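(* Let $\Gamma$ be a finitely generated, infinite group which does not have the Haagerup property and let $\mathcal G$ be the Cayley graph of $\Gamma$ with respect to a finite symmetric generating set. Suppose that for every $p\in(0,1)$ the two-point function $\tau_p(\cdot,\cdot)$ of $p$-Bernoulli bond percolation on $\mathcal G$ vanishes at infinity if and only if $\inf_{g,h\in\Gamma}\tau_p(g,h)=0$. Then $p_u(\mathcal G)<1$. Moreover, $p_u(\mathcal G)$-Bernoulli bond percolation does not have a unique infinite cluster.
   Context: In $p$-Bernoulli bond percolation on $\mathcal G$, each edge is kept independently with probability $p$; clusters are the connected components of the resulting subgraph; $\tau_p(g,h)$ is the probability that $g$ and $h$ are in the same cluster. $\tau_p$ vanishes at infinity if $\lim_{r\to\infty}\sup_{d(g,h)>r}\tau_p(g,h)=0$, with $d$ the graph distance. The uniqueness threshold $p_u(\mathcal G)$ is the infimum of all $p\in[0,1]$ such that $p$-Bernoulli bond percolation has a unique infinite cluster almost surely. (On a Cayley graph the number of infinite clusters is almost surely constant.) $\Gamma$ has the Haagerup property if it admits an affine isometric action on a Hilbert space $H$ which is metrically proper, i.e. for every bounded $B\subset H$ the set $\{g\in\Gamma:gB\cap B\ne\emptyset\}$ is finite. *)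

theory Defs
  imports "HOL-Probability.Probability" "HOL-Algebra.Algebra"
begin

section \<open>Hilbert spaces on a carrier set\<close>

text \<open>
  Real Hilbert spaces with an explicit carrier, so that one can quantify over all of them inside a
  formula (which is impossible for the type class of complete real inner product spaces).
  A complex Hilbert space is in particular a real one, with the real part of its inner product.
\<close>

definition real_ring :: "real ring" where
  "real_ring = \<lparr>carrier = UNIV, monoid.mult = (*), one = 1, ring.zero = 0, ring.add = (+)\<rparr>"

lemma real_ring_simps [simp]:
  "carrier real_ring = UNIV" "x \<otimes>\<^bsub>real_ring\<^esub> y = x * y" "\<one>\<^bsub>real_ring\<^esub> = 1"
  "\<zero>\<^bsub>real_ring\<^esub> = 0" "x \<oplus>\<^bsub>real_ring\<^esub> y = x + y"
  by (simp_all add: real_ring_def)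

record 'v inner_space = "(real, 'v) module" +
  ip :: "'v \<Rightarrow> 'v \<Rightarrow> real"

text \<open>
  The distance is set to 0 outside the carrier because \<^locale>\<open>Metric_space\<close> demands symmetry and
  nonnegativity on the whole type.
\<close>

definition ip_dist :: "('v, 'm) inner_space_scheme \<Rightarrow> 'v \<Rightarrow> 'v \<Rightarrow> real" where
  "ip_dist H x y =
     (if x \<in> carrier H \<and> y \<in> carrier H then sqrt (ip H (x \<ominus>\<^bsub>H\<^esub> y) (x \<ominus>\<^bsub>H\<^esub> y)) else 0)"

locale inner_product_space = Module.module real_ring H
  for H :: "('v, 'm) inner_space_scheme" (structure) +
  assumes ip_commute: "\<lbrakk>x \<in> carrier H; y \<in> carrier H\<rbrakk> \<Longrightarrow> ip H x y = ip H y x"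
    and ip_add_left: "\<lbrakk>x \<in> carrier H; y \<in> carrier H; z \<in> carrier H\<rbrakk>
          \<Longrightarrow> ip H (x \<oplus>\<^bsub>H\<^esub> y) z = ip H x z + ip H y z"
    and ip_scale_left: "\<lbrakk>x \<in> carrier H; y \<in> carrier H\<rbrakk> \<Longrightarrow> ip H (c \<odot>\<^bsub>H\<^esub> x) y = c * ip H x y"
    and ip_pos: "\<lbrakk>x \<in> carrier H; x \<noteq> \<zero>\<^bsub>H\<^esub>\<rbrakk> \<Longrightarrow> 0 < ip H x x"
begin

lemma ip_zero_left [simp]: "x \<in> carrier H \<Longrightarrow> ip H \<zero>\<^bsub>H\<^esub> x = 0"
  using ip_add_left[of "\<zero>\<^bsub>H\<^esub>" "\<zero>\<^bsub>H\<^esub>" x] by simp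

lemma ip_nonneg: "x \<in> carrier H \<Longrightarrow> 0 \<le> ip H x x"
  using ip_pos[of x] by (cases "x = \<zero>\<^bsub>H\<^esub>") auto

lemma ip_minus_left: "\<lbrakk>x \<in> carrier H; y \<in> carrier H\<rbrakk> \<Longrightarrow> ip H (\<ominus>\<^bsub>H\<^esub> x) y = - ip H x y"
  using ip_add_left[of x "\<ominus>\<^bsub>H\<^esub> x" y] by (simp add: M.r_neg)

lemma ip_add_right: "\<lbrakk>x \<in> carrier H; y \<in> carrier H; z \<in> carrier H\<rbrakk>
    \<Longrightarrow> ip H z (x \<oplus>\<^bsub>H\<^esub> y) = ip H z x + ip H z y"
  by (simp add: ip_commute[of z] ip_add_left)

lemma ip_scale_right:
  "\<lbrakk>x \<in> carrier H; y \<in> carrier H\<rbrakk> \<Longrightarrow> ip H y (c \<odot>\<^bsub>H\<^esub> x) = c * ip H y x"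
  by (simp add: ip_commute[of y] ip_scale_left)

lemma ip_Cauchy_Schwarz:
  assumes x: "x \<in> carrier H" and y: "y \<in> carrier H"
  shows "(ip H x y)\<^sup>2 \<le> ip H x x * ip H y y"
proof (cases "y = \<zero>\<^bsub>H\<^esub>")
  case True
  then show ?thesis using x by (simp add: ip_commute[of x "\<zero>\<^bsub>H\<^esub>"])
next
  case False
  define a b where "a = ip H y y" and "b = - ip H x y"
  have a: "a > 0" using False y ip_pos by (simp add: a_def)
  let ?z = "a \<odot>\<^bsub>H\<^esub> x \<oplus>\<^bsub>H\<^esub> b \<odot>\<^bsub>H\<^esub> y"
  have cl: "a \<odot>\<^bsub>H\<^esub> x \<in> carrier H" "b \<odot>\<^bsub>H\<^esub> y \<in> carrier H"
    using x y by (auto intro: smult_closed)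
  have "0 \<le> ip H ?z ?z" using cl by (intro ip_nonneg) auto
  also have "ip H ?z ?z = a * (a * ip H x x) + 2 * (a * b * ip H x y) + b * (b * a)"
    using x y cl
    by (simp add: ip_add_left ip_add_right ip_scale_left ip_scale_right ip_commute[of y x] a_def
        algebra_simps)
  also have "\<dots> = a * (ip H x x * ip H y y - (ip H x y)\<^sup>2)"
    by (simp add: a_def b_def power2_eq_square algebra_simps)
  finally show ?thesis using a by (simp add: zero_le_mult_iff)
qed

lemma Metric_space_ip_dist: "Metric_space (carrier H) (ip_dist H)"
proof
  fix x y
  show "0 \<le> ip_dist H x y" by (simp add: ip_dist_def ip_nonneg)
  have sw: "ip H (x \<ominus>\<^bsub>H\<^esub> y) (x \<ominus>\<^bsub>H\<^esub> y) = ip H (y \<ominus>\<^bsub>H\<^esub> x) (y \<ominus>\<^bsub>H\<^esub> x)"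
    if "x \<in> carrier H" "y \<in> carrier H"
  proof -
    have "y \<ominus>\<^bsub>H\<^esub> x = \<ominus>\<^bsub>H\<^esub> (x \<ominus>\<^bsub>H\<^esub> y)"
      using that by (simp add: M.minus_eq M.minus_add M.a_comm)
    moreover have "ip H (\<ominus>\<^bsub>H\<^esub> w) (\<ominus>\<^bsub>H\<^esub> w) = ip H w w" if w: "w \<in> carrier H" for w
      using w ip_minus_left[of w "\<ominus>\<^bsub>H\<^esub> w"] ip_minus_left[of w w] ip_commute[of w "\<ominus>\<^bsub>H\<^esub> w"]
      by simp
    ultimately show ?thesis using that by simp
  qed
  then show "ip_dist H x y = ip_dist H y x" by (auto simp: ip_dist_def)
  assume xy: "x \<in> carrier H" "y \<in> carrier H"
  have "ip H (x \<ominus>\<^bsub>H\<^esub> y) (x \<ominus>\<^bsub>H\<^esub> y) = 0 \<longleftrightarrow> x \<ominus>\<^bsub>H\<^esub> y = \<zero>\<^bsub>H\<^esub>"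
    using xy ip_pos[of "x \<ominus>\<^bsub>H\<^esub> y"] by fastforce
  moreover have eq0: "x \<ominus>\<^bsub>H\<^esub> y = \<zero>\<^bsub>H\<^esub> \<longleftrightarrow> x = y"
    using xy by (metis M.minus_eq M.a_inv_closed M.minus_equality M.minus_minus M.r_neg)
  ultimately show "ip_dist H x y = 0 \<longleftrightarrow> x = y"
    using xy eq0 by (simp add: ip_dist_def)
  fix z assume z: "z \<in> carrier H"
  let ?u = "x \<ominus>\<^bsub>H\<^esub> y" and ?v = "y \<ominus>\<^bsub>H\<^esub> z"
  have uv: "?u \<in> carrier H" "?v \<in> carrier H" using xy z by auto
  have eq: "x \<ominus>\<^bsub>H\<^esub> z = ?u \<oplus>\<^bsub>H\<^esub> ?v"
  proof -
    have "?u \<oplus>\<^bsub>H\<^esub> ?v = x \<oplus>\<^bsub>H\<^esub> ((\<ominus>\<^bsub>H\<^esub> y \<oplus>\<^bsub>H\<^esub> y) \<oplus>\<^bsub>H\<^esub> \<ominus>\<^bsub>H\<^esub> z)"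
      using xy z by (simp add: M.minus_eq M.a_assoc)
    then show ?thesis using xy z by (simp add: M.l_neg M.minus_eq)
  qed
  have "ip H ?u ?v \<le> sqrt (ip H ?u ?u) * sqrt (ip H ?v ?v)"
    using real_le_rsqrt[OF ip_Cauchy_Schwarz[OF uv]] by (simp add: real_sqrt_mult)
  then have "ip H (?u \<oplus>\<^bsub>H\<^esub> ?v) (?u \<oplus>\<^bsub>H\<^esub> ?v) \<le> (sqrt (ip H ?u ?u) + sqrt (ip H ?v ?v))\<^sup>2"
    using uv by (simp add: ip_add_left ip_add_right ip_commute[of ?v ?u] power2_sum ip_nonneg)
  then show "ip_dist H x z \<le> ip_dist H x y + ip_dist H y z"
    using xy z uv by (simp add: ip_dist_def eq real_le_lsqrt ip_nonneg)
qed

end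

locale real_hilbert_space = inner_product_space +
  assumes complete: "Metric_space.mcomplete (carrier H) (ip_dist H)"


section \<open>The Haagerup property\<close>

definition affine_isometric_action ::
  "('a, 'b) monoid_scheme \<Rightarrow> ('v, 'm) inner_space_scheme \<Rightarrow> ('a \<Rightarrow> 'v \<Rightarrow> 'v) \<Rightarrow> bool" where
  "affine_isometric_action G H \<alpha> \<longleftrightarrow>
     group_action G (carrier H) \<alpha> \<and>
     (\<forall>g\<in>carrier G. \<forall>x\<in>carrier H. \<forall>y\<in>carrier H.
        (\<forall>t::real. \<alpha> g (t \<odot>\<^bsub>H\<^esub> x \<oplus>\<^bsub>H\<^esub> (1 - t) \<odot>\<^bsub>H\<^esub> y) = t \<odot>\<^bsub>H\<^esub> \<alpha> g x \<oplus>\<^bsub>H\<^esub> (1 - t) \<odot>\<^bsub>H\<^esub> \<alpha> g y) \<and>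
        ip_dist H (\<alpha> g x) (\<alpha> g y) = ip_dist H x y)"

definition metrically_proper ::
  "('a, 'b) monoid_scheme \<Rightarrow> ('v, 'm) inner_space_scheme \<Rightarrow> ('a \<Rightarrow> 'v \<Rightarrow> 'v) \<Rightarrow> bool" where
  "metrically_proper G H \<alpha> \<longleftrightarrow>
     (\<forall>B. B \<subseteq> carrier H \<and> Metric_space.mbounded (carrier H) (ip_dist H) B \<longrightarrow>
        finite {g \<in> carrier G. \<alpha> g ` B \<inter> B \<noteq> {}})"

text \<open>
  HOL cannot quantify over types, so the carriers of the Hilbert spaces are arbitrary subsets of
  one fixed type, \<^typ>\<open>'a \<Rightarrow> real\<close>, where \<^typ>\<open>'a\<close> is the type of the group elements. This is no
  restriction. Given a proper affine isometric action on any Hilbert space, the closed affine span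
  of an orbit is invariant, hence (with a point of it as origin) a Hilbert space with a
  proper action; it has a dense subset of cardinality at most \<open>max \<aleph>\<^sub>0 \<bar>'a\<bar>\<close>, so it has at most
  as many elements as \<^typ>\<open>'a \<Rightarrow> real\<close> and can be transported to a subset of that type.
\<close>

definition haagerup :: "('a, 'b) monoid_scheme \<Rightarrow> bool" where
  "haagerup G \<longleftrightarrow>
     (\<exists>(H :: ('a \<Rightarrow> real) inner_space) \<alpha>.
        real_hilbert_space H \<and> affine_isometric_action G H \<alpha> \<and> metrically_proper G H \<alpha>)"


section \<open>Bernoulli bond percolation\<close>

text \<open>
  A graph is given by its vertex set \<open>V\<close> and its set \<open>E\<close> of two-element edges. In a configuration
  \<open>\<omega>\<close> an edge \<open>e \<in> E\<close> is kept iff \<open>\<omega> e\<close>.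
\<close>

definition adj :: "'a set set \<Rightarrow> 'a rel" where
  "adj E = {(x, y). {x, y} \<in> E}"

text \<open>Only meaningful if \<open>x\<close> and \<open>y\<close> are joined by a path.\<close>

definition graph_dist :: "'a set set \<Rightarrow> 'a \<Rightarrow> 'a \<Rightarrow> nat" where
  "graph_dist E x y = (LEAST n. (x, y) \<in> adj E ^^ n)"

definition percolation :: "'a set set \<Rightarrow> real \<Rightarrow> ('a set \<Rightarrow> bool) measure" where
  "percolation E p = (\<Pi>\<^sub>M e\<in>E. measure_pmf (bernoulli_pmf p))"

definition same_cluster :: "'a set \<Rightarrow> 'a set set \<Rightarrow> ('a set \<Rightarrow> bool) \<Rightarrow> 'a rel" where
  "same_cluster V E \<omega> = {(x, y) \<in> V \<times> V. (x, y) \<in> (adj {e \<in> E. \<omega> e})\<^sup>*}"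

definition clusters :: "'a set \<Rightarrow> 'a set set \<Rightarrow> ('a set \<Rightarrow> bool) \<Rightarrow> 'a set set" where
  "clusters V E \<omega> = V // same_cluster V E \<omega>"

definition unique_infinite_cluster :: "'a set \<Rightarrow> 'a set set \<Rightarrow> ('a set \<Rightarrow> bool) \<Rightarrow> bool" where
  "unique_infinite_cluster V E \<omega> \<longleftrightarrow> (\<exists>!C. C \<in> clusters V E \<omega> \<and> infinite C)"

definition two_point :: "'a set \<Rightarrow> 'a set set \<Rightarrow> real \<Rightarrow> 'a \<Rightarrow> 'a \<Rightarrow> real" where
  "two_point V E p x y =
     measure (percolation E p) {\<omega> \<in> space (percolation E p). (x, y) \<in> same_cluster V E \<omega>}"

text \<open>
  Used for infinite, connected, locally finite graphs only, where the suprema are over nonempty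
  sets of reals bounded by 1.
\<close>

definition two_point_vanishes_at_infinity :: "'a set \<Rightarrow> 'a set set \<Rightarrow> real \<Rightarrow> bool" where
  "two_point_vanishes_at_infinity V E p \<longleftrightarrow>
     (\<lambda>r::nat. SUP (x, y) \<in> {(x, y) \<in> V \<times> V. graph_dist E x y > r}. two_point V E p x y)
       \<longlonglongrightarrow> 0"

definition uniqueness_threshold :: "'a set \<Rightarrow> 'a set set \<Rightarrow> real" where
  "uniqueness_threshold V E =
     Inf {p \<in> {0..1}. AE \<omega> in percolation E p. unique_infinite_cluster V E \<omega>}"

text \<open>
  The edges of the (right) Cayley graph on the vertex set \<^term>\<open>carrier G\<close>. If the identity is in
  \<open>S\<close>, the resulting loops are omitted; they do not influence connectivity.
\<close>

definition cayley_edges :: "('a, 'b) monoid_scheme \<Rightarrow> 'a set \<Rightarrow> 'a set set" where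
  "cayley_edges G S = {{g, g \<otimes>\<^bsub>G\<^esub> s} | g s. g \<in> carrier G \<and> s \<in> S \<and> s \<noteq> \<one>\<^bsub>G\<^esub>}"

end

theory Submission
  imports Defs "HOL-Real_Asymp.Real_Asymp"
begin

text \<open>
  Let \<open>u\<close> be the uniqueness threshold. There is uniqueness at 1 and none at 0, and uniqueness obeys a
  zero-one law, so it suffices to refute that there is a unique infinite cluster at \<open>u > 0\<close>.

  Long-range order at \<open>p\<close> (the two-point function \<open>\<tau>\<close> is at least \<open>c > 0\<close>) implies uniqueness at every
  larger parameter: \<open>\<tau>\<close> is the Gram kernel of vectors indexed by the group, and the vector of minimal
  norm in their closed convex hull is nonzero and invariant. It gives every \<open>p\<close>-cluster \<open>C\<close> a weight
  \<open>f(C)\<^sup>2\<close> with finite expected total, that is, an invariant way to pick a random \<open>p\<close>-cluster. By mass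
  transport, an infinite cluster of the larger parameter has no or infinitely many points at the
  minimal distance from the picked cluster; if this distance is positive, there are infinitely many
  chances to decrease it by one additional open edge. So every infinite cluster meets the picked one.
  Consequently \<open>\<tau>\<close> has infimum 0 below \<open>u\<close>, and by assumption it vanishes at infinity there.

  If there were a unique infinite cluster at \<open>u\<close>, then moving every point equivariantly to a point of
  this cluster and thinning the cluster slightly gives invariant positive definite functions that
  vanish at infinity and tend to 1, so the group has the Haagerup property.
\<close>

section \<open>Positive semidefinite kernels and their Hilbert spaces\<close>

text \<open>The picked cluster is never built as a random object, since the vector of minimal norm
  exists only in a completion. Its substitute is the functional \<open>Q\<close> on bounded
  observables of clusters, a limit of quadratic forms along a minimizing sequence; that the picked
  cluster almost surely lacks a property means that \<open>Q\<close> vanishes on the indicator of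
  the property. A cluster is named by any of its points, so observables are functions of a
  configuration and a point that are constant along clusters. All positivity in the percolation part
  has one source: the 0-1 kernel of an equivalence relation is positive semidefinite, being a sum of
  squares over the classes. Thinning is forced because the two-point function is only known to
  vanish strictly below \<open>u\<close>: keeping edges of the \<open>u\<close>-configuration with
  probability \<open>q < 1\<close> leaves percolation at \<open>u q < u\<close>, while the target
  points are still chosen by the unthinned configuration, where uniqueness puts them all into one
  cluster. Hilbert spaces arise as reproducing kernel spaces because their elements are functions on
  the group, the type that \<open>haagerup\<close> demands.\<close>

text \<open>A list of pairs of a coefficient and a point stands for a finite formal combination of
  points; only the values of bilinear forms on such lists matter, so that no normal form is needed.\<close>

definition form :: "('a \<Rightarrow> 'a \<Rightarrow> real) \<Rightarrow> (real \<times> 'a) list \<Rightarrow> (real \<times> 'a) list \<Rightarrow> real" where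
  "form K a b = (\<Sum>p\<leftarrow>a. \<Sum>q\<leftarrow>b. fst p * fst q * K (snd p) (snd q))"

definition scale_comb :: "real \<Rightarrow> (real \<times> 'a) list \<Rightarrow> (real \<times> 'a) list" where
  "scale_comb t a = map (\<lambda>p. (t * fst p, snd p)) a"

definition diff_comb :: "(real \<times> 'a) list \<Rightarrow> (real \<times> 'a) list \<Rightarrow> (real \<times> 'a) list" where
  "diff_comb a b = a @ scale_comb (-1) b"

definition points :: "(real \<times> 'a) list \<Rightarrow> 'a set" where
  "points a = snd ` set a"

lemma points_simps [simp]:
  "points [] = {}" "points (p # a) = insert (snd p) (points a)" "points (a @ b) = points a \<union> points b"
  "points (scale_comb t a) = points a" "points (diff_comb a b) = points a \<union> points b"
  by (force simp: points_def scale_comb_def diff_comb_def image_image case_prod_beta)+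

lemma form_Nil [simp]: "form K [] b = 0" "form K a [] = 0"
  by (induction a) (auto simp: form_def)

lemma form_append: "form K (a @ b) c = form K a c + form K b c"
  "form K c (a @ b) = form K c a + form K c b"
  by (simp_all add: form_def sum_list_addf)

lemma form_scale: "form K (scale_comb t a) b = t * form K a b"
  "form K a (scale_comb t b) = t * form K a b"
  by (simp_all add: form_def scale_comb_def o_def sum_list_const_mult[symmetric] mult_ac)

lemma form_diff: "form K (diff_comb a b) c = form K a c - form K b c"
  "form K c (diff_comb a b) = form K c a - form K c b"
  by (auto simp: diff_comb_def form_append form_scale)

lemmas form_simps = form_append form_scale form_diff

lemma form_Cons_right: "form K a ((d, y) # b) = d * form K a [(1, y)] + form K a b"
  using form_append(2)[of K a "[(d, y)]" b] form_scale(2)[of K a d "[(1, y)]"]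
  by (simp add: scale_comb_def)

lemma form_single: "form K [(c, x)] [(d, y)] = c * d * K x y"
  by (simp add: form_def)

lemma form_add_kernel: "form (\<lambda>x y. K x y + L x y) a b = form K a b + form L a b"
  by (simp add: form_def distrib_left sum_list_addf)

lemma form_scale_kernel: "form (\<lambda>x y. t * K x y) a b = t * form K a b"
  by (simp add: form_def sum_list_const_mult[symmetric] mult_ac)

lemma form_diff_kernel: "form (\<lambda>x y. K x y - L x y) a b = form K a b - form L a b"
  using form_add_kernel[of K "\<lambda>x y. (-1) * L x y"] form_scale_kernel[of "-1" L] by simp

lemma form_map: "form K (map (map_prod id f) a) (map (map_prod id f) b) =
    form (\<lambda>x y. K (f x) (f y)) a b"
  by (simp add: form_def o_def)

lemma sum_list_cong: "(\<And>x. x \<in> set xs \<Longrightarrow> f x = g x) \<Longrightarrow> (\<Sum>x\<leftarrow>xs. f x) = (\<Sum>x\<leftarrow>xs. g x)"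
  by (metis map_eq_conv)

lemma form_cong: "(\<And>x y. x \<in> points a \<Longrightarrow> y \<in> points b \<Longrightarrow> K x y = L x y) \<Longrightarrow> form K a b = form L a b"
  unfolding form_def points_def by (intro sum_list_cong) auto

lemma form_swap: "form K a b = form (\<lambda>x y. K y x) b a"
proof (induction a)
  case (Cons p a)
  then show ?case
    using form_append(2)[of "\<lambda>x y. K y x" b "[p]" a]
    by (simp add: form_def mult_ac)
qed simp

text \<open>A kernel that ignores one argument factors through the total weight. Such kernels appear
  whenever a Gram kernel is rebased at another point, since the mixed terms then depend on one
  argument only.\<close>

lemma form_left: "form (\<lambda>x y. u x) a b = (\<Sum>p\<leftarrow>a. fst p * u (snd p)) * (\<Sum>p\<leftarrow>b. fst p)"
  by (induction a) (auto simp: form_def algebra_simps sum_list_const_mult[symmetric])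

lemma form_right: "form (\<lambda>x y. u y) a b = (\<Sum>p\<leftarrow>a. fst p) * (\<Sum>p\<leftarrow>b. fst p * u (snd p))"
  using form_swap[of "\<lambda>x y. u y" a b] form_left[of u b a] by (simp add: mult.commute)

section \<open>The seminorm of a positive semidefinite kernel\<close>

locale psd_kernel =
  fixes V :: "'a set" and K :: "'a \<Rightarrow> 'a \<Rightarrow> real"
  assumes sym: "\<lbrakk>x \<in> V; y \<in> V\<rbrakk> \<Longrightarrow> K x y = K y x"
    and form_nonneg: "points a \<subseteq> V \<Longrightarrow> 0 \<le> form K a a"
begin

lemma form_commute: "\<lbrakk>points a \<subseteq> V; points b \<subseteq> V\<rbrakk> \<Longrightarrow> form K a b = form K b a"
  by (subst form_swap, rule form_cong) (auto intro: sym)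

definition snorm :: "(real \<times> 'a) list \<Rightarrow> real" where
  "snorm a = sqrt (form K a a)"

lemma snorm_nonneg: "points a \<subseteq> V \<Longrightarrow> 0 \<le> snorm a"
  by (simp add: snorm_def form_nonneg)

lemma snorm_power2: "points a \<subseteq> V \<Longrightarrow> (snorm a)\<^sup>2 = form K a a"
  by (simp add: snorm_def form_nonneg)

text \<open>The quadratic form at \<open>s a + t b\<close> is nonnegative for all \<open>s\<close>
  and \<open>t\<close>. The form may be degenerate, so \<open>r = 0\<close> needs its own
  argument.\<close>

lemma Cauchy_Schwarz_square:
  assumes a: "points a \<subseteq> V" and b: "points b \<subseteq> V"
  shows "(form K a b)\<^sup>2 \<le> form K a a * form K b b"
proof -
  define p q r where "p = form K a a" and "q = form K a b" and "r = form K b b"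
  have ineq: "0 \<le> s * s * p + 2 * s * t * q + t * t * r" for s t
  proof -
    have "0 \<le> form K (scale_comb s a @ scale_comb t b) (scale_comb s a @ scale_comb t b)"
      using a b by (intro form_nonneg) auto
    then show ?thesis
      using form_commute[OF a b] by (simp add: form_simps p_def q_def r_def algebra_simps)
  qed
  have p: "p \<ge> 0" and r: "r \<ge> 0"
    using a b by (auto simp: p_def r_def form_nonneg)
  have "q\<^sup>2 \<le> p * r"
  proof (cases "r = 0")
    case True
    have "q = 0"
    proof (rule ccontr)
      assume "q \<noteq> 0"
      \<comment> \<open>For this \<open>t\<close> and \<open>s = 1\<close> the value
        \<open>p + 2 t q\<close> is -1.\<close>
      with ineq[of 1 "- (p + 1) / (2 * q)"] True p show False by (simp add: field_simps)
    qed
    then show ?thesis using True by simp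
  next
    case False
    \<comment> \<open>At \<open>s = r\<close>, \<open>t = - q\<close> the quadratic form takes this
      value.\<close>
    have "0 \<le> r * (p * r - q\<^sup>2)"
      using ineq[of r "-q"] by (simp add: algebra_simps power2_eq_square)
    then show ?thesis using False r by (simp add: zero_le_mult_iff)
  qed
  then show ?thesis by (simp add: p_def q_def r_def)
qed

lemma Cauchy_Schwarz:
  assumes a: "points a \<subseteq> V" and b: "points b \<subseteq> V"
  shows "\<bar>form K a b\<bar> \<le> snorm a * snorm b"
  using real_sqrt_le_mono[OF Cauchy_Schwarz_square[OF a b]]
  by (simp add: snorm_def real_sqrt_mult)

lemma snorm_append:
  assumes a: "points a \<subseteq> V" and b: "points b \<subseteq> V"
  shows "snorm (a @ b) \<le> snorm a + snorm b"
proof -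
  have "form K (a @ b) (a @ b) \<le> (snorm a + snorm b)\<^sup>2"
    using Cauchy_Schwarz[OF a b] form_commute[OF a b]
    by (simp add: form_simps power2_sum snorm_power2 a b)
  then show ?thesis
    unfolding snorm_def[of "a @ b"] using snorm_nonneg[OF a] snorm_nonneg[OF b]
    by (intro real_le_lsqrt) auto
qed

lemma snorm_scale: "snorm (scale_comb t a) = \<bar>t\<bar> * snorm a"
  by (simp add: snorm_def form_simps real_sqrt_mult mult.assoc[symmetric])

lemma form_diff_diff:
  assumes a: "points a \<subseteq> V" and b: "points b \<subseteq> V"
  shows "form K (diff_comb a b) (diff_comb a b) = form K a a - 2 * form K a b + form K b b"
  using form_commute[OF a b] by (simp add: form_simps)

lemma snorm_diff_commute:
  assumes a: "points a \<subseteq> V" and b: "points b \<subseteq> V"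
  shows "snorm (diff_comb a b) = snorm (diff_comb b a)"
  using form_commute[OF a b] by (simp add: snorm_def form_diff_diff a b)

lemma snorm_diff_triangle:
  assumes "points a \<subseteq> V" "points b \<subseteq> V" "points c \<subseteq> V"
  shows "snorm (diff_comb a c) \<le> snorm (diff_comb a b) + snorm (diff_comb b c)"
proof -
  have "form K (diff_comb a c) (diff_comb a c) =
      form K (diff_comb a b @ diff_comb b c) (diff_comb a b @ diff_comb b c)"
    by (simp add: form_simps)
  then have "snorm (diff_comb a c) = snorm (diff_comb a b @ diff_comb b c)"
    by (simp add: snorm_def)
  also have "\<dots> \<le> snorm (diff_comb a b) + snorm (diff_comb b c)"
    using assms by (intro snorm_append) auto
  finally show ?thesis .
qed

lemma snorm_diff_ge:
  assumes "points a \<subseteq> V" "points b \<subseteq> V"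
  shows "\<bar>snorm a - snorm b\<bar> \<le> snorm (diff_comb a b)"
proof -
  have *: "snorm (diff_comb c []) = snorm c" for c
    by (simp add: snorm_def form_simps)
  show ?thesis
    using snorm_diff_triangle[of a b "[]"] snorm_diff_triangle[of b a "[]"] assms
      snorm_diff_commute[of a b] by (auto simp: *)
qed

section \<open>Cauchy sequences of combinations\<close>

definition cauchy_comb :: "(nat \<Rightarrow> (real \<times> 'a) list) \<Rightarrow> bool" where
  "cauchy_comb a \<longleftrightarrow> (\<forall>n. points (a n) \<subseteq> V) \<and>
     (\<forall>e>0. \<exists>N. \<forall>m\<ge>N. \<forall>n\<ge>N. snorm (diff_comb (a m) (a n)) < e)"

lemma cauchy_combD:
  assumes "cauchy_comb a" "e > 0"
  obtains N where "\<And>m n. m \<ge> N \<Longrightarrow> n \<ge> N \<Longrightarrow> snorm (diff_comb (a m) (a n)) < e"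
  using assms unfolding cauchy_comb_def by blast

lemma cauchy_comb_points [simp]: "cauchy_comb a \<Longrightarrow> points (a n) \<subseteq> V"
  by (simp add: cauchy_comb_def)

lemma cauchy_comb_bounded:
  assumes "cauchy_comb a"
  obtains B where "B > 0" "\<And>n. snorm (a n) \<le> B"
proof -
  have "Cauchy (\<lambda>n. snorm (a n))"
  proof (rule CauchyI)
    fix e :: real assume "e > 0"
    then obtain N where N: "\<And>m n. m \<ge> N \<Longrightarrow> n \<ge> N \<Longrightarrow> snorm (diff_comb (a m) (a n)) < e"
      using cauchy_combD[OF assms] by blast
    show "\<exists>M. \<forall>m\<ge>M. \<forall>n\<ge>M. norm (snorm (a m) - snorm (a n)) < e"
    proof (intro exI allI impI)
      fix m n assume "m \<ge> N" "n \<ge> N"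
      then show "norm (snorm (a m) - snorm (a n)) < e"
        using N[of m n] snorm_diff_ge[of "a m" "a n"] cauchy_comb_points[OF assms] by simp
    qed
  qed
  then have "Bseq (\<lambda>n. snorm (a n))" by (rule Cauchy_Bseq)
  then obtain B where "B > 0" "\<And>n. norm (snorm (a n)) \<le> B" by (auto elim: BseqE)
  with that[of B] show ?thesis by (auto simp: abs_le_iff)
qed

lemma cauchy_comb_append:
  assumes "cauchy_comb a" "cauchy_comb b"
  shows "cauchy_comb (\<lambda>n. a n @ b n)"
  unfolding cauchy_comb_def
proof (intro conjI allI impI)
  fix e :: real assume "e > 0"
  obtain M where M: "\<And>m n. m \<ge> M \<Longrightarrow> n \<ge> M \<Longrightarrow> snorm (diff_comb (a m) (a n)) < e / 2"
    using cauchy_combD[OF assms(1), of "e / 2"] \<open>e > 0\<close> by auto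
  obtain N where N: "\<And>m n. m \<ge> N \<Longrightarrow> n \<ge> N \<Longrightarrow> snorm (diff_comb (b m) (b n)) < e / 2"
    using cauchy_combD[OF assms(2), of "e / 2"] \<open>e > 0\<close> by auto
  show "\<exists>N. \<forall>m\<ge>N. \<forall>n\<ge>N. snorm (diff_comb (a m @ b m) (a n @ b n)) < e"
  proof (intro exI allI impI)
    fix m n assume mn: "m \<ge> max M N" "n \<ge> max M N"
    have "snorm (diff_comb (a m @ b m) (a n @ b n)) =
        snorm (diff_comb (a m) (a n) @ diff_comb (b m) (b n))"
      by (simp add: snorm_def form_simps)
    also have "\<dots> \<le> snorm (diff_comb (a m) (a n)) + snorm (diff_comb (b m) (b n))"
      using assms by (intro snorm_append) auto
    also have "\<dots> < e" using M[of m n] N[of m n] mn by auto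
    finally show "snorm (diff_comb (a m @ b m) (a n @ b n)) < e" .
  qed
qed (use assms in auto)

lemma cauchy_comb_scale:
  assumes "cauchy_comb a"
  shows "cauchy_comb (\<lambda>n. scale_comb t (a n))"
  unfolding cauchy_comb_def
proof (intro conjI allI impI)
  fix e :: real assume "e > 0"
  obtain M where M: "\<And>m n. m \<ge> M \<Longrightarrow> n \<ge> M \<Longrightarrow> snorm (diff_comb (a m) (a n)) < e / (\<bar>t\<bar> + 1)"
    using cauchy_combD[OF assms(1), of "e / (\<bar>t\<bar> + 1)"] \<open>e > 0\<close> by auto
  show "\<exists>N. \<forall>m\<ge>N. \<forall>n\<ge>N. snorm (diff_comb (scale_comb t (a m)) (scale_comb t (a n))) < e"
  proof (intro exI allI impI)
    fix m n assume mn: "m \<ge> M" "n \<ge> M"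
    have "snorm (diff_comb (scale_comb t (a m)) (scale_comb t (a n))) =
        snorm (scale_comb t (diff_comb (a m) (a n)))"
      by (simp add: snorm_def form_simps algebra_simps)
    also have "\<dots> = \<bar>t\<bar> * snorm (diff_comb (a m) (a n))" by (rule snorm_scale)
    also have "\<dots> \<le> (\<bar>t\<bar> + 1) * snorm (diff_comb (a m) (a n))"
      using assms by (intro mult_right_mono snorm_nonneg) auto
    also have "\<dots> < e" using M[OF mn] by (simp add: pos_less_divide_eq mult.commute)
    finally show "snorm (diff_comb (scale_comb t (a m)) (scale_comb t (a n))) < e" .
  qed
qed (use assms in auto)

lemma cauchy_comb_diff:
  assumes "cauchy_comb a" "cauchy_comb b"
  shows "cauchy_comb (\<lambda>n. diff_comb (a n) (b n))"
  unfolding diff_comb_def using assms by (intro cauchy_comb_append cauchy_comb_scale)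

lemma cauchy_comb_const: "points c \<subseteq> V \<Longrightarrow> cauchy_comb (\<lambda>n. c)"
  by (auto simp: cauchy_comb_def snorm_def form_simps)

lemma convergent_form:
  assumes a: "cauchy_comb a" and b: "cauchy_comb b"
  shows "convergent (\<lambda>n. form K (a n) (b n))"
proof -
  obtain A where A: "A > 0" "\<And>n. snorm (a n) \<le> A" using cauchy_comb_bounded[OF a] by blast
  obtain B where B: "B > 0" "\<And>n. snorm (b n) \<le> B" using cauchy_comb_bounded[OF b] by blast
  have "Cauchy (\<lambda>n. form K (a n) (b n))"
  proof (rule CauchyI)
    fix e :: real assume "e > 0"
    define d where "d = e / (A + B)"
    have d: "d > 0" using A B \<open>e > 0\<close> by (simp add: d_def)
    obtain M where M: "\<And>m n. m \<ge> M \<Longrightarrow> n \<ge> M \<Longrightarrow> snorm (diff_comb (a m) (a n)) < d"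
      using cauchy_combD[OF a d] by auto
    obtain N where N: "\<And>m n. m \<ge> N \<Longrightarrow> n \<ge> N \<Longrightarrow> snorm (diff_comb (b m) (b n)) < d"
      using cauchy_combD[OF b d] by auto
    show "\<exists>M. \<forall>m\<ge>M. \<forall>n\<ge>M. norm (form K (a m) (b m) - form K (a n) (b n)) < e"
    proof (intro exI allI impI)
      fix m n assume mn: "m \<ge> max M N" "n \<ge> max M N"
      have "form K (a m) (b m) - form K (a n) (b n) =
          form K (diff_comb (a m) (a n)) (b m) + form K (a n) (diff_comb (b m) (b n))"
        by (simp add: form_simps)
      also have "\<bar>\<dots>\<bar> \<le> snorm (diff_comb (a m) (a n)) * snorm (b m) +
          snorm (a n) * snorm (diff_comb (b m) (b n))"
        using a b by (intro order_trans[OF abs_triangle_ineq] add_mono Cauchy_Schwarz) auto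
      also have "\<dots> \<le> snorm (diff_comb (a m) (a n)) * B + A * snorm (diff_comb (b m) (b n))"
        using a b A B by (intro add_mono mult_left_mono mult_right_mono snorm_nonneg) auto
      also have "\<dots> < d * B + A * d"
        using M[of m n] N[of m n] mn A B
        by (intro add_strict_mono mult_strict_left_mono mult_strict_right_mono) auto
      also have "\<dots> = d * (A + B)" by (simp add: algebra_simps)
      also have "\<dots> = e" using A B by (simp add: d_def)
      finally show "norm (form K (a m) (b m) - form K (a n) (b n)) < e" by simp
    qed
  qed
  then show ?thesis by (rule Cauchy_convergent)
qed

lemma form_tendsto_zero:
  assumes "\<And>y. y \<in> V \<Longrightarrow> (\<lambda>n. form K (a n) [(1, y)]) \<longlonglongrightarrow> 0" and "points d \<subseteq> V"
  shows "(\<lambda>n. form K (a n) d) \<longlonglongrightarrow> 0"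
  using assms(2)
proof (induction d)
  case (Cons p d)
  obtain t y where p: "p = (t, y)" by (cases p)
  have "(\<lambda>n. t * form K (a n) [(1, y)] + form K (a n) d) \<longlonglongrightarrow> t * 0 + 0"
    using Cons p by (intro tendsto_intros assms(1)) auto
  then show ?case by (simp add: p form_Cons_right[of K _ t y d])
qed simp

text \<open>This is why the completion is a space of functions: a Cauchy sequence whose evaluations
  all tend to 0 is a null sequence, so a limit function determines its approximating sequences up to
  null sequences. Splitting the form of \<open>c n\<close> with itself at a fixed late
  \<open>c N\<close>, the first part tends to 0 by assumption and the second is small by the Cauchy
  property and boundedness.\<close>

lemma snorm_tendsto_zero:
  assumes c: "cauchy_comb c" and lim: "\<And>y. y \<in> V \<Longrightarrow> (\<lambda>n. form K (c n) [(1, y)]) \<longlonglongrightarrow> 0"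
  shows "(\<lambda>n. snorm (c n)) \<longlonglongrightarrow> 0"
proof -
  obtain B where B: "B > 0" "\<And>n. snorm (c n) \<le> B" using cauchy_comb_bounded[OF c] by blast
  have "(\<lambda>n. form K (c n) (c n)) \<longlonglongrightarrow> 0"
  proof (rule LIMSEQ_I)
    fix e :: real assume e: "e > 0"
    obtain N where N: "\<And>m n. m \<ge> N \<Longrightarrow> n \<ge> N \<Longrightarrow> snorm (diff_comb (c m) (c n)) < e / (2 * B)"
      using cauchy_combD[OF c, of "e / (2 * B)"] e B by auto
    have "(\<lambda>n. form K (c n) (c N)) \<longlonglongrightarrow> 0"
      using form_tendsto_zero[of c "c N"] lim cauchy_comb_points[OF c] by blast
    then obtain M where M: "\<And>n. n \<ge> M \<Longrightarrow> \<bar>form K (c n) (c N)\<bar> < e / 2"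
      using LIMSEQ_D[of _ 0 "e / 2"] e by (metis diff_zero half_gt_zero real_norm_def)
    show "\<exists>M. \<forall>n\<ge>M. norm (form K (c n) (c n) - 0) < e"
    proof (intro exI allI impI)
      fix n assume n: "n \<ge> max M N"
      have "form K (c n) (c n) = form K (c n) (c N) + form K (c n) (diff_comb (c n) (c N))"
        by (simp add: form_simps)
      also have "\<bar>\<dots>\<bar> \<le> \<bar>form K (c n) (c N)\<bar> + snorm (c n) * snorm (diff_comb (c n) (c N))"
        using c by (intro order_trans[OF abs_triangle_ineq] add_mono Cauchy_Schwarz) auto
      also have "\<dots> \<le> \<bar>form K (c n) (c N)\<bar> + B * snorm (diff_comb (c n) (c N))"
        using B c by (intro add_mono mult_right_mono snorm_nonneg) auto
      also have "\<dots> < e / 2 + B * (e / (2 * B))"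
        using M[of n] N[of n N] n B by (intro add_strict_mono mult_strict_left_mono) auto
      also have "\<dots> = e" using B by simp
      finally show "norm (form K (c n) (c n) - 0) < e" by simp
    qed
  qed
  then have "(\<lambda>n. sqrt (form K (c n) (c n))) \<longlonglongrightarrow> sqrt 0" by (rule tendsto_real_sqrt)
  then show ?thesis by (simp add: snorm_def)
qed

text \<open>The reproducing kernel Hilbert space: a function on \<open>V\<close> belongs to it iff it is the pointwise
  limit of the functions represented by a Cauchy sequence of combinations.\<close>

definition approx :: "('a \<Rightarrow> real) \<Rightarrow> (nat \<Rightarrow> (real \<times> 'a) list) \<Rightarrow> bool" where
  "approx f a \<longleftrightarrow> cauchy_comb a \<and> (\<forall>y\<in>V. (\<lambda>n. form K (a n) [(1, y)]) \<longlonglongrightarrow> f y) \<and>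
     (\<forall>y. y \<notin> V \<longrightarrow> f y = 0)"

definition approx_seq :: "('a \<Rightarrow> real) \<Rightarrow> nat \<Rightarrow> (real \<times> 'a) list" where
  "approx_seq f = (SOME a. approx f a)"

definition rkhs_ip :: "('a \<Rightarrow> real) \<Rightarrow> ('a \<Rightarrow> real) \<Rightarrow> real" where
  "rkhs_ip f g = lim (\<lambda>n. form K (approx_seq f n) (approx_seq g n))"

text \<open>The elements are functions on the index type of the kernel; with the group as index set
  this is the type over which \<open>haagerup\<close> quantifies.\<close>

definition rkhs :: "('a \<Rightarrow> real) inner_space" where
  "rkhs = \<lparr>carrier = {f. \<exists>a. approx f a}, monoid.mult = \<lambda>f g. f, one = \<lambda>x. 0, ring.zero = \<lambda>x. 0,
     ring.add = \<lambda>f g x. f x + g x, smult = \<lambda>t f x. t * f x, ip = rkhs_ip\<rparr>"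

lemma rkhs_simps [simp]:
  "ring.zero rkhs = (\<lambda>x. 0)" "f \<oplus>\<^bsub>rkhs\<^esub> g = (\<lambda>x. f x + g x)" "t \<odot>\<^bsub>rkhs\<^esub> f = (\<lambda>x. t * f x)"
  "ip rkhs = rkhs_ip"
  by (simp_all add: rkhs_def)

lemma carrier_rkhs: "f \<in> carrier rkhs \<longleftrightarrow> (\<exists>a. approx f a)"
  by (simp add: rkhs_def)

lemma approx_in_carrier: "approx f a \<Longrightarrow> f \<in> carrier rkhs"
  by (auto simp: carrier_rkhs)

lemma approx_seq: "f \<in> carrier rkhs \<Longrightarrow> approx f (approx_seq f)"
  using someI_ex[of "approx f"] by (simp add: carrier_rkhs approx_seq_def)

lemma approx_cauchy: "approx f a \<Longrightarrow> cauchy_comb a"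
  by (simp add: approx_def)

lemma approx_unique:
  assumes "approx f a" "approx f b"
  shows "(\<lambda>n. snorm (diff_comb (a n) (b n))) \<longlonglongrightarrow> 0"
proof (rule snorm_tendsto_zero)
  show "cauchy_comb (\<lambda>n. diff_comb (a n) (b n))"
    using assms by (intro cauchy_comb_diff approx_cauchy)
  show "(\<lambda>n. form K (diff_comb (a n) (b n)) [(1, y)]) \<longlonglongrightarrow> 0" if "y \<in> V" for y
  proof -
    have "(\<lambda>n. form K (a n) [(1, y)] - form K (b n) [(1, y)]) \<longlonglongrightarrow> f y - f y"
      using assms that by (intro tendsto_intros) (auto simp: approx_def)
    then show ?thesis by (simp add: form_simps)
  qed
qed

text \<open>Well-definedness: two approximating sequences of the same function differ by a null
  sequence, and all of them are bounded. Every law of the inner product can therefore be checked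
  along convenient sequences.\<close>

lemma form_tendsto_rkhs_ip:
  assumes a: "approx f a" and b: "approx g b"
  shows "(\<lambda>n. form K (a n) (b n)) \<longlonglongrightarrow> rkhs_ip f g"
proof -
  define a' b' where "a' = approx_seq f" and "b' = approx_seq g"
  have a': "approx f a'" and b': "approx g b'"
    unfolding a'_def b'_def by (rule approx_seq[OF approx_in_carrier[OF a]] approx_seq[OF approx_in_carrier[OF b]])+
  note [simp] = a[THEN approx_cauchy] b[THEN approx_cauchy] a'[THEN approx_cauchy] b'[THEN approx_cauchy]
  obtain A where A: "A > 0" "\<And>n. snorm (a' n) \<le> A" using cauchy_comb_bounded[of a'] by auto
  obtain B where B: "B > 0" "\<And>n. snorm (b n) \<le> B" using cauchy_comb_bounded[of b] by auto
  have lim: "(\<lambda>n. form K (a' n) (b' n)) \<longlonglongrightarrow> rkhs_ip f g"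
    unfolding rkhs_ip_def a'_def[symmetric] b'_def[symmetric]
    using convergent_form[of a' b'] by (simp add: convergent_LIMSEQ_iff)
  have "(\<lambda>n. form K (a n) (b n) - form K (a' n) (b' n)) \<longlonglongrightarrow> 0"
  proof (rule Lim_null_comparison)
    show "(\<lambda>n. snorm (diff_comb (a n) (a' n)) * B + A * snorm (diff_comb (b n) (b' n))) \<longlonglongrightarrow> 0"
      using tendsto_add[OF tendsto_mult_right[OF approx_unique[OF a a'], of B]
          tendsto_mult_left[OF approx_unique[OF b b'], of A]] by simp
    show "\<forall>\<^sub>F n in sequentially. norm (form K (a n) (b n) - form K (a' n) (b' n)) \<le>
        snorm (diff_comb (a n) (a' n)) * B + A * snorm (diff_comb (b n) (b' n))"
    proof (intro always_eventually allI)
      fix n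
      have "form K (a n) (b n) - form K (a' n) (b' n) =
          form K (diff_comb (a n) (a' n)) (b n) + form K (a' n) (diff_comb (b n) (b' n))"
        by (simp add: form_simps)
      also have "\<bar>\<dots>\<bar> \<le> snorm (diff_comb (a n) (a' n)) * snorm (b n) +
          snorm (a' n) * snorm (diff_comb (b n) (b' n))"
        by (intro order_trans[OF abs_triangle_ineq] add_mono Cauchy_Schwarz) auto
      also have "\<dots> \<le> snorm (diff_comb (a n) (a' n)) * B + A * snorm (diff_comb (b n) (b' n))"
        using A B by (intro add_mono mult_left_mono mult_right_mono snorm_nonneg) auto
      finally show "norm (form K (a n) (b n) - form K (a' n) (b' n)) \<le>
        snorm (diff_comb (a n) (a' n)) * B + A * snorm (diff_comb (b n) (b' n))" by simp
    qed
  qed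
  from tendsto_add[OF this lim] show ?thesis by simp
qed

lemma rkhs_ip_eqI:
  assumes "approx f a" "approx g b" "(\<lambda>n. form K (a n) (b n)) \<longlonglongrightarrow> l"
  shows "rkhs_ip f g = l"
  using form_tendsto_rkhs_ip[OF assms(1,2)] assms(3) LIMSEQ_unique by blast

lemma approx_add:
  assumes "approx f a" "approx g b"
  shows "approx (\<lambda>x. f x + g x) (\<lambda>n. a n @ b n)"
  using assms unfolding approx_def by (auto intro!: cauchy_comb_append tendsto_add simp: form_simps)

lemma approx_scale:
  assumes "approx f a"
  shows "approx (\<lambda>x. t * f x) (\<lambda>n. scale_comb t (a n))"
  using assms unfolding approx_def by (auto intro!: cauchy_comb_scale tendsto_mult_left simp: form_simps)

lemma approx_diff:
  assumes "approx f a" "approx g b"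
  shows "approx (\<lambda>x. f x - g x) (\<lambda>n. diff_comb (a n) (b n))"
  using approx_add[OF assms(1) approx_scale[OF assms(2), of "-1"]] by (simp add: diff_comb_def)

lemma approx_const:
  assumes "points c \<subseteq> V"
  shows "approx (\<lambda>y. if y \<in> V then form K c [(1, y)] else 0) (\<lambda>n. c)"
  using assms by (auto simp: approx_def cauchy_comb_const)

lemma approx_zero: "approx (\<lambda>x. 0) (\<lambda>n. [])"
  by (auto simp: approx_def cauchy_comb_const)

lemma eval_le_snorm:
  assumes "points a \<subseteq> V" "y \<in> V"
  shows "\<bar>form K a [(1, y)]\<bar> \<le> snorm a * sqrt (K y y)"
  using Cauchy_Schwarz[of a "[(1, y)]"] assms by (simp add: snorm_def form_single)

text \<open>Point evaluations are bounded by the norm, so a function of norm 0 vanishes everywhere.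
  Passing to functions thus replaces the quotient by vectors of seminorm 0.\<close>

lemma rkhs_ip_eq_zeroD:
  assumes f: "f \<in> carrier rkhs" and "rkhs_ip f f = 0"
  shows "f = (\<lambda>x. 0)"
proof
  fix y
  note a = approx_seq[OF f]
  show "f y = 0"
  proof (cases "y \<in> V")
    case True
    have "(\<lambda>n. sqrt (form K (approx_seq f n) (approx_seq f n))) \<longlonglongrightarrow> 0"
      using tendsto_real_sqrt[OF form_tendsto_rkhs_ip[OF a a]] assms(2) by simp
    then have 0: "(\<lambda>n. snorm (approx_seq f n) * sqrt (K y y)) \<longlonglongrightarrow> 0"
      by (auto simp: snorm_def intro: tendsto_mult_left_zero)
    have "(\<lambda>n. form K (approx_seq f n) [(1, y)]) \<longlonglongrightarrow> 0"
      by (rule Lim_null_comparison[OF _ 0])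
        (use a True in \<open>simp add: eval_le_snorm cauchy_comb_points approx_cauchy\<close>)
    moreover have "(\<lambda>n. form K (approx_seq f n) [(1, y)]) \<longlonglongrightarrow> f y"
      using a True by (auto simp: approx_def)
    ultimately show ?thesis using LIMSEQ_unique by blast
  qed (use a in \<open>auto simp: approx_def\<close>)
qed

lemma cring_real_ring: "cring real_ring"
proof (rule cringI)
  show "abelian_group real_ring"
    by (rule abelian_groupI) (auto intro: exI[of _ "- x" for x])
  show "comm_monoid real_ring"
    by (rule comm_monoidI) auto
qed (auto simp: algebra_simps)

lemma abelian_group_rkhs: "abelian_group rkhs"
proof (rule abelian_groupI)
  fix f assume "f \<in> carrier rkhs"
  then obtain a where a: "approx f a" by (auto simp: carrier_rkhs)
  show "\<exists>g\<in>carrier rkhs. g \<oplus>\<^bsub>rkhs\<^esub> f = \<zero>\<^bsub>rkhs\<^esub>"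
    using approx_in_carrier[OF approx_scale[OF a, of "-1"]]
    by (intro bexI[of _ "\<lambda>x. - f x"]) auto
qed (auto simp: carrier_rkhs add_ac intro: approx_add approx_zero)

lemma module_rkhs: "Module.module real_ring rkhs"
  by (rule moduleI[OF cring_real_ring abelian_group_rkhs])
    (auto simp: carrier_rkhs algebra_simps intro: approx_scale)

lemma inner_product_space_rkhs: "inner_product_space rkhs"
proof (intro inner_product_space.intro inner_product_space_axioms.intro module_rkhs)
  fix f g assume f: "f \<in> carrier rkhs" and g: "g \<in> carrier rkhs"
  show "ip rkhs f g = ip rkhs g f"
    using form_tendsto_rkhs_ip[OF approx_seq[OF g] approx_seq[OF f]]
      approx_cauchy[OF approx_seq[OF f]] approx_cauchy[OF approx_seq[OF g]]
    by (auto intro!: rkhs_ip_eqI[OF approx_seq[OF f] approx_seq[OF g]] simp: form_commute[OF cauchy_comb_points cauchy_comb_points])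
  show "ip rkhs (c \<odot>\<^bsub>rkhs\<^esub> f) g = c * ip rkhs f g" for c
    using tendsto_mult_left[OF form_tendsto_rkhs_ip[OF approx_seq[OF f] approx_seq[OF g]], of c]
    by (auto intro!: rkhs_ip_eqI[OF approx_scale[OF approx_seq[OF f]] approx_seq[OF g]] simp: form_simps)
  show "ip rkhs (f \<oplus>\<^bsub>rkhs\<^esub> g) h = ip rkhs f h + ip rkhs g h" if h: "h \<in> carrier rkhs" for h
    using tendsto_add[OF form_tendsto_rkhs_ip[OF approx_seq[OF f] approx_seq[OF h]]
        form_tendsto_rkhs_ip[OF approx_seq[OF g] approx_seq[OF h]]]
    by (auto intro!: rkhs_ip_eqI[OF approx_add[OF approx_seq[OF f] approx_seq[OF g]] approx_seq[OF h]]
        simp: form_simps)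
  assume "f \<noteq> \<zero>\<^bsub>rkhs\<^esub>"
  then have "rkhs_ip f f \<noteq> 0" using rkhs_ip_eq_zeroD[OF f] by auto
  moreover have "rkhs_ip f f \<ge> 0"
    by (rule LIMSEQ_le_const[OF form_tendsto_rkhs_ip[OF approx_seq[OF f] approx_seq[OF f]]])
      (use approx_cauchy[OF approx_seq[OF f]] in \<open>auto intro!: form_nonneg exI[of _ 0] dest: cauchy_comb_points\<close>)
  ultimately show "0 < ip rkhs f f" by simp
qed

sublocale rkhs: inner_product_space rkhs
  by (rule inner_product_space_rkhs)

lemma rkhs_minus: "f \<in> carrier rkhs \<Longrightarrow> g \<in> carrier rkhs \<Longrightarrow> f \<ominus>\<^bsub>rkhs\<^esub> g = (\<lambda>x. f x - g x)"
proof -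
  assume f: "f \<in> carrier rkhs" and g: "g \<in> carrier rkhs"
  have "\<ominus>\<^bsub>rkhs\<^esub> g = (\<lambda>x. - g x)"
  proof (rule rkhs.M.minus_equality)
    show "(\<lambda>x. - g x) \<in> carrier rkhs"
      using approx_in_carrier[OF approx_scale[OF approx_seq[OF g], of "-1"]] by simp
  qed (use g in auto)
  then show ?thesis using f g by (simp add: rkhs.M.minus_eq)
qed

lemma snorm_tendsto_ip_dist:
  assumes a: "approx f a" and b: "approx g b"
  shows "(\<lambda>n. snorm (diff_comb (a n) (b n))) \<longlonglongrightarrow> ip_dist rkhs f g"
  using tendsto_real_sqrt[OF form_tendsto_rkhs_ip[OF approx_diff[OF a b] approx_diff[OF a b]]]
    approx_in_carrier[OF a] approx_in_carrier[OF b]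
  by (simp add: ip_dist_def rkhs_minus snorm_def)

text \<open>Finite combinations are dense: regarding each member of the approximating sequence as an
  element of the space, these elements converge in norm to the function.\<close>

lemma approx_tendsto:
  assumes a: "approx f a"
  shows "(\<lambda>n. ip_dist rkhs (\<lambda>y. if y \<in> V then form K (a n) [(1, y)] else 0) f) \<longlonglongrightarrow> 0"
proof (rule LIMSEQ_I)
  fix e :: real assume "e > 0"
  note [simp] = approx_cauchy[OF a]
  obtain N where N: "\<And>m n. m \<ge> N \<Longrightarrow> n \<ge> N \<Longrightarrow> snorm (diff_comb (a m) (a n)) < e / 2"
    using cauchy_combD[of a "e / 2"] \<open>e > 0\<close> by auto
  have "ip_dist rkhs (\<lambda>y. if y \<in> V then form K (a n) [(1, y)] else 0) f \<le> e / 2" if "n \<ge> N" for n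
  proof (rule LIMSEQ_le_const2[OF snorm_tendsto_ip_dist[OF approx_const a]])
    show "\<exists>M. \<forall>m\<ge>M. snorm (diff_comb (a n) (a m)) \<le> e / 2"
      using N[OF that] by (auto intro!: exI[of _ N] less_imp_le)
  qed simp
  moreover have "ip_dist rkhs u v \<ge> 0" for u v
    by (rule Metric_space.nonneg[OF rkhs.Metric_space_ip_dist])
  ultimately show "\<exists>N. \<forall>n\<ge>N. norm (ip_dist rkhs (\<lambda>y. if y \<in> V then form K (a n) [(1, y)] else 0) f - 0) < e"
    using \<open>e > 0\<close> by (intro exI[of _ N]) (force intro: order.strict_trans1)
qed

text \<open>By density the \<open>n\<close>-th member of a Cauchy sequence is replaced by a finite
  combination at distance below \<open>1 / (n + 1)\<close>. These combinations are again Cauchy,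
  hence approximate an element of the space by definition, and that element is the limit.\<close>

lemma real_hilbert_space_rkhs: "real_hilbert_space rkhs"
proof (intro real_hilbert_space.intro real_hilbert_space_axioms.intro inner_product_space_rkhs)
  interpret M: Metric_space "carrier rkhs" "ip_dist rkhs"
    by (rule rkhs.Metric_space_ip_dist)
  let ?fun = "\<lambda>c y. if y \<in> V then form K c [(1, y)] else 0"
  show "M.mcomplete"
    unfolding M.mcomplete_def
  proof (intro allI impI)
    fix \<sigma> assume "M.MCauchy \<sigma>"
    then have \<sigma>: "\<And>n. \<sigma> n \<in> carrier rkhs"
      and C: "\<And>e. e > 0 \<Longrightarrow> \<exists>N. \<forall>m n. N \<le> m \<longrightarrow> N \<le> n \<longrightarrow> ip_dist rkhs (\<sigma> m) (\<sigma> n) < e"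
      by (auto simp: M.MCauchy_def)
    have "\<exists>c. points c \<subseteq> V \<and> ip_dist rkhs (?fun c) (\<sigma> n) < 1 / (n + 1)" for n
    proof -
      have "\<forall>\<^sub>F k in sequentially. ip_dist rkhs (?fun (approx_seq (\<sigma> n) k)) (\<sigma> n) < 1 / (n + 1)"
        using order_tendstoD(2)[OF approx_tendsto[OF approx_seq[OF \<sigma>[of n]]]] by simp
      then obtain k where "ip_dist rkhs (?fun (approx_seq (\<sigma> n) k)) (\<sigma> n) < 1 / (n + 1)"
        by (auto simp: eventually_sequentially)
      then show ?thesis using approx_cauchy[OF approx_seq[OF \<sigma>[of n]]] by (intro exI[of _ "approx_seq (\<sigma> n) k"]) (simp add: add.commute)
    qed
    then have "\<exists>c. \<forall>n. points (c n) \<subseteq> V \<and> ip_dist rkhs (?fun (c n)) (\<sigma> n) < 1 / (n + 1)"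
      by (intro choice allI)
    then obtain c where c: "\<And>n. points (c n) \<subseteq> V"
      and near: "\<And>n. ip_dist rkhs (?fun (c n)) (\<sigma> n) < 1 / (n + 1)"
      by blast
    have cc: "?fun (c n) \<in> carrier rkhs" for n
      by (rule approx_in_carrier[OF approx_const[OF c]])
    have sn: "snorm (diff_comb (c m) (c n)) = ip_dist rkhs (?fun (c m)) (?fun (c n))" for m n
      using snorm_tendsto_ip_dist[OF approx_const[OF c] approx_const[OF c]] by (simp add: LIMSEQ_const_iff)
    have inv0: "(\<lambda>n. 1 / (real n + 1)) \<longlonglongrightarrow> 0"
      using LIMSEQ_inverse_real_of_nat by (simp add: inverse_eq_divide add.commute)
    have cauchy: "cauchy_comb c"
      unfolding cauchy_comb_def
    proof (intro conjI allI impI c)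
      fix e :: real assume e: "e > 0"
      obtain N where N: "\<And>m n. N \<le> m \<Longrightarrow> N \<le> n \<Longrightarrow> ip_dist rkhs (\<sigma> m) (\<sigma> n) < e / 3"
        using C[of "e / 3"] e by auto
      obtain M where M: "\<And>n. n \<ge> M \<Longrightarrow> 1 / (real n + 1) < e / 3"
        using order_tendstoD(2)[OF inv0, of "e / 3"] e by (auto simp: eventually_sequentially)
      show "\<exists>N. \<forall>m\<ge>N. \<forall>n\<ge>N. snorm (diff_comb (c m) (c n)) < e"
      proof (intro exI allI impI)
        fix m n assume "m \<ge> max M N" "n \<ge> max M N"
        then have "ip_dist rkhs (?fun (c m)) (\<sigma> m) < e / 3" "ip_dist rkhs (?fun (c n)) (\<sigma> n) < e / 3"
          "ip_dist rkhs (\<sigma> m) (\<sigma> n) < e / 3"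
          using N M near[of m] near[of n] by (force intro: order.strict_trans)+
        moreover have "ip_dist rkhs (?fun (c m)) (?fun (c n)) \<le>
            ip_dist rkhs (?fun (c m)) (\<sigma> m) + (ip_dist rkhs (\<sigma> m) (\<sigma> n) + ip_dist rkhs (\<sigma> n) (?fun (c n)))"
          using M.triangle[OF cc[of m] \<sigma>[of m] cc[of n]] M.triangle[OF \<sigma>[of m] \<sigma>[of n] cc[of n]] by linarith
        ultimately show "snorm (diff_comb (c m) (c n)) < e"
          using M.commute[of "\<sigma> n" "?fun (c n)"] unfolding sn by linarith
      qed
    qed
    define f where "f y = (if y \<in> V then lim (\<lambda>n. form K (c n) [(1, y)]) else 0)" for y
    have f: "approx f c"
      unfolding approx_def
    proof (intro conjI ballI allI impI cauchy)
      fix y assume "y \<in> V"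
      then have "convergent (\<lambda>n. form K (c n) [(1, y)])"
        by (intro convergent_form[OF cauchy] cauchy_comb_const) auto
      then show "(\<lambda>n. form K (c n) [(1, y)]) \<longlonglongrightarrow> f y"
        using \<open>y \<in> V\<close> by (simp add: f_def convergent_LIMSEQ_iff)
    qed (auto simp: f_def)
    have "(\<lambda>n. ip_dist rkhs (\<sigma> n) f) \<longlonglongrightarrow> 0"
    proof (rule tendsto_sandwich[of "\<lambda>_. 0"])
      show "(\<lambda>n. 1 / (real n + 1) + ip_dist rkhs (?fun (c n)) f) \<longlonglongrightarrow> 0"
        using tendsto_add[OF inv0 approx_tendsto[OF f]] by simp
      show "\<forall>\<^sub>F n in sequentially. ip_dist rkhs (\<sigma> n) f \<le> 1 / (real n + 1) + ip_dist rkhs (?fun (c n)) f"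
      proof (intro always_eventually allI)
        fix n
        show "ip_dist rkhs (\<sigma> n) f \<le> 1 / (real n + 1) + ip_dist rkhs (?fun (c n)) f"
          using near[of n] M.triangle[OF \<sigma> cc approx_in_carrier[OF f], of n n]
            M.commute[of "\<sigma> n" "?fun (c n)"] by linarith
      qed
      show "\<forall>\<^sub>F n in sequentially. 0 \<le> ip_dist rkhs (\<sigma> n) f" by auto
    qed auto
    then show "\<exists>x. limitin M.mtopology \<sigma> x sequentially"
      using \<sigma> approx_in_carrier[OF f]
      by (intro exI[of _ f]) (auto simp: M.limitin_metric_dist_null)
  qed
qed

end


section \<open>Affine actions from kernels\<close>

text \<open>\<open>K x y\<close> plays the role of the inner product of \<open>b x\<close> and \<open>b y\<close> for a cocycle \<open>b\<close>; the
  assumption \<open>kernel_cocycle\<close> says that \<open>b (g x) - b g\<close> has the same inner products as \<open>b x\<close>.\<close>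

locale cocycle_kernel = group G + psd_kernel "carrier G" K
  for G :: "('a, 'b) monoid_scheme" (structure) and K :: "'a \<Rightarrow> 'a \<Rightarrow> real" +
  assumes kernel_one: "y \<in> carrier G \<Longrightarrow> K \<one> y = 0"
    and kernel_cocycle: "\<lbrakk>g \<in> carrier G; x \<in> carrier G; y \<in> carrier G\<rbrakk> \<Longrightarrow>
      K (g \<otimes> x) (g \<otimes> y) - K (g \<otimes> x) g - K g (g \<otimes> y) + K g g = K x y"
begin

abbreviation wt :: "(real \<times> 'a) list \<Rightarrow> real" where
  "wt a \<equiv> \<Sum>p\<leftarrow>a. fst p"

text \<open>The affine map \<open>v \<mapsto> \<pi> g v + b g\<close> on formal combinations of
  cocycle vectors. The linear part sends \<open>b x\<close> to \<open>b (g x) - b g\<close>, so the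
  coefficient of \<open>b g\<close> adds up to 1 minus the total weight.\<close>

definition transl :: "'a \<Rightarrow> (real \<times> 'a) list \<Rightarrow> (real \<times> 'a) list" where
  "transl g a = map (map_prod id ((\<otimes>) g)) a @ [(1 - wt a, g)]"

text \<open>A vector \<open>v\<close> is seen as the function
  \<open>y \<mapsto> \<langle>v, b y\<rangle>\<close>; the adjoint of the linear part of
  \<open>g\<close> is that of its inverse, which sends \<open>b y\<close> to
  \<open>b (inv g \<otimes> y) - b (inv g)\<close>, and the translation part contributes
  \<open>K g y\<close>. The restriction to the carrier is there because group actions consist of
  extensional maps.\<close>

definition action :: "'a \<Rightarrow> ('a \<Rightarrow> real) \<Rightarrow> 'a \<Rightarrow> real" where
  "action g = (\<lambda>f\<in>carrier rkhs. \<lambda>y. if y \<in> carrier G then f (inv g \<otimes> y) - f (inv g) + K g y else 0)"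

lemma points_transl: "g \<in> carrier G \<Longrightarrow> points a \<subseteq> carrier G \<Longrightarrow> points (transl g a) \<subseteq> carrier G"
  by (auto simp: transl_def points_def)

text \<open>The adjoint relation between \<open>g\<close> and its inverse, on generators. It is the
  cocycle identity for the second points \<open>inv g \<otimes> y\<close> and \<open>inv g\<close>,
  subtracted from each other.\<close>

lemma kernel_shift:
  assumes "g \<in> carrier G" "x \<in> carrier G" "y \<in> carrier G"
  shows "K (g \<otimes> x) y = K x (inv g \<otimes> y) - K x (inv g) + K g y"
proof -
  have "K x (inv g \<otimes> y) = K (g \<otimes> x) y - K (g \<otimes> x) g - K g y + K g g"
    using kernel_cocycle[of g x "inv g \<otimes> y"] assms by (simp add: m_assoc[symmetric])
  moreover have "K x (inv g) = - K (g \<otimes> x) g + K g g"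
    using kernel_cocycle[of g x "inv g"] kernel_one sym[of "\<one>"] assms by simp
  ultimately show ?thesis by simp
qed

lemma eval_transl:
  assumes "g \<in> carrier G" "points a \<subseteq> carrier G" "y \<in> carrier G"
  shows "form K (transl g a) [(1, y)] = form K a [(1, inv g \<otimes> y)] - form K a [(1, inv g)] + K g y"
proof -
  have "form K (map (map_prod id ((\<otimes>) g)) a) [(1, y)] =
      form K a [(1, inv g \<otimes> y)] - form K a [(1, inv g)] + wt a * K g y"
    using assms(2)
  proof (induction a)
    case (Cons p a)
    then show ?case
      using assms by (simp add: form_def kernel_shift algebra_simps)
  qed simp
  then show ?thesis
    by (simp add: transl_def form_append form_single algebra_simps)
qed

text \<open>The correction consists of a term in \<open>a\<close>, a term in \<open>b\<close> and an
  affine function of the two weights. Such terms cancel in the form of a difference with itself,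
  which yields the isometry.\<close>

lemma form_transl:
  assumes g: "g \<in> carrier G" and a: "points a \<subseteq> carrier G" and b: "points b \<subseteq> carrier G"
  shows "form K (transl g a) (transl g b) = form K a b +
    (\<Sum>p\<leftarrow>a. fst p * K (g \<otimes> snd p) g) + (\<Sum>p\<leftarrow>b. fst p * K g (g \<otimes> snd p)) + K g g * (1 - wt a - wt b)"
proof -
  have "form K (map (map_prod id ((\<otimes>) g)) a) (map (map_prod id ((\<otimes>) g)) b) =
      form (\<lambda>x y. K x y + (K (g \<otimes> x) g + (K g (g \<otimes> y) - K g g))) a b"
    unfolding form_map by (rule form_cong) (use kernel_cocycle[OF g] a b in \<open>auto simp: algebra_simps\<close>)
  also have "\<dots> = form K a b + (\<Sum>p\<leftarrow>a. fst p * K (g \<otimes> snd p) g) * wt b +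
      wt a * (\<Sum>p\<leftarrow>b. fst p * K g (g \<otimes> snd p)) - wt a * wt b * K g g"
    unfolding form_add_kernel form_diff_kernel form_left form_right
    by (simp add: form_left[of "\<lambda>x. K g g"] sum_list_mult_const)
  finally have 1: "form K (map (map_prod id ((\<otimes>) g)) a) (map (map_prod id ((\<otimes>) g)) b) = \<dots>" .
  have 2: "form K (map (map_prod id ((\<otimes>) g)) a) [(d, g)] = d * (\<Sum>p\<leftarrow>a. fst p * K (g \<otimes> snd p) g)" for d
    by (simp add: form_def o_def sum_list_const_mult[symmetric] mult_ac)
  have 3: "form K [(d, g)] (map (map_prod id ((\<otimes>) g)) b) = d * (\<Sum>p\<leftarrow>b. fst p * K g (g \<otimes> snd p))" for d
    by (simp add: form_def o_def sum_list_const_mult[symmetric] mult_ac)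
  show ?thesis
    unfolding transl_def form_append 1 2 3 form_single by (simp add: algebra_simps)
qed

lemma snorm_diff_transl:
  assumes "g \<in> carrier G" "points a \<subseteq> carrier G" "points b \<subseteq> carrier G"
  shows "snorm (diff_comb (transl g a) (transl g b)) = snorm (diff_comb a b)"
  unfolding snorm_def form_diff using assms by (simp add: form_transl algebra_simps)

lemma approx_action:
  assumes g: "g \<in> carrier G" and f: "approx f a"
  shows "approx (action g f) (\<lambda>n. transl g (a n))"
  unfolding approx_def
proof (intro conjI ballI allI impI)
  note pts = cauchy_comb_points[OF approx_cauchy[OF f]]
  show "cauchy_comb (\<lambda>n. transl g (a n))"
    using approx_cauchy[OF f] unfolding cauchy_comb_def
    by (simp add: points_transl snorm_diff_transl g pts)
  have car: "f \<in> carrier rkhs" by (rule approx_in_carrier[OF f])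
  show "action g f y = 0" if "y \<notin> carrier G" for y
    using that car by (simp add: action_def)
  fix y assume y: "y \<in> carrier G"
  have "(\<lambda>n. form K (a n) [(1, inv g \<otimes> y)] - form K (a n) [(1, inv g)] + K g y)
      \<longlonglongrightarrow> f (inv g \<otimes> y) - f (inv g) + K g y"
    using f g y by (intro tendsto_intros) (auto simp: approx_def)
  then show "(\<lambda>n. form K (transl g (a n)) [(1, y)]) \<longlonglongrightarrow> action g f y"
    using car y g pts by (simp add: eval_transl action_def)
qed

lemma action_closed: "g \<in> carrier G \<Longrightarrow> f \<in> carrier rkhs \<Longrightarrow> action g f \<in> carrier rkhs"
  using approx_action approx_seq approx_in_carrier by blast

lemma rkhs_outside: "f \<in> carrier rkhs \<Longrightarrow> y \<notin> carrier G \<Longrightarrow> f y = 0"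
  by (auto simp: carrier_rkhs approx_def)

text \<open>The cocycle vanishes at the identity, so all represented functions do; this is what
  makes the identity of the group act trivially.\<close>

lemma rkhs_at_one:
  assumes "f \<in> carrier rkhs"
  shows "f \<one> = 0"
proof -
  obtain a where a: "approx f a" using assms by (auto simp: carrier_rkhs)
  have "form K b [(1, \<one>)] = 0" if "points b \<subseteq> carrier G" for b
    using that by (induction b) (auto simp: form_def sym[of _ "\<one>"] kernel_one)
  then have "(\<lambda>n. form K (a n) [(1, \<one>)]) = (\<lambda>n. 0)"
    using cauchy_comb_points[OF approx_cauchy[OF a]] by auto
  moreover have "(\<lambda>n. form K (a n) [(1, \<one>)]) \<longlonglongrightarrow> f \<one>"
    using a by (auto simp: approx_def)
  ultimately show ?thesis by (simp add: LIMSEQ_const_iff)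
qed

lemma action_one: "f \<in> carrier rkhs \<Longrightarrow> action \<one> f = f"
  by (rule ext) (auto simp: action_def rkhs_at_one kernel_one rkhs_outside)

lemma action_mult:
  assumes g: "g \<in> carrier G" and h: "h \<in> carrier G" and f: "f \<in> carrier rkhs"
  shows "action (g \<otimes> h) f = action g (action h f)"
proof
  fix y
  show "action (g \<otimes> h) f y = action g (action h f) y"
    using g h f action_closed[OF h f] kernel_shift[of g h y]
    by (auto simp: action_def inv_mult_group m_assoc)
qed

lemma group_action_action: "group_action G (carrier rkhs) action"
proof -
  have bij: "bij_betw (action g) (carrier rkhs) (carrier rkhs)" if g: "g \<in> carrier G" for g
    by (rule bij_betwI[of _ _ _ "action (inv g)"])
      (use g in \<open>auto simp: action_closed action_one action_mult[symmetric]\<close>)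
  then have B: "action g \<in> Bij (carrier rkhs)" if "g \<in> carrier G" for g
    using that by (auto simp: Bij_def action_def)
  have "group_hom G (BijGroup (carrier rkhs)) action"
  proof (intro group_hom.intro group_hom_axioms.intro group_BijGroup is_group homI)
    fix g h assume g: "g \<in> carrier G" and h: "h \<in> carrier G"
    show "action g \<in> carrier (BijGroup (carrier rkhs))"
      using B[OF g] by (simp add: BijGroup_def)
    have "action (g \<otimes> h) = compose (carrier rkhs) (action g) (action h)"
    proof
      fix f
      show "action (g \<otimes> h) f = compose (carrier rkhs) (action g) (action h) f"
        using action_mult[OF g h, of f] by (auto simp: compose_def action_def)
    qed
    then show "action (g \<otimes> h) = action g \<otimes>\<^bsub>BijGroup (carrier rkhs)\<^esub> action h"
      using B[OF g] B[OF h] by (simp add: BijGroup_def)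
  qed
  then show ?thesis by (rule group_action.intro)
qed

lemma ip_dist_action:
  assumes g: "g \<in> carrier G" and f: "f \<in> carrier rkhs" and f': "f' \<in> carrier rkhs"
  shows "ip_dist rkhs (action g f) (action g f') = ip_dist rkhs f f'"
proof (rule LIMSEQ_unique)
  note a = approx_seq[OF f] and a' = approx_seq[OF f']
  show "(\<lambda>n. snorm (diff_comb (approx_seq f n) (approx_seq f' n))) \<longlonglongrightarrow> ip_dist rkhs f f'"
    by (rule snorm_tendsto_ip_dist[OF a a'])
  show "(\<lambda>n. snorm (diff_comb (approx_seq f n) (approx_seq f' n))) \<longlonglongrightarrow>
      ip_dist rkhs (action g f) (action g f')"
    using snorm_tendsto_ip_dist[OF approx_action[OF g a] approx_action[OF g a']]
      cauchy_comb_points[OF approx_cauchy[OF a]] cauchy_comb_points[OF approx_cauchy[OF a']]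
    by (simp add: snorm_diff_transl g)
qed

lemma affine_isometric_action_action: "affine_isometric_action G rkhs action"
  unfolding affine_isometric_action_def
proof (intro conjI ballI allI group_action_action ip_dist_action)
  fix g f f' and t :: real
  assume g: "g \<in> carrier G" and f: "f \<in> carrier rkhs" and f': "f' \<in> carrier rkhs"
  have car: "(\<lambda>x. t * f x + (1 - t) * f' x) \<in> carrier rkhs"
    by (rule approx_in_carrier[OF approx_add[OF approx_scale[OF approx_seq[OF f]] approx_scale[OF approx_seq[OF f']]]])
  show "action g (t \<odot>\<^bsub>rkhs\<^esub> f \<oplus>\<^bsub>rkhs\<^esub> (1 - t) \<odot>\<^bsub>rkhs\<^esub> f') =
      t \<odot>\<^bsub>rkhs\<^esub> action g f \<oplus>\<^bsub>rkhs\<^esub> (1 - t) \<odot>\<^bsub>rkhs\<^esub> action g f'"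
    using car f f' by (auto simp: action_def algebra_simps)
qed

lemma ip_dist_action_zero:
  assumes g: "g \<in> carrier G"
  shows "ip_dist rkhs (action g (\<lambda>x. 0)) (\<lambda>x. 0) = sqrt (K g g)"
proof -
  have "snorm (diff_comb (transl g []) []) = sqrt (K g g)"
    by (simp add: snorm_def form_simps transl_def form_single)
  then show ?thesis
    using snorm_tendsto_ip_dist[OF approx_action[OF g approx_zero] approx_zero]
    by (simp add: LIMSEQ_const_iff)
qed

text \<open>The element \<open>g\<close> moves the origin by \<open>sqrt (K g g)\<close>. If it
  moves some point of a set of radius \<open>r\<close> around the origin into that set, then the
  origin moves by at most \<open>2 r\<close>, which leaves finitely many \<open>g\<close>.\<close>

lemma haagerup_if_proper:
  assumes proper: "\<And>r. finite {g \<in> carrier G. K g g \<le> r}"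
  shows "haagerup G"
proof -
  interpret M: Metric_space "carrier rkhs" "ip_dist rkhs"
    by (rule rkhs.Metric_space_ip_dist)
  let ?o = "\<lambda>x. 0 :: real"
  have o: "?o \<in> carrier rkhs" by (rule approx_in_carrier[OF approx_zero])
  have "metrically_proper G rkhs action"
    unfolding metrically_proper_def
  proof (intro allI impI, elim conjE)
    fix B assume "B \<subseteq> carrier rkhs" "M.mbounded B"
    \<comment> \<open>Adding the origin turns boundedness into a bound on the norms of all members
      of \<open>B\<close>.\<close>
    then have "M.mbounded (insert ?o B)" using o by (simp add: M.mbounded_insert)
    then obtain r where r: "\<And>f. f \<in> B \<Longrightarrow> f \<in> carrier rkhs \<and> ip_dist rkhs ?o f \<le> r"
      using \<open>B \<subseteq> carrier rkhs\<close> unfolding M.mbounded_alt by auto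
    have "{g \<in> carrier G. action g ` B \<inter> B \<noteq> {}} \<subseteq> {g \<in> carrier G. K g g \<le> (2 * r)\<^sup>2}"
    proof safe
      fix g f assume g: "g \<in> carrier G" and f: "f \<in> B" "action g f \<in> B"
      have fc: "f \<in> carrier rkhs" using r f by auto
      have "sqrt (K g g) \<le> ip_dist rkhs (action g ?o) (action g f) + ip_dist rkhs (action g f) ?o"
        using M.triangle[OF action_closed[OF g o] action_closed[OF g fc] o] ip_dist_action_zero[OF g] by simp
      also have "\<dots> \<le> 2 * r"
        using r[OF f(1)] r[OF f(2)] ip_dist_action[OF g o fc] M.commute[of "action g f" ?o] by simp
      finally show "K g g \<le> (2 * r)\<^sup>2" by (rule sqrt_le_D)
    qed
    then show "finite {g \<in> carrier G. action g ` B \<inter> B \<noteq> {}}"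
      by (rule finite_subset) (rule proper)
  qed
  then show ?thesis
    unfolding haagerup_def
    using real_hilbert_space_rkhs affine_isometric_action_action by blast
qed

end


section \<open>From positive definite functions to a proper cocycle kernel\<close>

lemma form_tendsto:
  assumes "\<And>x y. x \<in> points a \<Longrightarrow> y \<in> points b \<Longrightarrow> (\<lambda>n. K n x y) \<longlonglongrightarrow> L x y"
  shows "(\<lambda>n. form (K n) a b) \<longlonglongrightarrow> form L a b"
proof -
  have *: "(\<lambda>n. \<Sum>p\<leftarrow>c. f n p) \<longlonglongrightarrow> (\<Sum>p\<leftarrow>c. g p)" if "\<And>p. p \<in> set c \<Longrightarrow> (\<lambda>n. f n p) \<longlonglongrightarrow> g p"
    for c :: "(real \<times> 'a) list" and f :: "nat \<Rightarrow> real \<times> 'a \<Rightarrow> real" and g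
    using that by (induction c) (auto intro!: tendsto_add)
  show ?thesis
    unfolding form_def by (intro * tendsto_mult_left assms) (auto simp: points_def)
qed

lemma form_sum_kernel: "form (\<lambda>x y. \<Sum>k\<in>A. K k x y) a b = (\<Sum>k\<in>A. form (K k) a b)"
  by (induction A rule: infinite_finite_induct) (auto simp: form_add_kernel form_def sum_list_0)

text \<open>This is the Gram kernel of the vectors rebased at \<open>z\<close>. Its form at
  \<open>a\<close> equals the form of \<open>K\<close> at \<open>a\<close> extended by
  \<open>z\<close> with minus the total weight as coefficient.\<close>

lemma (in psd_kernel) form_based_nonneg:
  assumes z: "z \<in> V" and a: "points a \<subseteq> V"
  shows "0 \<le> form (\<lambda>x y. K z z - K z x - K z y + K x y) a a"
proof -
  let ?t = "\<Sum>p\<leftarrow>a. fst p" and ?u = "\<Sum>p\<leftarrow>a. fst p * K z (snd p)"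
  have "0 \<le> form K (a @ [(- ?t, z)]) (a @ [(- ?t, z)])"
    using z a by (intro form_nonneg) auto
  also have "\<dots> = form K a a - 2 * ?t * form K [(1, z)] a + ?t * ?t * K z z"
    using form_commute[of a "[(- ?t, z)]"] form_scale(1)[of K "- ?t" "[(1, z)]" a] z a
    by (simp add: form_append form_single scale_comb_def)
  also have "form K [(1, z)] a = ?u"
    by (simp add: form_def)
  also have "form K a a - 2 * ?t * ?u + ?t * ?t * K z z = form (\<lambda>x y. K z z - K z x - K z y + K x y) a a"
    unfolding form_add_kernel form_diff_kernel form_left[of "\<lambda>x. K z z"] form_left[of "K z"] form_right
    by (simp add: algebra_simps sum_list_mult_const)
  finally show ?thesis .
qed

text \<open>Schoenberg's construction: the sum of \<open>1 - \<phi>\<close> over a sparse subsequence is finite everywhere,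
  conditionally negative definite and proper.\<close>

lemma (in group) haagerup_if_positive_definite_approximation:
  fixes \<phi> :: "nat \<Rightarrow> 'a \<Rightarrow> 'a \<Rightarrow> real"
  assumes countable: "countable (carrier G)"
    and psd: "\<And>n. psd_kernel (carrier G) (\<phi> n)"
    and inv: "\<And>n g x y. \<lbrakk>g \<in> carrier G; x \<in> carrier G; y \<in> carrier G\<rbrakk> \<Longrightarrow> \<phi> n (g \<otimes> x) (g \<otimes> y) = \<phi> n x y"
    and diag: "\<And>n x. x \<in> carrier G \<Longrightarrow> \<phi> n x x = 1"
    and lim: "\<And>x. x \<in> carrier G \<Longrightarrow> (\<lambda>n. \<phi> n \<one> x) \<longlonglongrightarrow> 1"
    and c0: "\<And>n. finite {g \<in> carrier G. 1 / 2 \<le> \<phi> n \<one> g}"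
  shows "haagerup G"
proof -
  have le1: "\<phi> n x y \<le> 1" if "x \<in> carrier G" "y \<in> carrier G" for n x y
  proof -
    interpret psd_kernel "carrier G" "\<phi> n" by (rule psd)
    \<comment> \<open>The form of \<open>x\<close> with coefficient 1 and \<open>y\<close> with
      coefficient -1 is \<open>2 - 2 * \<phi> n x y\<close>.\<close>
    show ?thesis
      using form_nonneg[of "[(1, x), (-1, y)]"] that sym[of x y] diag by (simp add: form_def)
  qed
  define en where "en = from_nat_into (carrier G)"
  \<comment> \<open>The \<open>k\<close>-th chosen function is within \<open>(1/2) ^ k\<close> of 1
    at the points with index at most \<open>k\<close>. Every point is reached by some index, so at
    each point all but finitely many terms are dominated by a geometric series.\<close>
  have "\<exists>m. \<forall>i\<le>k. 1 - \<phi> m \<one> (en i) \<le> (1 / 2) ^ k" for k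
  proof -
    have "\<forall>\<^sub>F m in sequentially. 1 - (1 / 2) ^ k < \<phi> m \<one> (en i)" for i
      using lim[of "en i"] from_nat_into[of "carrier G" i] by (intro order_tendstoD(1)[of _ 1]) (auto simp: en_def)
    then have "\<forall>\<^sub>F m in sequentially. \<forall>i\<in>{..k}. 1 - (1 / 2) ^ k < \<phi> m \<one> (en i)"
      by (intro eventually_ball_finite) auto
    then obtain m where "\<forall>i\<in>{..k}. 1 - (1 / 2) ^ k < \<phi> m \<one> (en i)"
      by (auto simp: eventually_sequentially)
    then show ?thesis by (intro exI[of _ m]) (auto simp: less_imp_le algebra_simps)
  qed
  then obtain m where m: "\<And>k i. i \<le> k \<Longrightarrow> 1 - \<phi> (m k) \<one> (en i) \<le> (1 / 2) ^ k"
    by metis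
  define D where "D k x y = 1 - \<phi> (m k) x y" for k x y
  have D_nonneg: "0 \<le> D k x y" if "x \<in> carrier G" "y \<in> carrier G" for k x y
    using le1[OF that] by (simp add: D_def)
  have D_sym: "D k x y = D k y x" if "x \<in> carrier G" "y \<in> carrier G" for k x y
    using psd_kernel.sym[OF psd that] by (simp add: D_def)
  have D_inv: "D k (g \<otimes> x) (g \<otimes> y) = D k x y"
    if "g \<in> carrier G" "x \<in> carrier G" "y \<in> carrier G" for k g x y
    using inv[OF that] by (simp add: D_def)
  have sum1: "summable (\<lambda>k. D k \<one> x)" if x: "x \<in> carrier G" for x
  proof -
    obtain i where i: "x = en i"
      using from_nat_into_surj[OF countable x] by (auto simp: en_def)
    show ?thesis
    proof (rule summable_comparison_test[OF _ summable_geometric[of "1 / 2 :: real"]])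
      show "\<exists>N. \<forall>n\<ge>N. norm (D n \<one> x) \<le> (1 / 2) ^ n"
        using m[of i] D_nonneg[OF one_closed x] by (intro exI[of _ i]) (auto simp: D_def i)
    qed simp
  qed
  have sum: "summable (\<lambda>k. D k x y)" if "x \<in> carrier G" "y \<in> carrier G" for x y
  proof -
    have "D k x y = D k \<one> (inv\<^bsub>G\<^esub> x \<otimes> y)" for k
      using D_inv[of x \<one> "inv\<^bsub>G\<^esub> x \<otimes> y" k] that by (simp add: m_assoc[symmetric])
    then show ?thesis using sum1[of "inv\<^bsub>G\<^esub> x \<otimes> y"] that by simp
  qed
  define \<psi> where "\<psi> x y = suminf (\<lambda>k. D k x y)" for x y
  have \<psi>_sym: "\<psi> x y = \<psi> y x" if "x \<in> carrier G" "y \<in> carrier G" for x y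
    using D_sym[OF that] by (simp add: \<psi>_def)
  have \<psi>_inv: "\<psi> (g \<otimes> x) (g \<otimes> y) = \<psi> x y"
    if "g \<in> carrier G" "x \<in> carrier G" "y \<in> carrier G" for g x y
    using D_inv[OF that] by (simp add: \<psi>_def)
  have \<psi>_diag: "\<psi> x x = 0" if "x \<in> carrier G" for x
    using diag[OF that] by (simp add: \<psi>_def D_def)
  \<comment> \<open>This is the inner product of cocycle vectors with \<open>b \<one> = 0\<close>
    whose squared distances are \<open>2 * \<psi> x y\<close>; in particular
    \<open>K g g = 2 * \<psi> \<one> g\<close>.\<close>
  define K where "K x y = \<psi> \<one> x + \<psi> \<one> y - \<psi> x y" for x y
  interpret cocycle_kernel G K
  proof (intro cocycle_kernel.intro cocycle_kernel_axioms.intro psd_kernel.intro is_group)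
    fix x y assume xy: "x \<in> carrier G" "y \<in> carrier G"
    show "K x y = K y x" using \<psi>_sym[OF xy] by (simp add: K_def)
    show "K \<one> y = 0" using xy \<psi>_diag by (simp add: K_def)
    fix g assume g: "g \<in> carrier G"
    have "\<psi> (g \<otimes> x) g = \<psi> \<one> x" "\<psi> g (g \<otimes> y) = \<psi> \<one> y"
      using \<psi>_inv[OF g xy(1) one_closed] \<psi>_inv[OF g one_closed xy(2)] \<psi>_sym[OF xy(1) one_closed] g by simp_all
    then show "K (g \<otimes> x) (g \<otimes> y) - K (g \<otimes> x) g - K g (g \<otimes> y) + K g g = K x y"
      using \<psi>_inv[OF g xy] \<psi>_diag[OF g] by (simp add: K_def)
  next
    fix a assume a: "points a \<subseteq> carrier G"
    let ?K = "\<lambda>k x y. D k \<one> x + D k \<one> y - D k x y"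
    have "0 \<le> form (?K k) a a" for k
    proof -
      interpret psd_kernel "carrier G" "\<phi> (m k)" by (rule psd)
      show ?thesis
        using form_based_nonneg[OF one_closed a] diag[OF one_closed] by (simp add: D_def algebra_simps)
    qed
    then have "0 \<le> form (\<lambda>x y. \<Sum>k<n. ?K k x y) a a" for n
      by (auto simp: form_sum_kernel intro: sum_nonneg)
    moreover have "(\<lambda>n. form (\<lambda>x y. \<Sum>k<n. ?K k x y) a a) \<longlonglongrightarrow> form K a a"
    proof (rule form_tendsto)
      fix x y assume "x \<in> points a" "y \<in> points a"
      then have "x \<in> carrier G" "y \<in> carrier G" using a by auto
      show "(\<lambda>n. \<Sum>k<n. ?K k x y) \<longlonglongrightarrow> K x y"
        using sum[OF one_closed \<open>x \<in> carrier G\<close>] sum[OF one_closed \<open>y \<in> carrier G\<close>] sum[OF \<open>x \<in> carrier G\<close> \<open>y \<in> carrier G\<close>]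
        unfolding K_def \<psi>_def sums_def[symmetric] by (intro sums_diff sums_add summable_sums)
    qed
    ultimately show "0 \<le> form K a a"
      by (intro LIMSEQ_le_const[of _ "form K a a"]) auto
  qed
  show ?thesis
  proof (rule haagerup_if_proper)
    fix r :: real
    obtain N :: nat where N: "r < N" using reals_Archimedean2 by blast
    \<comment> \<open>Outside the first \<open>N\<close> finite sets each of the first
      \<open>N\<close> terms is at least 1/2, so \<open>K g g\<close> is at least
      \<open>N > r\<close>. This is why the level 1/2 is enough in the hypothesis on decay.\<close>
    have "{g \<in> carrier G. K g g \<le> r} \<subseteq> (\<Union>k<N. {g \<in> carrier G. 1 / 2 \<le> \<phi> (m k) \<one> g})"
    proof safe
      fix g assume g: "g \<in> carrier G" and r: "K g g \<le> r"
      show "g \<in> (\<Union>k<N. {g \<in> carrier G. 1 / 2 \<le> \<phi> (m k) \<one> g})"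
      proof (rule ccontr)
        assume "g \<notin> (\<Union>k<N. {g \<in> carrier G. 1 / 2 \<le> \<phi> (m k) \<one> g})"
        then have "1 / 2 \<le> D k \<one> g" if "k < N" for k
          using that g by (fastforce simp: D_def)
        then have "(\<Sum>k<N. 1 / 2) \<le> (\<Sum>k<N. D k \<one> g)"
          by (intro sum_mono) auto
        also have "\<dots> \<le> \<psi> \<one> g"
          unfolding \<psi>_def using g D_nonneg by (intro sum_le_suminf sum) auto
        finally have "N / 2 \<le> \<psi> \<one> g" by simp
        then show False using N r \<psi>_diag[OF g] by (simp add: K_def)
      qed
    qed
    then show "finite {g \<in> carrier G. K g g \<le> r}"
      by (rule finite_subset) (intro finite_UN_I finite_lessThan c0)
  qed
qed

section \<open>Independent bits\<close>

abbreviation bits :: "'e set \<Rightarrow> ('e \<Rightarrow> bool pmf) \<Rightarrow> ('e \<Rightarrow> bool) measure" where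
  "bits E M \<equiv> PiM E (\<lambda>e. measure_pmf (M e))"

lemma prob_space_bits: "prob_space (bits E M)"
  by (intro prob_space_PiM measure_pmf.prob_space_axioms)

lemma space_bits: "space (bits E M) = PiE E (\<lambda>_. UNIV)"
  by (simp add: space_PiM)

lemma pred_bits [measurable]: "e \<in> E \<Longrightarrow> Measurable.pred (bits E M) (\<lambda>\<omega>. \<omega> e)"
  using measurable_component_singleton[of e E "\<lambda>e. measure_pmf (M e)"]
  by (simp add: measurable_pmf_measure2 cong: measurable_cong_sets)

lemma measurable_bits:
  assumes "\<And>e. e \<in> E \<Longrightarrow> Measurable.pred K (\<lambda>w. F w e)"
  shows "(\<lambda>w. \<lambda>e\<in>E. F w e) \<in> measurable K (bits E M)"
  using assms by (intro measurable_restrict) (simp add: measurable_pmf_measure2 cong: measurable_cong_sets)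

lemma pred_fun2:
  fixes f :: "bool \<Rightarrow> bool \<Rightarrow> bool"
  assumes [measurable]: "Measurable.pred K P" "Measurable.pred K Q"
  shows "Measurable.pred K (\<lambda>w. f (P w) (Q w))"
proof -
  have eq: "f (P w) (Q w) \<longleftrightarrow> (P w \<and> Q w \<and> f True True) \<or> (P w \<and> \<not> Q w \<and> f True False) \<or>
      (\<not> P w \<and> Q w \<and> f False True) \<or> (\<not> P w \<and> \<not> Q w \<and> f False False)" for w
    by (cases "P w"; cases "Q w") auto
  show ?thesis
    by (rule measurable_cong[THEN iffD2, OF eq]) (intro pred_intros_logic assms measurable_const, simp_all)
qed

lemma measurable_zip:
  "(\<lambda>(\<omega>, \<eta>). \<lambda>e\<in>E. f e (\<omega> e) (\<eta> e)) \<in> measurable (bits E M \<Otimes>\<^sub>M bits E N) (bits E L)"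
  unfolding case_prod_beta
proof (rule measurable_bits)
  fix e assume e: "e \<in> E"
  show "Measurable.pred (bits E M \<Otimes>\<^sub>M bits E N) (\<lambda>w. f e (fst w e) (snd w e))"
    by (rule pred_fun2[where f="f e"])
      (rule measurable_compose[OF measurable_fst pred_bits[OF e]] measurable_compose[OF measurable_snd pred_bits[OF e]])+
qed

lemma emeasure_bits_cylinder:
  assumes "finite J" "J \<subseteq> E"
  shows "emeasure (bits E M) {\<omega> \<in> space (bits E M). \<forall>e\<in>J. \<omega> e \<in> A e} = (\<Prod>e\<in>J. emeasure (M e) (A e))"
proof -
  have "{\<omega> \<in> space (bits E M). \<forall>e\<in>J. \<omega> e \<in> A e} = prod_emb E (\<lambda>e. measure_pmf (M e)) J (PiE J A)"
    using assms by (auto simp: prod_emb_def space_bits PiE_iff extensional_def)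
  then show ?thesis
    using assms by (simp add: emeasure_PiM_emb measure_pmf.prob_space_axioms)
qed

lemma nn_integral_bits_prod:
  assumes J: "finite J" "J \<subseteq> E"
  shows "(\<integral>\<^sup>+\<omega>. (\<Prod>e\<in>J. g e (\<omega> e)) \<partial>bits E M) = (\<Prod>e\<in>J. \<integral>\<^sup>+b. g e b \<partial>M e)"
proof -
  interpret product_prob_space "\<lambda>e. measure_pmf (M e)" E
    by unfold_locales
  have "(\<integral>\<^sup>+\<omega>. (\<Prod>e\<in>J. g e (\<omega> e)) \<partial>bits E M) =
      (\<integral>\<^sup>+\<omega>. (\<Prod>e\<in>J. g e (restrict \<omega> J e)) \<partial>bits E M)"
    by (intro nn_integral_cong prod.cong) auto
  also have "\<dots> = (\<integral>\<^sup>+\<omega>. (\<Prod>e\<in>J. g e (\<omega> e)) \<partial>distr (bits E M) (bits J M) (\<lambda>\<omega>. restrict \<omega> J))"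
    using J by (subst nn_integral_distr) (auto intro!: measurable_restrict_subset)
  also have "\<dots> = (\<integral>\<^sup>+\<omega>. (\<Prod>e\<in>J. g e (\<omega> e)) \<partial>bits J M)"
    using J by (simp add: distr_PiM_restrict_finite)
  also have "\<dots> = (\<Prod>e\<in>J. \<integral>\<^sup>+b. g e b \<partial>M e)"
    by (intro product_nn_integral_prod J) auto
  finally show ?thesis .
qed

text \<open>Combining two independent families coordinatewise gives independent bits again: for a
  fixed first family the condition on the second one is a cylinder, and the resulting product
  integrates factor by factor. It serves for the union and the intersection of two percolations and
  for resampling part of the edges.\<close>

lemma bits_zip:
  fixes f :: "'e \<Rightarrow> bool \<Rightarrow> bool \<Rightarrow> bool"
  assumes L: "\<And>e. e \<in> E \<Longrightarrow> L e = map_pmf (\<lambda>(a, b). f e a b) (pair_pmf (M e) (N e))"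
  shows "distr (bits E M \<Otimes>\<^sub>M bits E N) (bits E L) (\<lambda>(\<omega>, \<eta>). \<lambda>e\<in>E. f e (\<omega> e) (\<eta> e)) = bits E L"
proof -
  interpret product_prob_space "\<lambda>e. measure_pmf (L e)" E
    by unfold_locales
  interpret N: prob_space "bits E N" by (rule prob_space_bits)
  show ?thesis
  proof (rule PiM_eq)
    fix J F assume J: "finite J" "J \<subseteq> E"
    let ?Z = "\<lambda>(\<omega>, \<eta>). \<lambda>e\<in>E. f e (\<omega> e) (\<eta> e)"
    let ?C = "{(\<omega>, \<eta>) \<in> space (bits E M \<Otimes>\<^sub>M bits E N). \<forall>e\<in>J. f e (\<omega> e) (\<eta> e) \<in> F e}"
    have eq: "?Z -` prod_emb E (\<lambda>e. measure_pmf (L e)) J (PiE J F) \<inter> space (bits E M \<Otimes>\<^sub>M bits E N) = ?C"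
      using J by (auto simp: prod_emb_def PiE_iff space_pair_measure subset_iff)
    have C: "?C \<in> sets (bits E M \<Otimes>\<^sub>M bits E N)"
      unfolding eq[symmetric] using J by (intro measurable_sets[OF measurable_zip]) auto
    have "emeasure (distr (bits E M \<Otimes>\<^sub>M bits E N) (bits E L) ?Z) (prod_emb E (\<lambda>e. measure_pmf (L e)) J (PiE J F))
        = emeasure (bits E M \<Otimes>\<^sub>M bits E N) ?C"
      using J by (subst emeasure_distr[OF measurable_zip]) (auto simp: eq)
    also have "\<dots> = (\<integral>\<^sup>+\<omega>. emeasure (bits E N) (Pair \<omega> -` ?C) \<partial>bits E M)"
      by (rule N.emeasure_pair_measure_alt[OF C])
    also have "\<dots> = (\<integral>\<^sup>+\<omega>. (\<Prod>e\<in>J. emeasure (N e) {b. f e (\<omega> e) b \<in> F e}) \<partial>bits E M)"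
    proof (rule nn_integral_cong)
      fix \<omega> assume "\<omega> \<in> space (bits E M)"
      then have "Pair \<omega> -` ?C = {\<eta> \<in> space (bits E N). \<forall>e\<in>J. \<eta> e \<in> {b. f e (\<omega> e) b \<in> F e}}"
        by (auto simp: space_pair_measure)
      then show "emeasure (bits E N) (Pair \<omega> -` ?C) = (\<Prod>e\<in>J. emeasure (N e) {b. f e (\<omega> e) b \<in> F e})"
        by (simp only: emeasure_bits_cylinder[OF J])
    qed
    also have "\<dots> = (\<Prod>e\<in>J. \<integral>\<^sup>+a. emeasure (N e) {b. f e a b \<in> F e} \<partial>M e)"
      by (rule nn_integral_bits_prod[OF J])
    also have "\<dots> = (\<Prod>e\<in>J. emeasure (L e) (F e))"
    proof (rule prod.cong[OF refl])
      fix e assume "e \<in> J"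
      then have "L e = map_pmf (\<lambda>(a, b). f e a b) (pair_pmf (M e) (N e))"
        using L J by auto
      then have "emeasure (L e) (F e) = (\<integral>\<^sup>+c. indicator (F e) c \<partial>map_pmf (\<lambda>(a, b). f e a b) (pair_pmf (M e) (N e)))"
        by (simp only:) (subst nn_integral_indicator, simp_all)
      also have "\<dots> = (\<integral>\<^sup>+a. \<integral>\<^sup>+b. indicator (F e) (f e a b) \<partial>N e \<partial>M e)"
        by (simp add: nn_integral_map_pmf nn_integral_pair_pmf' split_def)
      also have "\<dots> = (\<integral>\<^sup>+a. emeasure (N e) {b. f e a b \<in> F e} \<partial>M e)"
      proof (rule nn_integral_cong)
        fix a
        have "(\<integral>\<^sup>+b. indicator (F e) (f e a b) \<partial>N e) = (\<integral>\<^sup>+b. indicator {b. f e a b \<in> F e} b \<partial>N e)"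
          by (intro nn_integral_cong) (simp add: indicator_def)
        then show "(\<integral>\<^sup>+b. indicator (F e) (f e a b) \<partial>N e) = emeasure (N e) {b. f e a b \<in> F e}"
          by simp
      qed
      finally show "(\<integral>\<^sup>+a. emeasure (N e) {b. f e a b \<in> F e} \<partial>M e) = emeasure (L e) (F e)" by simp
    qed
    finally show "emeasure (distr (bits E M \<Otimes>\<^sub>M bits E N) (bits E L) ?Z) (prod_emb E (\<lambda>e. measure_pmf (L e)) J (\<Pi>\<^sub>E j\<in>J. F j)) =
      (\<Prod>j\<in>J. emeasure (L j) (F j))" .
  qed simp
qed

text \<open>Any \<open>n\<close> of the infinitely many bits are off together with probability at
  most \<open>q ^ n\<close>, where \<open>q\<close> bounds the probability of a single bit being
  off.\<close>

lemma emeasure_all_closed_eq_0: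
  fixes M :: "'e \<Rightarrow> bool pmf"
  assumes J: "infinite J" "J \<subseteq> E" "countable E" and q: "0 \<le> q" "q < 1" "\<And>e. e \<in> J \<Longrightarrow> emeasure (M e) {False} \<le> ennreal q"
  shows "emeasure (bits E M) {\<omega> \<in> space (bits E M). \<forall>e\<in>J. \<not> \<omega> e} = 0"
proof -
  interpret prob_space "bits E M" by (rule prob_space_bits)
  have "emeasure (bits E M) {\<omega> \<in> space (bits E M). \<forall>e\<in>J. \<not> \<omega> e} \<le> ennreal (q ^ n)" for n
  proof -
    obtain J' where J': "J' \<subseteq> J" "finite J'" "card J' = n"
      using infinite_arbitrarily_large[OF J(1)] by blast
    have "emeasure (bits E M) {\<omega> \<in> space (bits E M). \<forall>e\<in>J. \<not> \<omega> e} \<le>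
        emeasure (bits E M) {\<omega> \<in> space (bits E M). \<forall>e\<in>J'. \<omega> e \<in> {False}}"
    proof (rule emeasure_mono)
      show "{\<omega> \<in> space (bits E M). \<forall>e\<in>J'. \<omega> e \<in> {False}} \<in> sets (bits E M)"
        using J J' pred_bits[of _ E M]
          by (intro sets.sets_Collect_countable_All') (auto simp: pred_def countable_finite)
    qed (use J' in auto)
    also have "\<dots> = (\<Prod>e\<in>J'. emeasure (M e) {False})"
      using J J' by (intro emeasure_bits_cylinder) auto
    also have "\<dots> \<le> (\<Prod>e\<in>J'. ennreal (q))"
      using q J' by (intro prod_mono_ennreal) auto
    finally show ?thesis using J' q by (simp add: ennreal_power)
  qed
  moreover have "(\<lambda>n. ennreal (q ^ n)) \<longlonglongrightarrow> ennreal 0"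
    using q by (intro tendsto_ennrealI LIMSEQ_realpow_zero) auto
  ultimately show ?thesis
    by (intro antisym LIMSEQ_le_const[of _ 0]) auto
qed

section \<open>Percolation on Cayley graphs\<close>

lemma percolation_bits: "percolation E p = bits E (\<lambda>_. bernoulli_pmf p)"
  by (simp add: percolation_def)

lemma pred_Bex_countable:
  "countable I \<Longrightarrow> (\<And>i. i \<in> I \<Longrightarrow> Measurable.pred K (\<lambda>w. P w i)) \<Longrightarrow> Measurable.pred K (\<lambda>w. \<exists>i\<in>I. P w i)"
  unfolding pred_def by (rule sets.sets_Collect_countable_Ex')

lemma pred_Ball_countable:
  "countable I \<Longrightarrow> (\<And>i. i \<in> I \<Longrightarrow> Measurable.pred K (\<lambda>w. P w i)) \<Longrightarrow> Measurable.pred K (\<lambda>w. \<forall>i\<in>I. P w i)"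
  unfolding pred_def by (rule sets.sets_Collect_countable_All')

locale cayley = group G for G :: "('a, 'b) monoid_scheme" (structure) +
  fixes S :: "'a set"
  assumes infinite_carrier: "infinite (carrier G)"
    and finite_S: "finite S" and S_sub: "S \<subseteq> carrier G"
    and S_inv: "s \<in> S \<Longrightarrow> inv s \<in> S"
    and S_gen: "generate G S = carrier G"
begin

abbreviation E :: "'a set set" where "E \<equiv> cayley_edges G S"

lemma edge_iff: "{x, y} \<in> E \<longleftrightarrow> x \<in> carrier G \<and> (\<exists>s\<in>S. s \<noteq> \<one> \<and> y = x \<otimes> s)"
proof
  assume "{x, y} \<in> E"
  then obtain g s where gs: "g \<in> carrier G" "s \<in> S" "s \<noteq> \<one>" "{x, y} = {g, g \<otimes> s}"
    by (auto simp: cayley_edges_def)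
  then have s: "s \<in> carrier G" using S_sub by auto
  from gs(4) consider "x = g" "y = g \<otimes> s" | "x = g \<otimes> s" "y = g" by (auto simp: doubleton_eq_iff)
  then show "x \<in> carrier G \<and> (\<exists>s\<in>S. s \<noteq> \<one> \<and> y = x \<otimes> s)"
  proof cases
    case 2
    then have "y = x \<otimes> inv s" using gs s by (simp add: m_assoc)
    moreover have "inv s \<noteq> \<one>" using gs(3) s by (metis inv_inv inv_one)
    moreover have "x \<in> carrier G" using 2 gs s by simp
    ultimately show ?thesis using gs(2) S_inv[of s] by blast
  qed (use gs in auto)
qed (auto simp: cayley_edges_def)

lemma edge_closed: "{x, y} \<in> E \<Longrightarrow> x \<in> carrier G" "{x, y} \<in> E \<Longrightarrow> y \<in> carrier G"
  using edge_iff S_sub by auto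

lemma edgeE:
  assumes "e \<in> E"
  obtains x y where "e = {x, y}" "x \<in> carrier G" "y \<in> carrier G"
  using assms S_sub unfolding cayley_edges_def by blast

text \<open>Generators are multiplied from the right, hence left translations are automorphisms of
  the graph.\<close>

lemma edge_transl: "g \<in> carrier G \<Longrightarrow> {x, y} \<in> E \<Longrightarrow> {g \<otimes> x, g \<otimes> y} \<in> E"
  unfolding edge_iff using S_sub m_assoc[of g x] by (metis m_closed subsetD)

text \<open>Its iterates on a singleton are the closed balls; as the graph is locally finite, they
  are finite sets by induction on the radius.\<close>

definition nbhd :: "'a set \<Rightarrow> 'a set" where
  "nbhd A = A \<union> {u. \<exists>w\<in>A. {w, u} \<in> E}"

lemma finite_nbhd: "finite A \<Longrightarrow> finite (nbhd A)"
proof -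
  assume "finite A"
  moreover have "nbhd A \<subseteq> A \<union> (\<Union>w\<in>A. (\<lambda>s. w \<otimes> s) ` S)"
    by (auto simp: nbhd_def edge_iff)
  ultimately show ?thesis using finite_S by (auto elim!: finite_subset)
qed

lemma finite_nbhd_pow: "finite A \<Longrightarrow> finite ((nbhd ^^ r) A)"
  by (induction r) (auto intro: finite_nbhd)

lemma relpow_in_nbhd_pow: "(x, y) \<in> adj E ^^ r \<Longrightarrow> y \<in> (nbhd ^^ r) {x}"
  by (induction r arbitrary: y) (auto simp: nbhd_def adj_def)

lemma nbhd_pow_mono: "r \<le> s \<Longrightarrow> (nbhd ^^ r) A \<subseteq> (nbhd ^^ s) A"
  by (rule lift_Suc_mono_le) (auto simp: nbhd_def)

lemma connected_one: "h \<in> carrier G \<Longrightarrow> x \<in> carrier G \<Longrightarrow> (x, x \<otimes> h) \<in> (adj E)\<^sup>*"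
proof -
  have step: "(x, x \<otimes> s) \<in> (adj E)\<^sup>*" if "s \<in> S" "x \<in> carrier G" for x s
    using that by (cases "s = \<one>") (auto simp: adj_def edge_iff)
  assume "h \<in> carrier G" "x \<in> carrier G"
  then have "h \<in> generate G S" by (simp add: S_gen)
  then show ?thesis using \<open>x \<in> carrier G\<close>
  proof (induction h arbitrary: x)
    case (eng h1 h2)
    then have "h1 \<in> carrier G" "h2 \<in> carrier G" by (auto simp: S_gen)
    with eng.IH(1)[of x] eng.IH(2)[of "x \<otimes> h1"] eng.prems show ?case
      by (auto simp: m_assoc intro: rtrancl_trans)
  qed (auto intro: step S_inv)
qed

lemma connected: "x \<in> carrier G \<Longrightarrow> y \<in> carrier G \<Longrightarrow> (x, y) \<in> (adj E)\<^sup>*"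
  using connected_one[of "inv x \<otimes> y" x] by (simp add: m_assoc[symmetric])

lemma ex_nbhd_pow:
  assumes "x \<in> carrier G" "y \<in> carrier G"
  obtains r where "y \<in> (nbhd ^^ r) {x}"
  using connected[OF assms] relpow_in_nbhd_pow by (auto simp: rtrancl_power)

lemma countable_carrier: "countable (carrier G)"
proof -
  have "carrier G \<subseteq> (\<Union>r. (nbhd ^^ r) {\<one>})"
    using ex_nbhd_pow[OF one_closed] by blast
  moreover have "countable (\<Union>r. (nbhd ^^ r) {\<one>})"
    by (intro countable_UN) (auto intro: countable_finite finite_nbhd_pow)
  ultimately show ?thesis by (rule countable_subset)
qed

lemma countable_E: "countable E"
proof -
  have "E \<subseteq> (\<lambda>(x, y). {x, y}) ` (carrier G \<times> carrier G)"
    by (auto elim!: edgeE)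
  then show ?thesis
    by (rule countable_subset) (auto intro: countable_carrier)
qed

text \<open>An enumeration without repetitions. It turns infinitude of subsets into countable
  quantifiers, and it provides the order in which points look for the infinite cluster.\<close>

definition en :: "nat \<Rightarrow> 'a" where
  "en = from_nat_into (carrier G)"

lemma bij_en: "bij_betw en UNIV (carrier G)"
  unfolding en_def by (rule bij_betw_from_nat_into[OF countable_carrier infinite_carrier])

lemma en_closed [simp]: "en n \<in> carrier G"
  using bij_en by (auto simp: bij_betw_def)

lemma inj_en: "inj en" using bij_en by (auto simp: bij_betw_def)

lemma range_en: "range en = carrier G" using bij_en by (auto simp: bij_betw_def)

lemma en_surj:
  assumes "x \<in> carrier G" obtains n where "x = en n"
  using assms range_en by blast

text \<open>The right-hand side has only countable quantifiers, which is the form needed for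
  measurability.\<close>

lemma infinite_iff_en: "infinite {y \<in> carrier G. Q y} \<longleftrightarrow> (\<forall>m. \<exists>n\<ge>m. Q (en n))"
proof -
  have "{y \<in> carrier G. Q y} = en ` {n. Q (en n)}"
    using range_en by auto
  then have "infinite {y \<in> carrier G. Q y} \<longleftrightarrow> infinite {n. Q (en n)}"
    by (simp add: finite_image_iff inj_on_subset[OF inj_en])
  then show ?thesis by (simp add: infinite_nat_iff_unbounded_le)
qed

subsection \<open>Clusters\<close>

definition conn :: "('a set \<Rightarrow> bool) \<Rightarrow> 'a \<Rightarrow> 'a \<Rightarrow> bool" where
  "conn \<omega> x y \<longleftrightarrow> (x, y) \<in> (adj {e \<in> E. \<omega> e})\<^sup>*"

definition inf_cl :: "('a set \<Rightarrow> bool) \<Rightarrow> 'a \<Rightarrow> bool" where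
  "inf_cl \<omega> x \<longleftrightarrow> infinite {y \<in> carrier G. conn \<omega> x y}"

lemma conn_refl [simp]: "conn \<omega> x x" by (simp add: conn_def)

lemma conn_trans [trans]: "conn \<omega> x y \<Longrightarrow> conn \<omega> y z \<Longrightarrow> conn \<omega> x z"
  unfolding conn_def by (rule rtrancl_trans)

lemma conn_sym: "conn \<omega> x y \<Longrightarrow> conn \<omega> y x"
proof -
  have "sym (adj {e \<in> E. \<omega> e})" by (auto simp: adj_def sym_def insert_commute)
  then show "conn \<omega> x y \<Longrightarrow> conn \<omega> y x" unfolding conn_def by (metis sym_rtrancl symD)
qed

lemma conn_commute: "conn \<omega> x y \<longleftrightarrow> conn \<omega> y x"
  using conn_sym by blast

lemma conn_edge: "{x, y} \<in> E \<Longrightarrow> \<omega> {x, y} \<Longrightarrow> conn \<omega> x y"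
  by (auto simp: conn_def adj_def)

lemma conn_mono:
  assumes "conn \<omega> x y" "\<And>e. e \<in> E \<Longrightarrow> \<omega> e \<Longrightarrow> \<eta> e"
  shows "conn \<eta> x y"
proof -
  have "adj {e \<in> E. \<omega> e} \<subseteq> adj {e \<in> E. \<eta> e}" using assms(2) by (auto simp: adj_def)
  from rtrancl_mono[OF this] show ?thesis using assms(1) by (auto simp: conn_def)
qed

lemma conn_cong: "(\<And>e. e \<in> E \<Longrightarrow> \<omega> e = \<eta> e) \<Longrightarrow> conn \<omega> x y = conn \<eta> x y"
  by (auto elim: conn_mono)

lemma inf_cl_mono: "inf_cl \<omega> x \<Longrightarrow> (\<And>e. e \<in> E \<Longrightarrow> \<omega> e \<Longrightarrow> \<eta> e) \<Longrightarrow> inf_cl \<eta> x"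
  unfolding inf_cl_def by (erule contrapos_nn, erule finite_subset[rotated]) (auto elim: conn_mono)

lemma inf_cl_cong: "(\<And>e. e \<in> E \<Longrightarrow> \<omega> e = \<eta> e) \<Longrightarrow> inf_cl \<omega> x = inf_cl \<eta> x"
  by (auto elim: inf_cl_mono)

lemma inf_cl_conn: "inf_cl \<omega> x \<Longrightarrow> conn \<omega> x y \<Longrightarrow> inf_cl \<omega> y"
  unfolding inf_cl_def
  by (erule contrapos_nn, erule finite_subset[rotated]) (auto intro: conn_trans conn_sym)

lemma same_cluster_iff: "(x, y) \<in> same_cluster (carrier G) E \<omega> \<longleftrightarrow> x \<in> carrier G \<and> y \<in> carrier G \<and> conn \<omega> x y"
  by (auto simp: same_cluster_def conn_def)

lemma unique_infinite_cluster_iff: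
  "unique_infinite_cluster (carrier G) E \<omega> \<longleftrightarrow>
    (\<exists>x\<in>carrier G. inf_cl \<omega> x) \<and> (\<forall>x\<in>carrier G. \<forall>y\<in>carrier G. inf_cl \<omega> x \<longrightarrow> inf_cl \<omega> y \<longrightarrow> conn \<omega> x y)"
proof -
  let ?c = "\<lambda>x. {y \<in> carrier G. conn \<omega> x y}"
  have cl: "clusters (carrier G) E \<omega> = ?c ` carrier G"
    unfolding clusters_def quotient_def by (auto simp: same_cluster_iff Image_def)
  have eq: "?c x = ?c y \<longleftrightarrow> conn \<omega> x y" if "x \<in> carrier G" "y \<in> carrier G" for x y
  proof
    assume "?c x = ?c y"
    then have "y \<in> ?c x" using that by simp
    then show "conn \<omega> x y" by simp
  next
    assume xy: "conn \<omega> x y"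
    have "conn \<omega> x z \<longleftrightarrow> conn \<omega> y z" for z
      using conn_trans[OF xy] conn_trans[OF conn_sym[OF xy]] by blast
    then show "?c x = ?c y" by auto
  qed
  show ?thesis
  proof
    assume "unique_infinite_cluster (carrier G) E \<omega>"
    then have "\<exists>!C. C \<in> ?c ` carrier G \<and> infinite C"
      by (simp only: unique_infinite_cluster_def cl)
    then obtain C where C0: "C \<in> ?c ` carrier G \<and> infinite C"
      "\<forall>D. D \<in> ?c ` carrier G \<and> infinite D \<longrightarrow> D = C"
      by (rule ex1E)
    note C = conjunct1[OF C0(1)] conjunct2[OF C0(1)] mp[OF spec[OF C0(2)], OF conjI]
    have "?c x = C" if "x \<in> carrier G" "inf_cl \<omega> x" for x
      using C(3)[of "?c x"] that by (simp add: inf_cl_def)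
    then have "conn \<omega> x y" if "x \<in> carrier G" "y \<in> carrier G" "inf_cl \<omega> x" "inf_cl \<omega> y" for x y
      by (intro iffD1[OF eq]) (simp_all only: that)
    moreover have "\<exists>x\<in>carrier G. inf_cl \<omega> x"
    proof -
      obtain x where Cx: "C = ?c x" and x: "x \<in> carrier G" using C(1) by (rule imageE)
      have "inf_cl \<omega> x" unfolding inf_cl_def using C(2) unfolding Cx .
      then show ?thesis using x by (rule bexI)
    qed
    ultimately show "(\<exists>x\<in>carrier G. inf_cl \<omega> x) \<and>
        (\<forall>x\<in>carrier G. \<forall>y\<in>carrier G. inf_cl \<omega> x \<longrightarrow> inf_cl \<omega> y \<longrightarrow> conn \<omega> x y)"
      by blast
  next
    assume *: "(\<exists>x\<in>carrier G. inf_cl \<omega> x) \<and>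
        (\<forall>x\<in>carrier G. \<forall>y\<in>carrier G. inf_cl \<omega> x \<longrightarrow> inf_cl \<omega> y \<longrightarrow> conn \<omega> x y)"
    then obtain x where x: "x \<in> carrier G" "inf_cl \<omega> x" by blast
    show "unique_infinite_cluster (carrier G) E \<omega>"
      unfolding unique_infinite_cluster_def cl
    proof (rule ex1I[of _ "?c x"])
      show "?c x \<in> ?c ` carrier G \<and> infinite (?c x)"
        by (rule conjI[OF imageI[OF x(1)] x(2)[unfolded inf_cl_def]])
      fix D assume D: "D \<in> ?c ` carrier G \<and> infinite D"
      from conjunct1[OF D] obtain y where Dy: "D = ?c y" and y: "y \<in> carrier G" by (rule imageE)
      have "inf_cl \<omega> y" unfolding inf_cl_def using conjunct2[OF D] unfolding Dy .
      then have "conn \<omega> y x" using * x y by simp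
      then show "D = ?c x" unfolding Dy eq[OF y x(1)] .
    qed
  qed
qed

lemma two_point_eq:
  assumes "x \<in> carrier G" "y \<in> carrier G"
  shows "two_point (carrier G) E p x y = measure (percolation E p) {\<omega> \<in> space (percolation E p). conn \<omega> x y}"
  using assms by (simp add: two_point_def same_cluster_iff)

text \<open>Paths of length \<open>n\<close> are treated by induction on \<open>n\<close>. The edge
  states \<open>F\<close> are arbitrary, because connectivity is needed in the lower configuration,
  in unions and intersections of two levels and in modified configurations.\<close>

lemma pred_conn:
  assumes F: "\<And>e. e \<in> E \<Longrightarrow> Measurable.pred K (\<lambda>w. F w e)"
  shows "Measurable.pred K (\<lambda>w. conn (F w) x y)"
proof -
  have pow: "Measurable.pred K (\<lambda>w. (x, y) \<in> adj {e \<in> E. F w e} ^^ n)" for n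
  proof (induction n arbitrary: y)
    case (Suc n)
    have step: "Measurable.pred K (\<lambda>w. (z, y) \<in> adj {e \<in> E. F w e})" for z
      using F by (cases "{z, y} \<in> E") (auto simp: adj_def)
    have "(\<lambda>w. (x, y) \<in> adj {e \<in> E. F w e} ^^ Suc n) =
        (\<lambda>w. \<exists>z\<in>carrier G. (x, z) \<in> adj {e \<in> E. F w e} ^^ n \<and> (z, y) \<in> adj {e \<in> E. F w e})"
      by (auto simp: fun_eq_iff relcomp_unfold adj_def dest: edge_closed)
    moreover have "Measurable.pred K (\<lambda>w. (x, z) \<in> adj {e \<in> E. F w e} ^^ n \<and> (z, y) \<in> adj {e \<in> E. F w e})" for z
      by (rule pred_intros_logic(3)[OF Suc step])
    ultimately show ?case
      by (simp only:) (rule pred_Bex_countable[OF countable_carrier])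
  qed simp
  show ?thesis
    unfolding conn_def rtrancl_power using pow by (rule pred_intros_countable)
qed

lemma pred_inf_cl:
  assumes F: "\<And>e. e \<in> E \<Longrightarrow> Measurable.pred K (\<lambda>w. F w e)"
  shows "Measurable.pred K (\<lambda>w. inf_cl (F w) x)"
proof -
  have "Measurable.pred K (\<lambda>w. conn (F w) x y)" for y by (rule pred_conn[OF F])
  then have "Measurable.pred K (\<lambda>w. m \<le> n \<and> conn (F w) x (en n))" for m n :: nat
    by (rule pred_intros_conj1')
  then have "Measurable.pred K (\<lambda>w. \<exists>n. m \<le> n \<and> conn (F w) x (en n))" for m :: nat
    by (rule pred_intros_countable)
  then show ?thesis
    unfolding inf_cl_def infinite_iff_en by (rule pred_intros_countable)
qed

subsection \<open>Translations\<close>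

text \<open>The pull-back along left translation: the point \<open>x\<close> sees in
  \<open>shift g \<omega>\<close> what \<open>g \<otimes> x\<close> sees in \<open>\<omega>\<close>.
  Restriction to \<open>E\<close> keeps the result in the product space.\<close>

definition shift :: "'a \<Rightarrow> ('a set \<Rightarrow> bool) \<Rightarrow> 'a set \<Rightarrow> bool" where
  "shift g \<omega> = (\<lambda>e\<in>E. \<omega> ((\<otimes>) g ` e))"

lemma image_transl_closed: "g \<in> carrier G \<Longrightarrow> e \<in> E \<Longrightarrow> (\<otimes>) g ` e \<in> E"
proof -
  assume "g \<in> carrier G" "e \<in> E"
  moreover from this obtain x y where "e = {x, y}" by (auto elim: edgeE)
  ultimately show ?thesis using edge_transl[of g x y] by simp
qed

lemma inj_on_transl: "g \<in> carrier G \<Longrightarrow> inj_on ((\<otimes>) g) (carrier G)"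
  by (auto simp: inj_on_def)

lemma edge_sub: "e \<in> E \<Longrightarrow> e \<subseteq> carrier G"
  by (auto elim!: edgeE)

lemma inj_on_image_transl: "g \<in> carrier G \<Longrightarrow> inj_on ((`) ((\<otimes>) g)) E"
  using inj_on_image_eq_iff[OF inj_on_transl] edge_sub by (auto simp: inj_on_def)

lemma conn_shift1:
  assumes g: "g \<in> carrier G" and "conn (shift g \<omega>) x y"
  shows "conn \<omega> (g \<otimes> x) (g \<otimes> y)"
  using assms(2) unfolding conn_def
proof (induction rule: rtrancl_induct)
  case (step y z)
  then have "{y, z} \<in> E" "\<omega> {g \<otimes> y, g \<otimes> z}" by (auto simp: adj_def shift_def)
  then have "(g \<otimes> y, g \<otimes> z) \<in> adj {e \<in> E. \<omega> e}" using g by (auto simp: adj_def edge_transl)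
  with step.IH show ?case by simp
qed simp

lemma shift_shift: "g \<in> carrier G \<Longrightarrow> h \<in> carrier G \<Longrightarrow> shift g (shift h \<omega>) = shift (h \<otimes> g) \<omega>"
proof
  fix e assume g: "g \<in> carrier G" and h: "h \<in> carrier G"
  then have "(\<otimes>) h ` (\<otimes>) g ` e = (\<otimes>) (h \<otimes> g) ` e" if "e \<in> E"
    unfolding image_image using edge_sub[OF that] by (intro image_cong) (auto simp: m_assoc)
  then show "shift g (shift h \<omega>) e = shift (h \<otimes> g) \<omega> e"
    using g h by (simp add: shift_def image_transl_closed)
qed

lemma shift_one: "e \<in> E \<Longrightarrow> shift \<one> \<omega> e = \<omega> e"
proof -
  assume e: "e \<in> E"
  have "(\<otimes>) \<one> ` e = id ` e" using edge_sub[OF e] by (intro image_cong) auto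
  then show ?thesis using e by (simp add: shift_def)
qed

lemma conn_shift:
  assumes g: "g \<in> carrier G" and x: "x \<in> carrier G" and y: "y \<in> carrier G"
  shows "conn (shift g \<omega>) x y \<longleftrightarrow> conn \<omega> (g \<otimes> x) (g \<otimes> y)"
proof
  assume "conn \<omega> (g \<otimes> x) (g \<otimes> y)"
  then have "conn (shift (inv g) (shift g \<omega>)) (g \<otimes> x) (g \<otimes> y)"
    using g by (simp add: shift_shift shift_one cong: conn_cong)
  from conn_shift1[OF inv_closed[OF g] this] show "conn (shift g \<omega>) x y"
    using g x y by (simp add: m_assoc[symmetric])
qed (rule conn_shift1[OF g])

lemma inf_cl_shift:
  assumes g: "g \<in> carrier G" and x: "x \<in> carrier G"
  shows "inf_cl (shift g \<omega>) x \<longleftrightarrow> inf_cl \<omega> (g \<otimes> x)"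
proof -
  have "{y \<in> carrier G. conn \<omega> (g \<otimes> x) y} = (\<otimes>) g ` {y \<in> carrier G. conn \<omega> (g \<otimes> x) (g \<otimes> y)}"
  proof (intro equalityI subsetI)
    fix y assume y: "y \<in> {y \<in> carrier G. conn \<omega> (g \<otimes> x) y}"
    then have "y = g \<otimes> (inv g \<otimes> y)" using g by (simp add: m_assoc[symmetric])
    then show "y \<in> (\<otimes>) g ` {y \<in> carrier G. conn \<omega> (g \<otimes> x) (g \<otimes> y)}"
      using y g by (intro image_eqI[of _ _ "inv g \<otimes> y"]) auto
  qed (use g in auto)
  then have "finite {y \<in> carrier G. conn \<omega> (g \<otimes> x) y} \<longleftrightarrow> finite {y \<in> carrier G. conn \<omega> (g \<otimes> x) (g \<otimes> y)}"
    using inj_on_subset[OF inj_on_transl[OF g]] by (simp add: finite_image_iff)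
  also have "{y \<in> carrier G. conn \<omega> (g \<otimes> x) (g \<otimes> y)} = {y \<in> carrier G. conn (shift g \<omega>) x y}"
    using conn_shift[OF g x] by auto
  finally show ?thesis by (simp add: inf_cl_def)
qed

lemma measurable_shift: "g \<in> carrier G \<Longrightarrow> shift g \<in> measurable (bits E M) (bits E N)"
  unfolding shift_def[abs_def] by (intro measurable_bits pred_bits image_transl_closed)

lemma distr_shift:
  assumes g: "g \<in> carrier G"
  shows "distr (percolation E p) (percolation E p) (shift g) = percolation E p"
  unfolding percolation_def shift_def[abs_def]
  using g by (intro distr_PiM_reindex measure_pmf.prob_space_axioms inj_on_image_transl)
    (auto intro: image_transl_closed)

lemma prob_space_percolation: "prob_space (percolation E p)"
  unfolding percolation_bits by (rule prob_space_bits)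

end

subsection \<open>Ergodicity\<close>

lemma emeasure_bits_cylinder_reindex:
  assumes J: "finite J" "inj_on f J" "f ` J \<subseteq> E"
  shows "emeasure (bits E M) {\<omega> \<in> space (bits E M). \<forall>i\<in>J. \<omega> (f i) \<in> A i} = (\<Prod>i\<in>J. emeasure (M (f i)) (A i))"
proof -
  let ?A = "\<lambda>e. A (the_inv_into J f e)"
  have "{\<omega> \<in> space (bits E M). \<forall>i\<in>J. \<omega> (f i) \<in> A i} = {\<omega> \<in> space (bits E M). \<forall>e\<in>f ` J. \<omega> e \<in> ?A e}"
    using J by (auto simp: the_inv_into_f_f)
  also have "emeasure (bits E M) \<dots> = (\<Prod>e\<in>f ` J. emeasure (M e) (?A e))"
    using J by (intro emeasure_bits_cylinder) auto
  also have "\<dots> = (\<Prod>i\<in>J. emeasure (M (f i)) (A i))"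
    using J by (subst prod.reindex) (auto simp: the_inv_into_f_f intro!: prod.cong)
  finally show ?thesis .
qed

context cayley
begin

lemma ex_disjoint_translates:
  assumes W: "finite W" "W \<subseteq> carrier G"
  shows "\<exists>\<Gamma>\<subseteq>carrier G. finite \<Gamma> \<and> card \<Gamma> = n \<and> (\<forall>g\<in>\<Gamma>. \<forall>h\<in>\<Gamma>. g \<noteq> h \<longrightarrow> (\<otimes>) g ` W \<inter> (\<otimes>) h ` W = {})"
proof (induction n)
  case 0
  show ?case by (intro exI[of _ "{}"]) auto
next
  case (Suc n)
  then obtain \<Gamma> where \<Gamma>: "\<Gamma> \<subseteq> carrier G" "finite \<Gamma>" "card \<Gamma> = n"
    "\<forall>g\<in>\<Gamma>. \<forall>h\<in>\<Gamma>. g \<noteq> h \<longrightarrow> (\<otimes>) g ` W \<inter> (\<otimes>) h ` W = {}" by auto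
  \<comment> \<open>The translates by \<open>g\<close> and \<open>k\<close> intersect only if
    \<open>k\<close> is one of these products. The old translations are excluded as well, so that
    the cardinality grows.\<close>
  let ?bad = "\<Gamma> \<union> (\<lambda>(g, w, v). (g \<otimes> w) \<otimes> inv v) ` (\<Gamma> \<times> W \<times> W)"
  have "finite ?bad" using \<Gamma> W by auto
  then obtain k where k: "k \<in> carrier G" "k \<notin> ?bad"
    using infinite_carrier by (meson finite_subset subsetI)
  have "(\<otimes>) g ` W \<inter> (\<otimes>) k ` W = {}" if g: "g \<in> \<Gamma>" for g
  proof (rule ccontr)
    assume "(\<otimes>) g ` W \<inter> (\<otimes>) k ` W \<noteq> {}"
    then obtain w v where wv: "w \<in> W" "v \<in> W" "g \<otimes> w = k \<otimes> v" by blast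
    then have "k = (g \<otimes> w) \<otimes> inv v" using k W by (auto simp: m_assoc subset_iff)
    then show False using k(2) g wv by force
  qed
  then show ?case
    using \<Gamma> k by (intro exI[of _ "insert k \<Gamma>"]) (auto simp: Int_commute)
qed

lemma measure_shift:
  assumes g: "g \<in> carrier G" and A: "A \<in> sets (percolation E p)"
  shows "measure (percolation E p) (shift g -` A \<inter> space (percolation E p)) = measure (percolation E p) A"
proof -
  have "measure (percolation E p) A = measure (distr (percolation E p) (percolation E p) (shift g)) A"
    by (simp add: distr_shift[OF g])
  also have "\<dots> = measure (percolation E p) (shift g -` A \<inter> space (percolation E p))"
    using A by (intro measure_distr) (auto simp: percolation_bits measurable_shift[OF g])
  finally show ?thesis by simp
qed

text \<open>Averaging the indicators of the translates of a cylinder along many disjoint translates shows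
  that an invariant event is independent of every cylinder, hence of itself.\<close>

lemma invariant_indep_cylinder:
  fixes p defines "P \<equiv> percolation E p"
  assumes A: "A \<in> sets P"
    and inv: "\<And>g \<omega>. g \<in> carrier G \<Longrightarrow> \<omega> \<in> space P \<Longrightarrow> shift g \<omega> \<in> A \<longleftrightarrow> \<omega> \<in> A"
    and J: "finite J" "J \<subseteq> E" and C: "C = {\<omega> \<in> space P. \<forall>e\<in>J. \<omega> e \<in> F e}"
  shows "measure P (A \<inter> C) = measure P A * measure P C"
proof -
  interpret prob_space P unfolding P_def by (rule prob_space_percolation)
  have P: "P = bits E (\<lambda>_. bernoulli_pmf p)" by (simp add: P_def percolation_bits)
  define Cg where "Cg g = {\<omega> \<in> space P. \<forall>e\<in>J. \<omega> ((\<otimes>) g ` e) \<in> F e}" for g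
  define c where "c = prob C"
  define d where "d = prob (A \<inter> C) - c * prob A"
  have C_sets: "C \<in> sets P"
    unfolding C P
  proof (rule sets.sets_Collect_countable_All')
    fix e assume "e \<in> J"
    then have "Measurable.pred P (\<lambda>\<omega>. \<omega> e)" using J by (auto simp: P)
    from pred_fun2[OF this this, of "\<lambda>a b. a \<in> F e"]
    show "{\<omega> \<in> space (bits E (\<lambda>_. bernoulli_pmf p)). \<omega> e \<in> F e} \<in> sets (bits E (\<lambda>_. bernoulli_pmf p))"
      by (simp only: P pred_def)
  qed (use J in \<open>auto intro: countable_finite\<close>)
  have Cg_eq: "Cg g = shift g -` C \<inter> space P" if g: "g \<in> carrier G" for g
  proof -
    have sp: "shift g \<omega> \<in> space P" if "\<omega> \<in> space P" for \<omega>
      using measurable_space[OF measurable_shift[OF g]] that unfolding P .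
    have "shift g \<omega> e = \<omega> ((\<otimes>) g ` e)" if "e \<in> J" for e \<omega>
      using that J by (simp add: shift_def subset_iff)
    then have "\<omega> \<in> Cg g \<longleftrightarrow> \<omega> \<in> shift g -` C \<inter> space P" for \<omega>
      using sp[of \<omega>] by (simp only: Cg_def C mem_Collect_eq Int_iff vimage_eq simp_thms cong: conj_cong ball_cong) blast
    then show ?thesis by (rule Set.set_eqI)
  qed
  have Cg_sets [measurable]: "Cg g \<in> sets P" if g: "g \<in> carrier G" for g
    unfolding Cg_eq[OF g] using C_sets measurable_shift[OF g] unfolding P by (intro measurable_sets)
  have prob_Cg: "prob (Cg g) = c" if g: "g \<in> carrier G" for g
    unfolding Cg_eq[OF g] c_def using measure_shift[OF g] C_sets by (simp add: P_def)
  have prob_ACg: "prob (A \<inter> Cg g) = prob (A \<inter> C)" if g: "g \<in> carrier G" for g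
  proof -
    have "A \<inter> Cg g = shift g -` (A \<inter> C) \<inter> space P"
      using inv[OF g] sets.sets_into_space[OF A] unfolding Cg_eq[OF g] by auto
    then show ?thesis using measure_shift[OF g, of "A \<inter> C" p] A C_sets by (simp add: P_def)
  qed
  define W where "W = \<Union> J"
  have W: "finite W" "W \<subseteq> carrier G"
    using J edge_sub unfolding W_def by (auto elim!: edgeE dest!: subsetD[OF J(2)])
  have J_ne: "e \<noteq> {}" if "e \<in> J" for e using that J by (auto elim!: edgeE)
  have prob_Cgh: "prob (Cg g \<inter> Cg h) = c * c"
    if g: "g \<in> carrier G" and h: "h \<in> carrier G" and disj: "(\<otimes>) g ` W \<inter> (\<otimes>) h ` W = {}" for g h
  proof -
    \<comment> \<open>Equal translations are compatible with disjointness only for empty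
      \<open>J\<close>, when the cylinder is the whole space and \<open>c * c = c\<close>.\<close>
    have gh: "g \<noteq> h \<or> J = {}"
      using disj J_ne by (auto simp: W_def)
    let ?f = "\<lambda>(k, e). (\<otimes>) k ` e"
    have inj: "inj_on ?f ({g, h} \<times> J)"
    proof (rule inj_onI, clarify)
      fix k l e e' assume kl: "k \<in> {g, h}" "l \<in> {g, h}" and e: "e \<in> J" "e' \<in> J"
        and eq: "(\<otimes>) k ` e = (\<otimes>) l ` e'"
      have "k = l"
      proof (rule ccontr)
        assume "k \<noteq> l"
        then have "(\<otimes>) k ` e \<inter> (\<otimes>) l ` e' = {}"
          using disj kl e unfolding W_def by blast
        then show False using eq J_ne[OF e(1)] by simp
      qed
      moreover have "e = e'"
      proof (rule inj_onD[OF inj_on_image_transl])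
        show "k \<in> carrier G" using kl g h by auto
      qed (use eq \<open>k = l\<close> e J in auto)
      ultimately show "k = l \<and> e = e'" by simp
    qed
    have "emeasure P {\<omega> \<in> space P. \<forall>i\<in>{g, h} \<times> J. \<omega> (?f i) \<in> F (snd i)} =
        (\<Prod>i\<in>{g, h} \<times> J. emeasure (bernoulli_pmf p) (F (snd i)))"
      unfolding P using J g h image_transl_closed by (intro emeasure_bits_cylinder_reindex inj) auto
    also have "{\<omega> \<in> space P. \<forall>i\<in>{g, h} \<times> J. \<omega> (?f i) \<in> F (snd i)} = Cg g \<inter> Cg h"
      by (auto simp: Cg_def)
    also have "(\<Prod>i\<in>{g, h} \<times> J. emeasure (bernoulli_pmf p) (F (snd i))) =
        (\<Prod>k\<in>{g, h}. \<Prod>e\<in>J. emeasure (bernoulli_pmf p) (F e))"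
      by (simp only: prod.cartesian_product split_def)
    also have "\<dots> = (\<Prod>k\<in>{g, h}. emeasure P C)"
      unfolding C P by (simp only: emeasure_bits_cylinder[OF J])
    also have "\<dots> = emeasure P C * emeasure P C"
    proof (cases "g = h")
      case True
      then have "C = space P" using gh by (auto simp: C)
      then show ?thesis using True emeasure_space_1 by simp
    qed simp
    finally show ?thesis
      by (simp add: emeasure_eq_measure c_def ennreal_mult[symmetric])
  qed
  have bound: "real n * d\<^sup>2 \<le> 1" if n: "n > 0" for n
  proof -
    obtain \<Gamma> where \<Gamma>: "\<Gamma> \<subseteq> carrier G" "finite \<Gamma>" "card \<Gamma> = n"
      "\<And>g h. g \<in> \<Gamma> \<Longrightarrow> h \<in> \<Gamma> \<Longrightarrow> g \<noteq> h \<Longrightarrow> (\<otimes>) g ` W \<inter> (\<otimes>) h ` W = {}"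
      using ex_disjoint_translates[OF W, of n] by blast
    define Y where "Y g \<omega> = indicator (Cg g) \<omega> - c" for g \<omega>
    define Z where "Z \<omega> = (\<Sum>g\<in>\<Gamma>. Y g \<omega>)" for \<omega>
    have [measurable]: "g \<in> \<Gamma> \<Longrightarrow> Cg g \<in> sets P" for g using \<Gamma>(1) Cg_sets by auto
    note [measurable] = A
    have XX: "Y g \<omega> * Y h \<omega> = indicator (Cg g \<inter> Cg h) \<omega> - c * indicator (Cg g) \<omega> - c * indicator (Cg h) \<omega> + c * c" for g h \<omega>
      by (simp add: Y_def algebra_simps indicator_inter_arith)
    have int_XX: "integrable P (\<lambda>\<omega>. Y g \<omega> * Y h \<omega>)" if "g \<in> \<Gamma>" "h \<in> \<Gamma>" for g h
      using that unfolding XX by (intro Bochner_Integration.integrable_add Bochner_Integration.integrable_diff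
          integrable_mult_right integrable_real_indicator) (auto simp: emeasure_eq_measure)
    have E_XX: "(\<integral>\<omega>. Y g \<omega> * Y h \<omega> \<partial>P) = prob (Cg g \<inter> Cg h) - c * c" if "g \<in> \<Gamma>" "h \<in> \<Gamma>" for g h
    proof -
      have "(\<integral>\<omega>. Y g \<omega> * Y h \<omega> \<partial>P) = prob (Cg g \<inter> Cg h) - c * prob (Cg g) - c * prob (Cg h) + c * c"
        unfolding XX using that
        by (subst Bochner_Integration.integral_add Bochner_Integration.integral_diff,
            (auto simp: emeasure_eq_measure prob_space)[2])+ (simp add: prob_space)
      then show ?thesis using that \<Gamma>(1) prob_Cg[of g] prob_Cg[of h] by (auto simp: subset_iff)
    qed
    have int_X: "integrable P (Y g)" if "g \<in> \<Gamma>" for g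
      using that unfolding Y_def[abs_def] by (auto simp: emeasure_eq_measure)
    have ZZ: "Z \<omega> * Z \<omega> = (\<Sum>g\<in>\<Gamma>. \<Sum>h\<in>\<Gamma>. Y g \<omega> * Y h \<omega>)" for \<omega>
      by (simp add: Z_def sum_product)
    have int_ZZ: "integrable P (\<lambda>\<omega>. Z \<omega> * Z \<omega>)"
      unfolding ZZ by (intro Bochner_Integration.integrable_sum int_XX)
    have "(\<integral>\<omega>. Z \<omega> * Z \<omega> \<partial>P) = (\<Sum>g\<in>\<Gamma>. \<Sum>h\<in>\<Gamma>. prob (Cg g \<inter> Cg h) - c * c)"
      unfolding ZZ by (simp add: Bochner_Integration.integral_sum int_XX E_XX)
    \<comment> \<open>Events on disjoint translates are uncorrelated, so only the diagonal survives
      and the second moment of \<open>Z\<close> is of order \<open>n\<close> instead of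
      \<open>n\<close> squared.\<close>
    also have "\<dots> = (\<Sum>g\<in>\<Gamma>. \<Sum>h\<in>\<Gamma>. if h = g then c - c * c else 0)"
    proof (intro sum.cong refl)
      fix g h assume "g \<in> \<Gamma>" "h \<in> \<Gamma>"
      then show "prob (Cg g \<inter> Cg h) - c * c = (if h = g then c - c * c else 0)"
        using \<Gamma>(1) \<Gamma>(4)[of g h] prob_Cgh[of g h] prob_Cg[of g] by (auto simp: subset_iff)
    qed
    also have "\<dots> = n * (c - c * c)" using \<Gamma> by simp
    also have "\<dots> \<le> real n * 1"
    proof (rule mult_left_mono)
      show "c - c * c \<le> 1"
        unfolding c_def using prob_le_1[of C] zero_le_square[of "prob C"] by linarith
    qed simp
    finally have EZZ: "(\<integral>\<omega>. Z \<omega> * Z \<omega> \<partial>P) \<le> n" by simp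
    have AX: "indicator A \<omega> * Y g \<omega> = indicator (A \<inter> Cg g) \<omega> - c * indicator A \<omega>" for g \<omega>
      by (simp add: Y_def algebra_simps indicator_inter_arith)
    have int_AX: "integrable P (\<lambda>\<omega>. indicator A \<omega> * Y g \<omega>)" if "g \<in> \<Gamma>" for g
      using that unfolding AX by (auto simp: emeasure_eq_measure)
    have E_AX: "(\<integral>\<omega>. indicator A \<omega> * Y g \<omega> \<partial>P) = d" if "g \<in> \<Gamma>" for g
      using that subsetD[OF \<Gamma>(1) that] prob_ACg[of g] unfolding AX d_def
      by (subst Bochner_Integration.integral_diff) (auto simp: emeasure_eq_measure)
    have AZ: "indicator A \<omega> * Z \<omega> = (\<Sum>g\<in>\<Gamma>. indicator A \<omega> * Y g \<omega>)" for \<omega>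
      by (simp add: Z_def sum_distrib_left)
    have int_AZ: "integrable P (\<lambda>\<omega>. indicator A \<omega> * Z \<omega>)"
      unfolding AZ by (intro Bochner_Integration.integrable_sum int_AX)
    have EAZ: "(\<integral>\<omega>. indicator A \<omega> * Z \<omega> \<partial>P) = n * d"
    proof -
      have "(\<integral>\<omega>. indicator A \<omega> * Z \<omega> \<partial>P) = (\<Sum>g\<in>\<Gamma>. \<integral>\<omega>. indicator A \<omega> * Y g \<omega> \<partial>P)"
        unfolding AZ by (rule Bochner_Integration.integral_sum[OF int_AX])
      also have "\<dots> = (\<Sum>g\<in>\<Gamma>. d)" by (intro sum.cong refl E_AX)
      finally show ?thesis using \<Gamma> by simp
    qed
    \<comment> \<open>The multiple \<open>n * d\<close> is the correlation of \<open>Z\<close> with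
      the indicator of \<open>A\<close>. Expanding the square gives
      \<open>0 \<le> n - (n * d)\<^sup>2\<close>, and since \<open>n\<close> is arbitrary,
      \<open>d\<close> must be 0.\<close>
    have "0 \<le> (\<integral>\<omega>. (Z \<omega> - n * d * indicator A \<omega>)\<^sup>2 \<partial>P)"
      by (rule integral_nonneg_AE) auto
    also have "\<dots> = (\<integral>\<omega>. Z \<omega> * Z \<omega> - 2 * (n * d) * (indicator A \<omega> * Z \<omega>) + (n * d)\<^sup>2 * indicator A \<omega> \<partial>P)"
      by (intro Bochner_Integration.integral_cong) (auto simp: power2_eq_square algebra_simps indicator_def)
    also have "\<dots> = (\<integral>\<omega>. Z \<omega> * Z \<omega> \<partial>P) - 2 * (n * d) * (n * d) + (n * d)\<^sup>2 * prob A"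
      using int_ZZ int_AZ by (simp add: EAZ emeasure_eq_measure)
    also have "\<dots> \<le> n - 2 * (n * d) * (n * d) + (n * d)\<^sup>2 * 1"
      using EZZ mult_left_mono[OF prob_le_1[of A], of "(n * d)\<^sup>2"] by simp
    also have "\<dots> = n * (1 - n * d\<^sup>2)" by (simp add: power2_eq_square algebra_simps)
    finally show "n * d\<^sup>2 \<le> 1" using n by (simp add: zero_le_mult_iff)
  qed
  have "d\<^sup>2 = 0"
  proof (rule ccontr)
    assume "d\<^sup>2 \<noteq> 0"
    then have "d\<^sup>2 > 0" by simp
    then obtain n :: nat where "1 / d\<^sup>2 < n" using reals_Archimedean2 by blast
    then have "1 < n * d\<^sup>2" using \<open>d\<^sup>2 > 0\<close> by (simp add: field_simps)
    moreover have "n > 0" using \<open>1 / d\<^sup>2 < n\<close> \<open>d\<^sup>2 > 0\<close> by (cases n) (auto simp: field_simps)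
    ultimately show False using bound[of n] by simp
  qed
  then show ?thesis by (simp add: d_def c_def)
qed

text \<open>If \<open>A\<close> has positive probability, conditioning on \<open>A\<close> does not
  change the probabilities of cylinders, hence does not change the measure at all. Evaluating both
  measures at \<open>A\<close> gives probability 1.\<close>

lemma invariant_zero_one:
  fixes p defines "P \<equiv> percolation E p"
  assumes A: "A \<in> sets P"
    and inv: "\<And>g \<omega>. g \<in> carrier G \<Longrightarrow> \<omega> \<in> space P \<Longrightarrow> shift g \<omega> \<in> A \<longleftrightarrow> \<omega> \<in> A"
  shows "measure P A = 0 \<or> measure P A = 1"
proof (rule disjCI)
  interpret prob_space P unfolding P_def by (rule prob_space_percolation)
  assume pos: "prob A \<noteq> 1"
  show "prob A = 0"
  proof (rule ccontr)
    assume "prob A \<noteq> 0"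
    then have A_pos: "prob A > 0" by (simp add: zero_less_measure_iff)
    interpret PP: product_prob_space "\<lambda>_. measure_pmf (bernoulli_pmf p)" E
      by unfold_locales
    have "uniform_measure P A = PiM E (\<lambda>_. measure_pmf (bernoulli_pmf p))"
    proof (rule PP.PiM_eq)
      fix J F assume J: "finite J" "J \<subseteq> E"
      let ?C = "prod_emb E (\<lambda>_. measure_pmf (bernoulli_pmf p)) J (PiE J F)"
      have C: "?C = {\<omega> \<in> space P. \<forall>e\<in>J. \<omega> e \<in> F e}"
        using J by (auto simp: prod_emb_def P_def percolation_bits space_bits PiE_iff extensional_def)
      have C_sets: "?C \<in> sets P" using J by (auto simp: P_def percolation_def intro!: sets_PiM_I)
      have "emeasure (uniform_measure P A) ?C = emeasure P (A \<inter> ?C) / emeasure P A"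
        by (rule emeasure_uniform_measure[OF A C_sets])
      also have "emeasure P (A \<inter> ?C) = ennreal (prob A * prob ?C)"
        using invariant_indep_cylinder[of A p J ?C F] A inv J C by (simp add: P_def[symmetric] emeasure_eq_measure)
      also have "\<dots> / emeasure P A = emeasure P ?C"
        using A_pos by (simp add: emeasure_eq_measure divide_ennreal)
      also have "\<dots> = (\<Prod>j\<in>J. emeasure (bernoulli_pmf p) (F j))"
        unfolding C P_def percolation_bits by (rule emeasure_bits_cylinder[OF J])
      finally show "emeasure (uniform_measure P A) (prod_emb E (\<lambda>_. measure_pmf (bernoulli_pmf p)) J (\<Pi>\<^sub>E j\<in>J. F j)) =
        (\<Prod>j\<in>J. emeasure (bernoulli_pmf p) (F j))" .
    qed (simp add: P_def percolation_def)
    then have "uniform_measure P A = P" by (simp add: P_def percolation_def)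
    then have "emeasure P A = emeasure P A / emeasure P A"
      using emeasure_uniform_measure[OF A A] by simp
    then show False using A_pos pos by (simp add: emeasure_eq_measure divide_ennreal)
  qed
qed

end

section \<open>Cluster kernels\<close>

text \<open>The form is a sum over the classes of \<open>R\<close> of squares of weighted
  coefficient sums. Reflexivity is not assumed, because \<open>linked\<close> relates a point to
  itself only if the point has a first hit.\<close>

lemma per_form_nonneg:
  assumes sym: "\<And>x y. R x y \<Longrightarrow> R y x" and trans: "\<And>x y z. R x y \<Longrightarrow> R y z \<Longrightarrow> R x z"
    and h: "\<And>x. x \<in> points a \<Longrightarrow> 0 \<le> h x" "\<And>x y. x \<in> points a \<Longrightarrow> y \<in> points a \<Longrightarrow> R x y \<Longrightarrow> h x = h y"
  shows "0 \<le> form (\<lambda>x y. of_bool (R x y) * h x) a a"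
proof -
  define cls where "cls = R"
  \<comment> \<open>A class is encoded as the predicate \<open>R x\<close> of any of its members;
    \<open>v C p\<close> is the contribution of the entry \<open>p\<close> to the class
    \<open>C\<close>, and it is 0 for points that are not related to themselves.\<close>
  define v where "v C p = (if cls (snd p) = C \<and> R (snd p) (snd p) then fst p * sqrt (h (snd p)) else 0)" for C p
  define \<C> where "\<C> = (\<lambda>p. cls (snd p)) ` set a"
  have fin: "finite \<C>" by (simp add: \<C>_def)
  have R_iff: "R x y \<longleftrightarrow> R x x \<and> R y y \<and> cls y = cls x" for x y
  proof
    assume xy: "R x y"
    have "R x z \<longleftrightarrow> R y z" for z using trans[OF xy] trans[OF sym[OF xy]] by blast
    then show "R x x \<and> R y y \<and> cls y = cls x"
      using trans[OF xy sym[OF xy]] trans[OF sym[OF xy] xy] by (auto simp: cls_def)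
  qed (auto simp: cls_def)
  have "fst p * fst q * (of_bool (R (snd p) (snd q)) * h (snd p)) = (\<Sum>C\<in>\<C>. v C p * v C q)"
    if p: "p \<in> set a" and q: "q \<in> set a" for p q
  proof -
    have pq: "snd p \<in> points a" "snd q \<in> points a" using p q by (auto simp: points_def)
    have "v C p * v C q = (if cls (snd p) = C then v C p * v C q else 0)" for C
      by (simp add: v_def)
    then have "(\<Sum>C\<in>\<C>. v C p * v C q) = (\<Sum>C\<in>\<C>. if cls (snd p) = C then v C p * v C q else 0)"
      by (intro sum.cong refl)
    also have "\<dots> = v (cls (snd p)) p * v (cls (snd p)) q"
      using fin p by (simp add: \<C>_def)
    also have "\<dots> = fst p * fst q * (of_bool (R (snd p) (snd q)) * h (snd p))"
    proof (cases "R (snd p) (snd q)")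
      case True
      have "h (snd p) = h (snd q)" by (rule h(2)[OF pq True])
      moreover have "R (snd p) (snd p)" "R (snd q) (snd q)" "cls (snd q) = cls (snd p)"
        using True R_iff[of "snd p" "snd q"] by blast+
      moreover have "sqrt (h (snd p)) * sqrt (h (snd p)) = h (snd p)"
        using h(1)[OF pq(1)] by simp
      ultimately show ?thesis using True by (simp add: v_def mult_ac)
    next
      case False
      then show ?thesis using R_iff[of "snd p" "snd q"] by (auto simp: v_def)
    qed
    finally show ?thesis by simp
  qed
  then have "form (\<lambda>x y. of_bool (R x y) * h x) a a = (\<Sum>p\<leftarrow>a. \<Sum>q\<leftarrow>a. \<Sum>C\<in>\<C>. v C p * v C q)"
    unfolding form_def by (intro sum_list_cong) auto
  also have "\<dots> = (\<Sum>C\<in>\<C>. (\<Sum>p\<leftarrow>a. v C p)\<^sup>2)"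
  proof -
    have swap: "(\<Sum>p\<leftarrow>b. \<Sum>C\<in>\<C>. f p C) = (\<Sum>C\<in>\<C>. \<Sum>p\<leftarrow>b. f p C)" for b :: "(real \<times> 'a) list" and f :: "real \<times> 'a \<Rightarrow> _ \<Rightarrow> real"
      by (induction b) (simp_all add: sum.distrib)
    have "(\<Sum>p\<leftarrow>a. \<Sum>q\<leftarrow>a. \<Sum>C\<in>\<C>. v C p * v C q) = (\<Sum>C\<in>\<C>. \<Sum>p\<leftarrow>a. \<Sum>q\<leftarrow>a. v C p * v C q)"
      by (simp only: swap)
    also have "\<dots> = (\<Sum>C\<in>\<C>. (\<Sum>p\<leftarrow>a. v C p)\<^sup>2)"
      by (simp add: sum_list_const_mult sum_list_mult_const power2_eq_square)
    finally show ?thesis .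
  qed
  also have "0 \<le> \<dots>" by (intro sum_nonneg) auto
  finally show ?thesis .
qed

lemma form_integral:
  assumes "\<And>x y. x \<in> points a \<Longrightarrow> y \<in> points b \<Longrightarrow> integrable M (\<lambda>w. k w x y)"
  shows "integrable M (\<lambda>w. form (k w) a b)"
    and "form (\<lambda>x y. \<integral>w. k w x y \<partial>M) a b = (\<integral>w. form (k w) a b \<partial>M)"
proof -
  have *: "integrable M (\<lambda>w. \<Sum>p\<leftarrow>c. f p w) \<and> (\<integral>w. (\<Sum>p\<leftarrow>c. f p w) \<partial>M) = (\<Sum>p\<leftarrow>c. \<integral>w. f p w \<partial>M)"
    if "\<And>p. p \<in> set c \<Longrightarrow> integrable M (f p)" for c :: "(real \<times> 'a) list" and f :: "real \<times> 'a \<Rightarrow> _ \<Rightarrow> real"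
    using that by (induction c) simp_all
  have int: "integrable M (\<lambda>w. fst p * fst q * k w (snd p) (snd q))" if "p \<in> set a" "q \<in> set b" for p q
    using assms that by (auto simp: points_def)
  have inner: "integrable M (\<lambda>w. \<Sum>q\<leftarrow>b. fst p * fst q * k w (snd p) (snd q))"
    "(\<integral>w. (\<Sum>q\<leftarrow>b. fst p * fst q * k w (snd p) (snd q)) \<partial>M) = (\<Sum>q\<leftarrow>b. fst p * fst q * (\<integral>w. k w (snd p) (snd q) \<partial>M))"
    if p: "p \<in> set a" for p
    using *[of b "\<lambda>q w. fst p * fst q * k w (snd p) (snd q)"] int[OF p] by simp_all
  show "integrable M (\<lambda>w. form (k w) a b)"
    unfolding form_def using *[of a "\<lambda>p w. \<Sum>q\<leftarrow>b. fst p * fst q * k w (snd p) (snd q)"] inner(1) by blast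
  have "(\<integral>w. form (k w) a b \<partial>M) = (\<Sum>p\<leftarrow>a. \<integral>w. (\<Sum>q\<leftarrow>b. fst p * fst q * k w (snd p) (snd q)) \<partial>M)"
    unfolding form_def using *[of a "\<lambda>p w. \<Sum>q\<leftarrow>b. fst p * fst q * k w (snd p) (snd q)"] inner(1) by blast
  also have "\<dots> = form (\<lambda>x y. \<integral>w. k w x y \<partial>M) a b"
    unfolding form_def by (intro sum_list_cong) (simp add: inner(2))
  finally show "form (\<lambda>x y. \<integral>w. k w x y \<partial>M) a b = (\<integral>w. form (k w) a b \<partial>M)" by simp
qed

context cayley
begin

text \<open>One product space serves both couplings: sprinkling takes the union of the two levels,
  thinning their intersection.\<close>

definition two_level :: "real \<Rightarrow> real \<Rightarrow> (('a set \<Rightarrow> bool) \<times> ('a set \<Rightarrow> bool)) measure" where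
  "two_level p q = percolation E p \<Otimes>\<^sub>M percolation E q"

definition shift2 :: "'a \<Rightarrow> ('a set \<Rightarrow> bool) \<times> ('a set \<Rightarrow> bool) \<Rightarrow> ('a set \<Rightarrow> bool) \<times> ('a set \<Rightarrow> bool)" where
  "shift2 g = map_prod (shift g) (shift g)"

lemma prob_space_two_level: "prob_space (two_level p q)"
  unfolding two_level_def by (intro prob_space_pair prob_space_percolation)

lemma pred_fst: "e \<in> E \<Longrightarrow> Measurable.pred (two_level p q) (\<lambda>w. fst w e)"
  unfolding two_level_def percolation_bits by (rule measurable_compose[OF measurable_fst pred_bits])

lemma pred_snd: "e \<in> E \<Longrightarrow> Measurable.pred (two_level p q) (\<lambda>w. snd w e)"
  unfolding two_level_def percolation_bits by (rule measurable_compose[OF measurable_snd pred_bits])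

lemma measurable_shift2: "g \<in> carrier G \<Longrightarrow> shift2 g \<in> measurable (two_level p q) (two_level p q)"
  unfolding two_level_def percolation_bits shift2_def map_prod_def
  by (auto intro!: measurable_Pair measurable_compose[OF measurable_fst] measurable_compose[OF measurable_snd]
      measurable_shift simp: split_def)

lemma distr_shift2:
  assumes g: "g \<in> carrier G"
  shows "distr (two_level p q) (two_level p q) (shift2 g) = two_level p q"
proof -
  interpret prob_space "distr (percolation E q) (percolation E q) (shift g)"
    unfolding distr_shift[OF g] by (rule prob_space_percolation)
  have "distr (percolation E p) (percolation E p) (shift g) \<Otimes>\<^sub>M distr (percolation E q) (percolation E q) (shift g) =
      distr (two_level p q) (two_level p q) (\<lambda>(x, y). (shift g x, shift g y))"
    unfolding two_level_def
  proof (rule pair_measure_distr)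
    show "sigma_finite_measure (distr (percolation E q) (percolation E q) (shift g))"
      by (rule sigma_finite_measure_axioms)
  qed (auto simp: percolation_bits g measurable_shift)
  then show ?thesis
    by (simp add: distr_shift[OF g] two_level_def shift2_def map_prod_def split_def)
qed

text \<open>Observables of a cluster of the lower configuration that is given by one of its points \<open>x\<close>.\<close>

definition cluster_fun :: "real \<Rightarrow> real \<Rightarrow> real \<Rightarrow> (('a set \<Rightarrow> bool) \<times> ('a set \<Rightarrow> bool) \<Rightarrow> 'a \<Rightarrow> real) \<Rightarrow> bool" where
  "cluster_fun p q B h \<longleftrightarrow>
    (\<forall>x\<in>carrier G. (\<lambda>w. h w x) \<in> borel_measurable (two_level p q)) \<and>
    (\<forall>w. \<forall>x\<in>carrier G. 0 \<le> h w x \<and> h w x \<le> B) \<and>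
    (\<forall>w. \<forall>x\<in>carrier G. \<forall>y\<in>carrier G. conn (fst w) x y \<longrightarrow> h w x = h w y)"

definition cluster_kernel ::
  "real \<Rightarrow> real \<Rightarrow> (('a set \<Rightarrow> bool) \<times> ('a set \<Rightarrow> bool) \<Rightarrow> 'a \<Rightarrow> real) \<Rightarrow> 'a \<Rightarrow> 'a \<Rightarrow> real" where
  "cluster_kernel p q h x y = (\<integral>w. of_bool (conn (fst w) x y) * h w x \<partial>two_level p q)"

lemma cluster_funD:
  assumes "cluster_fun p q B h" "x \<in> carrier G"
  shows "(\<lambda>w. h w x) \<in> borel_measurable (two_level p q)" "0 \<le> h w x" "h w x \<le> B"
    "y \<in> carrier G \<Longrightarrow> conn (fst w) x y \<Longrightarrow> h w x = h w y"
  using assms unfolding cluster_fun_def by blast+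

lemma cluster_funI:
  assumes "\<And>x. x \<in> carrier G \<Longrightarrow> (\<lambda>w. h w x) \<in> borel_measurable (two_level p q)"
    and "\<And>w x. x \<in> carrier G \<Longrightarrow> 0 \<le> h w x" "\<And>w x. x \<in> carrier G \<Longrightarrow> h w x \<le> B"
    and "\<And>w x y. x \<in> carrier G \<Longrightarrow> y \<in> carrier G \<Longrightarrow> conn (fst w) x y \<Longrightarrow> h w x = h w y"
  shows "cluster_fun p q B h"
  unfolding cluster_fun_def by (intro conjI ballI allI impI) (rule assms; assumption)+

lemma borel_of_bool: "Measurable.pred M Q \<Longrightarrow> (\<lambda>w. of_bool (Q w) :: real) \<in> borel_measurable M"
  unfolding of_bool_def by (rule measurable_If) (simp_all only: pred_def borel_measurable_const)

lemma cluster_kernel_measurable: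
  assumes "cluster_fun p q B h" "x \<in> carrier G"
  shows "(\<lambda>w. of_bool (conn (fst w) x y) * h w x) \<in> borel_measurable (two_level p q)"
  by (intro borel_measurable_times borel_of_bool pred_conn pred_fst cluster_funD(1)[OF assms])

lemma cluster_kernel_integrable:
  assumes h: "cluster_fun p q B h" and x: "x \<in> carrier G"
  shows "integrable (two_level p q) (\<lambda>w. of_bool (conn (fst w) x y) * h w x)"
proof -
  interpret prob_space "two_level p q" by (rule prob_space_two_level)
  have "\<bar>of_bool (conn (fst w) x y) * h w x\<bar> \<le> B" for w
    using cluster_funD(2,3)[OF h x, of w] by simp
  then show ?thesis
    by (intro integrable_const_bound[where B=B] AE_I2 cluster_kernel_measurable[OF assms]) simp
qed

lemma form_cluster_kernel:
  assumes h: "cluster_fun p q B h" and a: "points a \<subseteq> carrier G" and b: "points b \<subseteq> carrier G"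
  shows "form (cluster_kernel p q h) a b = (\<integral>w. form (\<lambda>x y. of_bool (conn (fst w) x y) * h w x) a b \<partial>two_level p q)"
  unfolding cluster_kernel_def[abs_def]
  using cluster_kernel_integrable[OF h] a by (intro form_integral(2)) auto

lemma psd_cluster_kernel:
  assumes h: "cluster_fun p q B h"
  shows "psd_kernel (carrier G) (cluster_kernel p q h)"
proof
  fix x y assume xy: "x \<in> carrier G" "y \<in> carrier G"
  have "of_bool (conn (fst w) x y) * h w x = of_bool (conn (fst w) y x) * h w y" for w
    using cluster_funD(4)[OF h xy, of w] conn_commute[of "fst w" x y] by auto
  then show "cluster_kernel p q h x y = cluster_kernel p q h y x"
    by (simp add: cluster_kernel_def)
next
  fix a assume a: "points a \<subseteq> carrier G"
  show "0 \<le> form (cluster_kernel p q h) a a"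
    unfolding form_cluster_kernel[OF h a a]
  proof (rule integral_nonneg_AE, intro AE_I2 per_form_nonneg)
    show "conn (fst w) x y \<Longrightarrow> conn (fst w) y x" for w x y by (rule conn_sym)
    show "conn (fst w) x y \<Longrightarrow> conn (fst w) y z \<Longrightarrow> conn (fst w) x z" for w x y z by (rule conn_trans)
    show "0 \<le> h w x" if "x \<in> points a" for w x
      using cluster_funD(2)[OF h] that a by blast
    show "h w x = h w y" if "x \<in> points a" "y \<in> points a" "conn (fst w) x y" for w x y
      using cluster_funD(4)[OF h] that a by blast
  qed
qed

lemma cluster_fun_const: "0 \<le> c \<Longrightarrow> c \<le> B \<Longrightarrow> cluster_fun p q B (\<lambda>w x. c)"
  by (simp add: cluster_fun_def)

lemma cluster_fun_add:
  "cluster_fun p q B h \<Longrightarrow> cluster_fun p q C k \<Longrightarrow> cluster_fun p q (B + C) (\<lambda>w x. h w x + k w x)"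
  by (intro cluster_funI borel_measurable_add add_nonneg_nonneg add_mono arg_cong2[of _ _ _ _ "(+)"])
    (rule cluster_funD, assumption+)+

lemma cluster_fun_scale:
  "cluster_fun p q B h \<Longrightarrow> 0 \<le> c \<Longrightarrow> cluster_fun p q (c * B) (\<lambda>w x. c * h w x)"
  by (intro cluster_funI borel_measurable_times borel_measurable_const mult_nonneg_nonneg mult_left_mono
      arg_cong2[of _ _ _ _ "(*)"] refl) ((rule cluster_funD)?, assumption+)+

lemma cluster_fun_diff:
  assumes "cluster_fun p q B h" "cluster_fun p q C k" "\<And>w x. x \<in> carrier G \<Longrightarrow> k w x \<le> h w x"
  shows "cluster_fun p q B (\<lambda>w x. h w x - k w x)"
  unfolding cluster_fun_def
proof (intro conjI ballI allI impI)
  fix x w assume x: "x \<in> carrier G"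
  show "(\<lambda>w. h w x - k w x) \<in> borel_measurable (two_level p q)"
    by (intro borel_measurable_diff cluster_funD(1)[OF assms(1) x] cluster_funD(1)[OF assms(2) x])
  show "0 \<le> h w x - k w x" using assms(3)[OF x, of w] by simp
  show "h w x - k w x \<le> B"
    using cluster_funD(3)[OF assms(1) x, of w] cluster_funD(2)[OF assms(2) x, of w] by simp
  fix y assume "y \<in> carrier G" "conn (fst w) x y"
  then show "h w x - k w x = h w y - k w y"
    using cluster_funD(4)[OF assms(1) x] cluster_funD(4)[OF assms(2) x] by simp
qed

lemma cluster_kernel_add:
  assumes "cluster_fun p q B h" "cluster_fun p q C k" "x \<in> carrier G"
  shows "cluster_kernel p q (\<lambda>w x. h w x + k w x) x y = cluster_kernel p q h x y + cluster_kernel p q k x y"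
  using cluster_kernel_integrable[OF assms(1,3), of y] cluster_kernel_integrable[OF assms(2,3), of y]
  by (simp add: cluster_kernel_def distrib_left)

lemma cluster_kernel_scale: "cluster_kernel p q (\<lambda>w x. c * h w x) x y = c * cluster_kernel p q h x y"
proof -
  have "(\<lambda>w. of_bool (conn (fst w) x y) * (c * h w x)) = (\<lambda>w. c * (of_bool (conn (fst w) x y) * h w x))"
    by (rule ext) (rule mult.left_commute)
  then show ?thesis by (simp add: cluster_kernel_def)
qed

text \<open>The point \<open>inv g \<otimes> x\<close> names in \<open>shift2 g w\<close> the
  translate of the cluster that \<open>x\<close> names in \<open>w\<close>, so the left-hand side
  contains the translated observable. The law of the two levels is invariant.\<close>

lemma cluster_kernel_shift:
  assumes g: "g \<in> carrier G" and h: "cluster_fun p q B h" and x: "x \<in> carrier G" and y: "y \<in> carrier G"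
  shows "cluster_kernel p q (\<lambda>w x. h (shift2 g w) (inv g \<otimes> x)) x y = cluster_kernel p q h (inv g \<otimes> x) (inv g \<otimes> y)"
proof -
  have gx: "inv g \<otimes> x \<in> carrier G" "inv g \<otimes> y \<in> carrier G" using g x y by auto
  have "conn (fst (shift2 g w)) (inv g \<otimes> x) (inv g \<otimes> y) \<longleftrightarrow> conn (fst w) x y" for w
    using conn_shift[OF g gx, of "fst w"] g x y by (simp add: shift2_def m_assoc[symmetric])
  then have "cluster_kernel p q (\<lambda>w x. h (shift2 g w) (inv g \<otimes> x)) x y =
      (\<integral>w. of_bool (conn (fst (shift2 g w)) (inv g \<otimes> x) (inv g \<otimes> y)) * h (shift2 g w) (inv g \<otimes> x) \<partial>two_level p q)"
    by (simp add: cluster_kernel_def)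
  also have "\<dots> = (\<integral>w. of_bool (conn (fst w) (inv g \<otimes> x) (inv g \<otimes> y)) * h w (inv g \<otimes> x) \<partial>distr (two_level p q) (two_level p q) (shift2 g))"
    by (rule integral_distr[symmetric, OF measurable_shift2[OF g] cluster_kernel_measurable[OF h gx(1)]])
  also have "\<dots> = cluster_kernel p q h (inv g \<otimes> x) (inv g \<otimes> y)"
    by (simp add: distr_shift2[OF g] cluster_kernel_def)
  finally show ?thesis .
qed

lemma cluster_fun_shift:
  assumes g: "g \<in> carrier G" and h: "cluster_fun p q B h"
  shows "cluster_fun p q B (\<lambda>w x. h (shift2 g w) (inv g \<otimes> x))"
  unfolding cluster_fun_def
proof (intro conjI ballI allI impI)
  fix x w assume x: "x \<in> carrier G"
  then have gx: "inv g \<otimes> x \<in> carrier G" using g by simp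
  show "(\<lambda>w. h (shift2 g w) (inv g \<otimes> x)) \<in> borel_measurable (two_level p q)"
    by (rule measurable_compose[OF measurable_shift2[OF g] cluster_funD(1)[OF h gx]])
  show "0 \<le> h (shift2 g w) (inv g \<otimes> x)" "h (shift2 g w) (inv g \<otimes> x) \<le> B"
    using cluster_funD[OF h gx] by auto
  fix y assume y: "y \<in> carrier G" and xy: "conn (fst w) x y"
  then have "conn (fst (shift2 g w)) (inv g \<otimes> x) (inv g \<otimes> y)"
    using conn_shift[OF g gx, of "inv g \<otimes> y" "fst w"] g x by (simp add: shift2_def m_assoc[symmetric])
  then show "h (shift2 g w) (inv g \<otimes> x) = h (shift2 g w) (inv g \<otimes> y)"
    using cluster_funD(4)[OF h gx] g y by simp
qed

abbreviation \<tau> :: "real \<Rightarrow> real \<Rightarrow> 'a \<Rightarrow> 'a \<Rightarrow> real" where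
  "\<tau> p q \<equiv> cluster_kernel p q (\<lambda>w x. 1)"

text \<open>The observable \<open>B - h\<close> is again nonnegative, so its kernel is positive
  semidefinite.\<close>

lemma form_cluster_kernel_le:
  assumes h: "cluster_fun p q B h" and a: "points a \<subseteq> carrier G"
  shows "form (cluster_kernel p q h) a a \<le> B * form (\<tau> p q) a a"
proof -
  have B: "0 \<le> B" using cluster_funD[OF h one_closed] by (meson order_trans)
  have d: "cluster_fun p q B (\<lambda>w x. B * 1 - h w x)"
    using cluster_funD(3)[OF h] B by (intro cluster_fun_diff[OF _ h]) (auto intro: cluster_fun_const)
  have "0 \<le> form (cluster_kernel p q (\<lambda>w x. B * 1 - h w x)) a a"
    by (rule psd_kernel.form_nonneg[OF psd_cluster_kernel[OF d] a])
  moreover have "form (\<lambda>x y. B * \<tau> p q x y) a a =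
      form (\<lambda>x y. cluster_kernel p q (\<lambda>w x. B * 1 - h w x) x y + cluster_kernel p q h x y) a a"
  proof (rule form_cong)
    fix x y assume "x \<in> points a"
    then have "x \<in> carrier G" using a by auto
    from cluster_kernel_add[OF d h this, of y]
    show "B * \<tau> p q x y = cluster_kernel p q (\<lambda>w x. B * 1 - h w x) x y + cluster_kernel p q h x y"
      using cluster_kernel_scale[of p q B "\<lambda>w x. 1" x y] by simp
  qed
  ultimately show ?thesis by (simp add: form_scale_kernel form_add_kernel)
qed

text \<open>By symmetry the left-hand side is the bilinear value at \<open>a - b\<close> and
  \<open>a + b\<close>, to which Cauchy-Schwarz applies. The bound involves the two-point kernel
  only, so closeness of two combinations in its seminorm controls all observables at once.\<close>

lemma form_cluster_kernel_diff:
  assumes h: "cluster_fun p q B h" and a: "points a \<subseteq> carrier G" and b: "points b \<subseteq> carrier G"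
  shows "\<bar>form (cluster_kernel p q h) a a - form (cluster_kernel p q h) b b\<bar> \<le>
    B * sqrt (form (\<tau> p q) (diff_comb a b) (diff_comb a b) * form (\<tau> p q) (a @ b) (a @ b))"
proof -
  interpret psd_kernel "carrier G" "cluster_kernel p q h" by (rule psd_cluster_kernel[OF h])
  have B: "0 \<le> B" using cluster_funD[OF h one_closed] by (meson order_trans)
  have d: "points (diff_comb a b) \<subseteq> carrier G" and s: "points (a @ b) \<subseteq> carrier G" using a b by auto
  have "form (cluster_kernel p q h) a a - form (cluster_kernel p q h) b b =
      form (cluster_kernel p q h) (diff_comb a b) (a @ b)"
    using form_commute[OF a b] by (simp add: form_simps)
  also have "\<bar>\<dots>\<bar> \<le> sqrt (form (cluster_kernel p q h) (diff_comb a b) (diff_comb a b) *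
      form (cluster_kernel p q h) (a @ b) (a @ b))"
    using Cauchy_Schwarz[OF d s] by (simp add: snorm_def real_sqrt_mult)
  also have "\<dots> \<le> sqrt ((B * form (\<tau> p q) (diff_comb a b) (diff_comb a b)) * (B * form (\<tau> p q) (a @ b) (a @ b)))"
  proof (intro real_sqrt_le_mono mult_mono form_cluster_kernel_le[OF h] form_nonneg d s)
    have "0 \<le> form (\<tau> p q) (diff_comb a b) (diff_comb a b)"
      by (rule psd_kernel.form_nonneg[OF psd_cluster_kernel[OF cluster_fun_const[of 1 1]] d]) auto
    then show "0 \<le> B * form (\<tau> p q) (diff_comb a b) (diff_comb a b)" using B by simp
  qed
  also have "\<dots> = sqrt (B\<^sup>2 * (form (\<tau> p q) (diff_comb a b) (diff_comb a b) * form (\<tau> p q) (a @ b) (a @ b)))"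
    by (simp add: power2_eq_square mult_ac)
  also have "\<dots> = B * sqrt (form (\<tau> p q) (diff_comb a b) (diff_comb a b) * form (\<tau> p q) (a @ b) (a @ b))"
    using B by (simp add: real_sqrt_mult)
  finally show ?thesis .
qed

end

section \<open>The invariant functional of a percolation with long-range order\<close>

lemma form_mono:
  assumes "\<And>r. r \<in> set a \<Longrightarrow> 0 \<le> fst r" "\<And>r. r \<in> set b \<Longrightarrow> 0 \<le> fst r"
    and "\<And>x y. x \<in> points a \<Longrightarrow> y \<in> points b \<Longrightarrow> K x y \<le> L x y"
  shows "form K a b \<le> form L a b"
proof -
  have *: "(\<Sum>r\<leftarrow>c. f r) \<le> (\<Sum>r\<leftarrow>c. g r)" if "\<And>r. r \<in> set c \<Longrightarrow> f r \<le> g r"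
    for c :: "(real \<times> 'a) list" and f g :: "real \<times> 'a \<Rightarrow> real"
    using that by (induction c) (auto intro!: add_mono)
  show ?thesis
    unfolding form_def by (intro * mult_left_mono assms mult_nonneg_nonneg) (auto simp: points_def)
qed

lemma form_const: "form (\<lambda>x y. c) a b = c * (\<Sum>r\<leftarrow>a. fst r) * (\<Sum>r\<leftarrow>b. fst r)"
  using form_left[of "\<lambda>x. c" a b] by (simp add: sum_list_mult_const)

locale long_range = cayley +
  fixes p q c :: real
  assumes c_pos: "0 < c"
    and long_range: "\<lbrakk>x \<in> carrier G; y \<in> carrier G\<rbrakk> \<Longrightarrow> c \<le> \<tau> p q x y"
begin

abbreviation "M \<equiv> two_level p q"
abbreviation "K \<equiv> cluster_kernel p q"
abbreviation "T \<equiv> \<tau> p q"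
abbreviation "cfun \<equiv> cluster_fun p q"

sublocale M: prob_space M by (rule prob_space_two_level)

lemma cfun_one: "cfun 1 (\<lambda>w x. 1)" by (rule cluster_fun_const) auto

sublocale T: psd_kernel "carrier G" T by (rule psd_cluster_kernel[OF cfun_one])

definition cvx :: "(real \<times> 'a) list \<Rightarrow> bool" where
  "cvx a \<longleftrightarrow> points a \<subseteq> carrier G \<and> (\<forall>r\<in>set a. 0 \<le> fst r) \<and> (\<Sum>r\<leftarrow>a. fst r) = 1"

definition D :: real where "D = Inf {form T a a |a. cvx a}"

definition near :: "real \<Rightarrow> (real \<times> 'a) list \<Rightarrow> bool" where
  "near \<delta> a \<longleftrightarrow> cvx a \<and> form T a a \<le> D + \<delta>"

lemma T_le_1: "x \<in> carrier G \<Longrightarrow> T x y \<le> 1"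
proof -
  assume x: "x \<in> carrier G"
  have "T x y \<le> (\<integral>w. 1 \<partial>M)"
    unfolding cluster_kernel_def using cluster_kernel_integrable[OF cfun_one x]
    by (intro integral_mono) auto
  then show ?thesis by (simp add: M.prob_space)
qed

text \<open>Nonnegative weights of sum 1 average the pointwise lower bound. This keeps the minimal
  norm, and later \<open>Q\<close> of the constant 1, away from 0.\<close>

lemma form_T_ge: "cvx a \<Longrightarrow> c \<le> form T a a"
proof -
  assume a: "cvx a"
  have "form (\<lambda>x y. c) a a \<le> form T a a"
    using a long_range by (intro form_mono) (auto simp: cvx_def subset_iff)
  then show ?thesis using a by (simp add: form_const cvx_def)
qed

lemma D_le: "cvx a \<Longrightarrow> D \<le> form T a a"
  unfolding D_def using form_T_ge by (intro cInf_lower bdd_belowI[of _ c]) auto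

lemma cvx_single: "x \<in> carrier G \<Longrightarrow> cvx [(1, x)]"
  by (simp add: cvx_def)

lemma ex_near:
  assumes "0 < \<delta>"
  shows "\<exists>a. near \<delta> a"
proof -
  have "D < D + \<delta>" using assms by simp
  then have "Inf {form T a a |a. cvx a} < D + \<delta>" by (simp only: D_def[symmetric])
  then have "\<exists>z\<in>{form T a a |a. cvx a}. z < D + \<delta>"
    by (rule cInf_lessD[rotated, THEN bexE]) (use cvx_single[OF one_closed] in auto)
  then show ?thesis by (auto simp: near_def)
qed

lemma near_mono: "near \<delta> a \<Longrightarrow> \<delta> \<le> \<epsilon> \<Longrightarrow> near \<epsilon> a"
  by (simp add: near_def)

text \<open>The parallelogram law: two almost minimizers of a positive semidefinite form on a convex set
  are close to each other.\<close>

lemma near_close: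
  assumes a: "near \<delta> a" and b: "near \<delta> b" and h: "cfun B h"
  shows "\<bar>form (K h) a a - form (K h) b b\<bar> \<le> 4 * B * sqrt \<delta>"
proof -
  have pts: "points a \<subseteq> carrier G" "points b \<subseteq> carrier G" using a b by (auto simp: near_def cvx_def)
  have B: "0 \<le> B" using cluster_funD[OF h one_closed] by (meson order_trans)
  have "(\<Sum>r\<leftarrow>scale_comb (1 / 2) (a @ b). fst r) = 1 / 2 * (\<Sum>r\<leftarrow>a @ b. fst r)"
    unfolding scale_comb_def sum_list_const_mult[symmetric] by (simp add: o_def)
  moreover have "\<forall>r\<in>set (scale_comb (1 / 2) (a @ b)). 0 \<le> fst r"
    using a b by (auto simp: near_def cvx_def scale_comb_def)
  ultimately have "cvx (scale_comb (1 / 2) (a @ b))"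
    using a b by (simp add: near_def cvx_def)
  then have "D \<le> form T (scale_comb (1 / 2) (a @ b)) (scale_comb (1 / 2) (a @ b))" by (rule D_le)
  then have mid: "4 * D \<le> form T (a @ b) (a @ b)" by (simp add: form_scale)
  have "form T (diff_comb a b) (diff_comb a b) = 2 * form T a a + 2 * form T b b - form T (a @ b) (a @ b)"
    using T.form_commute[OF pts] by (simp add: form_simps)
  also have "\<dots> \<le> 4 * \<delta>" using a b mid by (simp add: near_def)
  finally have diff: "form T (diff_comb a b) (diff_comb a b) \<le> 4 * \<delta>" .
  \<comment> \<open>The appended combination has total weight 2 and the kernel is at most 1, which
    gives 4; together with \<open>4 * \<delta>\<close> for the difference this is the source of the
    constant in the statement.\<close>
  have "form T (a @ b) (a @ b) \<le> form (\<lambda>x y. 1) (a @ b) (a @ b)"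
    using a b T_le_1 by (intro form_mono) (auto simp: near_def cvx_def subset_iff)
  also have "\<dots> = 4" using a b by (simp add: form_const near_def cvx_def)
  finally have sum: "form T (a @ b) (a @ b) \<le> 4" .
  have "0 \<le> form T (diff_comb a b) (diff_comb a b)" "0 \<le> form T (a @ b) (a @ b)"
    using pts by (auto intro!: T.form_nonneg)
  then have "form T (diff_comb a b) (diff_comb a b) * form T (a @ b) (a @ b) \<le> (4 * \<delta>) * 4"
    using diff sum by (intro mult_mono) auto
  then have "sqrt (form T (diff_comb a b) (diff_comb a b) * form T (a @ b) (a @ b)) \<le> sqrt (16 * \<delta>)"
    by (intro real_sqrt_le_mono) simp
  then have "B * sqrt (form T (diff_comb a b) (diff_comb a b) * form T (a @ b) (a @ b)) \<le> B * (4 * sqrt \<delta>)"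
    using B by (intro mult_left_mono) (simp_all add: real_sqrt_mult)
  with form_cluster_kernel_diff[OF h pts] show ?thesis by simp
qed

text \<open>A combination \<open>a\<close> assigns to a lower cluster \<open>C\<close> the sum \<open>f(C)\<close> of the coefficients of its points in
  \<open>C\<close>, and \<open>form (K h) a a\<close> is the expectation of the sum of \<open>f(C)\<^sup>2 h(C)\<close> over all \<open>C\<close>. The limit \<open>Q h\<close> along a
  minimizing sequence exists and is invariant by \<open>near_close\<close>.\<close>

definition mini :: "nat \<Rightarrow> (real \<times> 'a) list" where
  "mini n = (SOME a. near (1 / (real n + 1)) a)"

definition Q :: "(('a set \<Rightarrow> bool) \<times> ('a set \<Rightarrow> bool) \<Rightarrow> 'a \<Rightarrow> real) \<Rightarrow> real" where
  "Q h = lim (\<lambda>n. form (K h) (mini n) (mini n))"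

lemma near_mini: "near (1 / (real n + 1)) (mini n)"
  unfolding mini_def by (rule someI_ex[OF ex_near]) simp

lemma near_mini': "m \<le> n \<Longrightarrow> near (1 / (real m + 1)) (mini n)"
  by (rule near_mono[OF near_mini]) (simp add: frac_le)

lemma points_mini: "points (mini n) \<subseteq> carrier G"
  using near_mini by (auto simp: near_def cvx_def)

lemma err_tendsto: "(\<lambda>n. b * sqrt (1 / (real n + 1))) \<longlonglongrightarrow> 0"
proof -
  have "(\<lambda>n. 1 / (real n + 1)) \<longlonglongrightarrow> 0"
    using LIMSEQ_inverse_real_of_nat by (simp add: inverse_eq_divide add.commute)
  from tendsto_mult_left[OF tendsto_real_sqrt[OF this], of b] show ?thesis by simp
qed

lemma Q_tendsto:
  assumes h: "cfun B h"
  shows "(\<lambda>n. form (K h) (mini n) (mini n)) \<longlonglongrightarrow> Q h"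
proof -
  have "Cauchy (\<lambda>n. form (K h) (mini n) (mini n))"
  proof (rule CauchyI)
    fix e :: real assume "e > 0"
    then have "\<forall>\<^sub>F N in sequentially. 4 * B * sqrt (1 / (real N + 1)) < e"
      using order_tendstoD(2)[OF err_tendsto] by simp
    then obtain N where N: "4 * B * sqrt (1 / (real N + 1)) < e"
      by (auto simp: eventually_sequentially)
    show "\<exists>N. \<forall>m\<ge>N. \<forall>n\<ge>N. norm (form (K h) (mini m) (mini m) - form (K h) (mini n) (mini n)) < e"
    proof (intro exI allI impI)
      fix m n assume "N \<le> m" "N \<le> n"
      from near_close[OF near_mini'[OF this(1)] near_mini'[OF this(2)] h] N
      show "norm (form (K h) (mini m) (mini m) - form (K h) (mini n) (mini n)) < e" by simp
    qed
  qed
  then show ?thesis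
    unfolding Q_def by (simp add: Cauchy_convergent convergent_LIMSEQ_iff[symmetric])
qed

text \<open>The rate depends on \<open>h\<close> only through its bound \<open>B\<close>. This
  uniformity allows limits of observables to be interchanged with the limit that defines
  \<open>Q\<close>.\<close>

lemma Q_near:
  assumes h: "cfun B h"
  shows "\<bar>form (K h) (mini n) (mini n) - Q h\<bar> \<le> 4 * B * sqrt (1 / (real n + 1))"
proof (rule LIMSEQ_le_const2)
  show "(\<lambda>m. \<bar>form (K h) (mini n) (mini n) - form (K h) (mini m) (mini m)\<bar>) \<longlonglongrightarrow> \<bar>form (K h) (mini n) (mini n) - Q h\<bar>"
    by (intro tendsto_intros Q_tendsto[OF h])
  show "\<exists>N. \<forall>m\<ge>N. \<bar>form (K h) (mini n) (mini n) - form (K h) (mini m) (mini m)\<bar> \<le> 4 * B * sqrt (1 / (real n + 1))"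
    using near_close[OF near_mini near_mini' h] by blast
qed

lemma Q_eqI:
  assumes "cfun B h" "(\<lambda>n. form (K h) (mini n) (mini n)) \<longlonglongrightarrow> l"
  shows "Q h = l"
  using Q_tendsto[OF assms(1)] assms(2) by (rule LIMSEQ_unique)

lemma Q_add:
  assumes h: "cfun B h" and k: "cfun C k"
  shows "Q (\<lambda>w x. h w x + k w x) = Q h + Q k"
proof (rule Q_eqI[OF cluster_fun_add[OF h k]])
  have "form (K (\<lambda>w x. h w x + k w x)) (mini n) (mini n) = form (K h) (mini n) (mini n) + form (K k) (mini n) (mini n)" for n
    unfolding form_add_kernel[symmetric] using points_mini
    by (intro form_cong cluster_kernel_add[OF h k]) auto
  then show "(\<lambda>n. form (K (\<lambda>w x. h w x + k w x)) (mini n) (mini n)) \<longlonglongrightarrow> Q h + Q k"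
    by (simp add: tendsto_add[OF Q_tendsto[OF h] Q_tendsto[OF k]])
qed

lemma Q_scale:
  assumes h: "cfun B h" and "0 \<le> t"
  shows "Q (\<lambda>w x. t * h w x) = t * Q h"
proof (rule Q_eqI[OF cluster_fun_scale[OF h]])
  have "form (K (\<lambda>w x. t * h w x)) (mini n) (mini n) = t * form (K h) (mini n) (mini n)" for n
    unfolding form_scale_kernel[symmetric] by (intro form_cong cluster_kernel_scale)
  then show "(\<lambda>n. form (K (\<lambda>w x. t * h w x)) (mini n) (mini n)) \<longlonglongrightarrow> t * Q h"
    by (simp add: tendsto_mult_left[OF Q_tendsto[OF h]])
qed fact

lemma Q_nonneg:
  assumes h: "cfun B h"
  shows "0 \<le> Q h"
  by (rule LIMSEQ_le_const[OF Q_tendsto[OF h]])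
    (use psd_kernel.form_nonneg[OF psd_cluster_kernel[OF h] points_mini] in blast)

lemma Q_mono:
  assumes h: "cfun B h" and k: "cfun C k" and le: "\<And>w x. x \<in> carrier G \<Longrightarrow> h w x \<le> k w x"
  shows "Q h \<le> Q k"
proof -
  have d: "cfun C (\<lambda>w x. k w x - h w x)" by (rule cluster_fun_diff[OF k h le])
  have "(\<lambda>w x. h w x + (k w x - h w x)) = k" by (intro ext) simp
  then have "Q k = Q h + Q (\<lambda>w x. k w x - h w x)" using Q_add[OF h d] by simp
  then show ?thesis using Q_nonneg[OF d] by simp
qed

lemma Q_one: "c \<le> Q (\<lambda>w x. 1)"
proof (rule LIMSEQ_le_const[OF Q_tendsto[OF cfun_one]])
  show "\<exists>N. \<forall>n\<ge>N. c \<le> form T (mini n) (mini n)"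
    using form_T_ge near_mini unfolding near_def by blast
qed

lemma Q_AE_zero:
  assumes h: "cfun B h" and z: "\<And>x. x \<in> carrier G \<Longrightarrow> AE w in M. h w x = 0"
  shows "Q h = 0"
proof (rule Q_eqI[OF h])
  have "K h x y = 0" if x: "x \<in> carrier G" for x y
  proof -
    have "K h x y = (\<integral>w. 0 \<partial>M)"
      unfolding cluster_kernel_def
      by (rule integral_cong_AE[OF cluster_kernel_measurable[OF h x] borel_measurable_const])
        (use z[OF x] in auto)
    then show ?thesis by simp
  qed
  then have "form (K h) (mini n) (mini n) = form (\<lambda>x y. 0) (mini n) (mini n)" for n
    using points_mini by (intro form_cong) auto
  then show "(\<lambda>n. form (K h) (mini n) (mini n)) \<longlonglongrightarrow> 0" by (simp add: form_const)
qed

lemma near_translate: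
  assumes g: "g \<in> carrier G" and a: "near \<delta> a"
  shows "near \<delta> (map (map_prod id ((\<otimes>) g)) a)"
proof -
  have T: "T (g \<otimes> x) (g \<otimes> y) = T x y" if "x \<in> carrier G" "y \<in> carrier G" for x y
    using cluster_kernel_shift[OF inv_closed[OF g] cfun_one that] g by simp
  have "form T (map (map_prod id ((\<otimes>) g)) a) (map (map_prod id ((\<otimes>) g)) a) = form T a a"
    unfolding form_map using a by (intro form_cong T) (auto simp: near_def cvx_def)
  moreover have "points (map (map_prod id ((\<otimes>) g)) a) = (\<otimes>) g ` points a"
    by (force simp: points_def)
  ultimately show ?thesis
    using a g by (auto simp: near_def cvx_def o_def)
qed

lemma Q_shift:
  assumes g: "g \<in> carrier G" and h: "cfun B h"
  shows "Q (\<lambda>w x. h (shift2 g w) (inv g \<otimes> x)) = Q h"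
proof (rule Q_eqI[OF cluster_fun_shift[OF g h]])
  let ?a = "\<lambda>n. map (map_prod id ((\<otimes>) (inv g))) (mini n)"
  have eq: "form (K (\<lambda>w x. h (shift2 g w) (inv g \<otimes> x))) (mini n) (mini n) = form (K h) (?a n) (?a n)" for n
    unfolding form_map using points_mini by (intro form_cong cluster_kernel_shift[OF g h]) auto
  have "(\<lambda>n. form (K h) (?a n) (?a n) - form (K h) (mini n) (mini n)) \<longlonglongrightarrow> 0"
  proof (rule Lim_null_comparison[OF _ err_tendsto])
    show "\<forall>\<^sub>F n in sequentially. norm (form (K h) (?a n) (?a n) - form (K h) (mini n) (mini n)) \<le> 4 * B * sqrt (1 / (real n + 1))"
      using near_close[OF near_translate[OF inv_closed[OF g] near_mini] near_mini h] by simp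
  qed
  from tendsto_add[OF this Q_tendsto[OF h]]
  show "(\<lambda>n. form (K (\<lambda>w x. h (shift2 g w) (inv g \<otimes> x))) (mini n) (mini n)) \<longlonglongrightarrow> Q h"
    by (simp add: eq)
qed

text \<open>At one late \<open>n\<close>, chosen by the uniform rate of \<open>Q_near\<close>, only
  finitely many kernel entries are involved, and ordinary dominated convergence applies to each of
  them. With this property \<open>Q\<close> behaves like an expectation over the picked
  cluster.\<close>

lemma Q_dominated:
  assumes h: "\<And>j. cfun B (h j)" and k: "cfun B k"
    and lim: "\<And>w x. x \<in> carrier G \<Longrightarrow> (\<lambda>j. h j w x) \<longlonglongrightarrow> k w x"
  shows "(\<lambda>j. Q (h j)) \<longlonglongrightarrow> Q k"
proof (rule LIMSEQ_I)
  fix e :: real assume e: "e > 0"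
  then have "\<forall>\<^sub>F N in sequentially. 4 * B * sqrt (1 / (real N + 1)) < e / 3"
    by (intro order_tendstoD(2)[OF err_tendsto]) simp
  then obtain n where n: "4 * B * sqrt (1 / (real n + 1)) < e / 3"
    by (auto simp: eventually_sequentially)
  have "(\<lambda>j. K (h j) x y) \<longlonglongrightarrow> K k x y" if x: "x \<in> carrier G" for x y
    unfolding cluster_kernel_def
  proof (rule integral_dominated_convergence[where w="\<lambda>_. B"])
    show "AE w in M. (\<lambda>j. of_bool (conn (fst w) x y) * h j w x) \<longlonglongrightarrow> of_bool (conn (fst w) x y) * k w x"
      by (intro AE_I2 tendsto_mult_left lim x)
    have "\<bar>of_bool (conn (fst w) x y) * h j w x\<bar> \<le> B" for j w
      using cluster_funD(2,3)[OF h x, of j w] by simp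
    then show "AE w in M. norm (of_bool (conn (fst w) x y) * h j w x) \<le> B" for j by simp
  qed (rule cluster_kernel_measurable[OF h x] cluster_kernel_measurable[OF k x] | simp)+
  then have "(\<lambda>j. form (K (h j)) (mini n) (mini n)) \<longlonglongrightarrow> form (K k) (mini n) (mini n)"
    using points_mini by (intro form_tendsto) auto
  then obtain N where N: "\<And>j. N \<le> j \<Longrightarrow> \<bar>form (K (h j)) (mini n) (mini n) - form (K k) (mini n) (mini n)\<bar> < e / 3"
    using LIMSEQ_D[of _ "form (K k) (mini n) (mini n)" "e / 3"] e by (auto simp del: divide_const_simps)
  show "\<exists>N. \<forall>j\<ge>N. norm (Q (h j) - Q k) < e"
  proof (intro exI allI impI)
    fix j assume "N \<le> j"
    with N[of j] Q_near[OF h[of j], of n] Q_near[OF k, of n] n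
    show "norm (Q (h j) - Q k) < e" unfolding real_norm_def by linarith
  qed
qed

subsection \<open>Null properties of clusters\<close>

definition cprop :: "(('a set \<Rightarrow> bool) \<times> ('a set \<Rightarrow> bool) \<Rightarrow> 'a \<Rightarrow> bool) \<Rightarrow> bool" where
  "cprop H \<longleftrightarrow> (\<forall>x\<in>carrier G. Measurable.pred M (\<lambda>w. H w x)) \<and>
     (\<forall>w. \<forall>x\<in>carrier G. \<forall>y\<in>carrier G. conn (fst w) x y \<longrightarrow> H w x = H w y)"

abbreviation QP :: "(('a set \<Rightarrow> bool) \<times> ('a set \<Rightarrow> bool) \<Rightarrow> 'a \<Rightarrow> bool) \<Rightarrow> real" where
  "QP H \<equiv> Q (\<lambda>w x. of_bool (H w x))"

text \<open>The picked cluster almost surely lacks the property.\<close>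

definition null :: "(('a set \<Rightarrow> bool) \<times> ('a set \<Rightarrow> bool) \<Rightarrow> 'a \<Rightarrow> bool) \<Rightarrow> bool" where
  "null H \<longleftrightarrow> cprop H \<and> QP H = 0"

lemma cpropD:
  fixes H :: "('a set \<Rightarrow> bool) \<times> ('a set \<Rightarrow> bool) \<Rightarrow> 'a \<Rightarrow> bool"
  assumes "cprop H" "x \<in> carrier G"
  shows "Measurable.pred M (\<lambda>w. H w x)" "y \<in> carrier G \<Longrightarrow> conn (fst w) x y \<Longrightarrow> H w x = H w y"
  using assms unfolding cprop_def by blast+

lemma cpropI:
  fixes H :: "('a set \<Rightarrow> bool) \<times> ('a set \<Rightarrow> bool) \<Rightarrow> 'a \<Rightarrow> bool"
  assumes "\<And>x. x \<in> carrier G \<Longrightarrow> Measurable.pred M (\<lambda>w. H w x)"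
    and "\<And>w x y. x \<in> carrier G \<Longrightarrow> y \<in> carrier G \<Longrightarrow> conn (fst w) x y \<Longrightarrow> H w x \<Longrightarrow> H w y"
  shows "cprop H"
  unfolding cprop_def
proof (intro conjI ballI allI impI)
  fix w :: "('a set \<Rightarrow> bool) \<times> ('a set \<Rightarrow> bool)" and x y
  assume xy: "x \<in> carrier G" "y \<in> carrier G" "conn (fst w) x y"
  show "H w x = H w y"
    using assms(2)[OF xy] assms(2)[OF xy(2,1) conn_sym[OF xy(3)]] by blast
qed (rule assms(1))

lemma cfun_cprop: "cprop H \<Longrightarrow> cfun 1 (\<lambda>w x. of_bool (H w x))"
  by (intro cluster_funI borel_of_bool arg_cong[of _ _ of_bool]) (rule cpropD; assumption | simp)+

lemma null_mono:
  assumes H: "null H" and I: "cprop I" and le: "\<And>w x. x \<in> carrier G \<Longrightarrow> I w x \<Longrightarrow> H w x"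
  shows "null I"
proof -
  have "QP I \<le> QP H"
    using H by (intro Q_mono[OF cfun_cprop[OF I] cfun_cprop]) (auto simp: null_def le)
  then show ?thesis using H I Q_nonneg[OF cfun_cprop[OF I]] by (auto simp: null_def)
qed

lemma cprop_disj: "cprop H \<Longrightarrow> cprop I \<Longrightarrow> cprop (\<lambda>w x. H w x \<or> I w x)"
  by (intro cpropI pred_intros_logic(5)) (auto dest: cpropD)

lemma cprop_ex: "(\<And>i. cprop (H i)) \<Longrightarrow> cprop (\<lambda>w x. \<exists>i::nat. H i w x)"
  by (intro cpropI pred_intros_countable(2)) (auto dest: cpropD)

lemma null_disj:
  assumes H: "null H" and I: "null I"
  shows "null (\<lambda>w x. H w x \<or> I w x)"
proof -
  have cp: "cprop (\<lambda>w x. H w x \<or> I w x)" using H I by (intro cprop_disj) (auto simp: null_def)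
  have h: "cfun 1 (\<lambda>w x. of_bool (H w x))" "cfun 1 (\<lambda>w x. of_bool (I w x))"
    using H I by (auto simp: null_def cfun_cprop)
  have "QP (\<lambda>w x. H w x \<or> I w x) \<le> Q (\<lambda>w x. of_bool (H w x) + of_bool (I w x))"
    by (rule Q_mono[OF cfun_cprop[OF cp] cluster_fun_add[OF h]]) auto
  also have "\<dots> = 0" using Q_add[OF h] H I by (simp add: null_def)
  finally show ?thesis using cp Q_nonneg[OF cfun_cprop[OF cp]] by (simp add: null_def)
qed

text \<open>Countable subadditivity, obtained from finite unions by
  \<open>Q_dominated\<close>.\<close>

lemma null_ex:
  assumes H: "\<And>i. null (H i)"
  shows "null (\<lambda>w x. \<exists>i::nat. H i w x)"
proof -
  have fin: "null (\<lambda>w x. \<exists>i\<le>n. H i w x)" for n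
  proof (induction n)
    case (Suc n)
    have "(\<lambda>w x. \<exists>i\<le>Suc n. H i w x) = (\<lambda>w x. (\<exists>i\<le>n. H i w x) \<or> H (Suc n) w x)"
      by (auto simp: le_Suc_eq fun_eq_iff)
    then show ?case using null_disj[OF Suc H] by simp
  qed (use H in simp)
  have cp: "cprop (\<lambda>w x. \<exists>i. H i w x)" using H by (intro cprop_ex) (simp add: null_def)
  have "(\<lambda>n. QP (\<lambda>w x. \<exists>i\<le>n. H i w x)) \<longlonglongrightarrow> QP (\<lambda>w x. \<exists>i. H i w x)"
  proof (rule Q_dominated[of 1])
    fix w x
    show "(\<lambda>n. of_bool (\<exists>i\<le>n. H i w x)) \<longlonglongrightarrow> (of_bool (\<exists>i. H i w x) :: real)"
    proof (cases "\<exists>i. H i w x")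
      case True
      then obtain i where i: "H i w x" by blast
      have "\<forall>\<^sub>F n in sequentially. of_bool (\<exists>i\<le>n. H i w x) = (of_bool (\<exists>i. H i w x) :: real)"
        using eventually_ge_at_top[of i] by (rule eventually_mono) (use i in auto)
      then show ?thesis by (rule tendsto_eventually)
    qed simp
  qed (use fin cp in \<open>auto simp: null_def intro: cfun_cprop\<close>)
  moreover have "(\<lambda>n. QP (\<lambda>w x. \<exists>i\<le>n. H i w x)) = (\<lambda>n. 0)"
    using fin by (auto simp: null_def)
  ultimately show ?thesis using cp by (simp add: null_def LIMSEQ_const_iff)
qed

lemma null_ex_carrier:
  assumes H: "\<And>u. u \<in> carrier G \<Longrightarrow> null (H u)"
  shows "null (\<lambda>w x. \<exists>u\<in>carrier G. H u w x)"
proof -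
  have "(\<lambda>w x. \<exists>u\<in>carrier G. H u w x) = (\<lambda>w x. \<exists>i. H (en i) w x)"
    unfolding range_en[symmetric] by auto
  then show ?thesis using null_ex[of "\<lambda>i. H (en i)"] H by simp
qed

end

section \<open>Long-range order implies uniqueness after sprinkling\<close>

context cayley
begin

lemma nbhd_pow_Suc:
  "u \<in> (nbhd ^^ Suc r) A \<longleftrightarrow> u \<in> (nbhd ^^ r) A \<or> (\<exists>v\<in>(nbhd ^^ r) A. {v, u} \<in> E)"
  by (simp add: nbhd_def[of "(nbhd ^^ r) A"])

lemma nbhd_pow_transl1:
  assumes g: "g \<in> carrier G" and "u \<in> (nbhd ^^ r) {z}"
  shows "g \<otimes> u \<in> (nbhd ^^ r) {g \<otimes> z}"
  using assms(2)
proof (induction r arbitrary: u)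
  case (Suc r)
  then show ?case
    using Suc.IH edge_transl[OF g] unfolding nbhd_pow_Suc by blast
qed simp

lemma nbhd_pow_transl:
  assumes g: "g \<in> carrier G" and u: "u \<in> carrier G" and z: "z \<in> carrier G"
  shows "g \<otimes> u \<in> (nbhd ^^ r) {g \<otimes> z} \<longleftrightarrow> u \<in> (nbhd ^^ r) {z}"
proof
  assume "g \<otimes> u \<in> (nbhd ^^ r) {g \<otimes> z}"
  from nbhd_pow_transl1[OF inv_closed[OF g] this] show "u \<in> (nbhd ^^ r) {z}"
    using g u z by (simp add: m_assoc[symmetric])
qed (rule nbhd_pow_transl1[OF g])

text \<open>The group has only countably many finite subsets, and the event says that each of them
  that satisfies \<open>Q\<close> throughout has at most \<open>m\<close> elements. Finiteness of
  the whole set is implied by this.\<close>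

lemma pred_card_le:
  assumes Q: "\<And>f. f \<in> carrier G \<Longrightarrow> Measurable.pred K (\<lambda>w. Q w f)"
  shows "Measurable.pred K (\<lambda>w. finite {f \<in> carrier G. Q w f} \<and> card {f \<in> carrier G. Q w f} \<le> m)"
proof -
  have eq: "finite {f \<in> carrier G. Q w f} \<and> card {f \<in> carrier G. Q w f} \<le> m \<longleftrightarrow>
      (\<forall>F\<in>{F. finite F \<and> F \<subseteq> carrier G}. (\<forall>f\<in>F. Q w f) \<longrightarrow> card F \<le> m)" for w
  proof
    assume *: "\<forall>F\<in>{F. finite F \<and> F \<subseteq> carrier G}. (\<forall>f\<in>F. Q w f) \<longrightarrow> card F \<le> m"
    have fin: "finite {f \<in> carrier G. Q w f}"
    proof (rule ccontr)
      assume "infinite {f \<in> carrier G. Q w f}"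
      from infinite_arbitrarily_large[OF this, of "Suc m"]
      obtain F where F: "finite F" "card F = Suc m" "F \<subseteq> {f \<in> carrier G. Q w f}" by blast
      have "card F \<le> m" using * F(1,3) by blast
      then show False unfolding F(2) by linarith
    qed
    moreover have "card {f \<in> carrier G. Q w f} \<le> m"
      using bspec[OF *, of "{f \<in> carrier G. Q w f}"] fin by simp
    ultimately show "finite {f \<in> carrier G. Q w f} \<and> card {f \<in> carrier G. Q w f} \<le> m" ..
  next
    assume *: "finite {f \<in> carrier G. Q w f} \<and> card {f \<in> carrier G. Q w f} \<le> m"
    show "\<forall>F\<in>{F. finite F \<and> F \<subseteq> carrier G}. (\<forall>f\<in>F. Q w f) \<longrightarrow> card F \<le> m"
    proof (intro ballI impI)
      fix F assume "F \<in> {F. finite F \<and> F \<subseteq> carrier G}" "\<forall>f\<in>F. Q w f"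
      then have F: "F \<subseteq> {f \<in> carrier G. Q w f}" by blast
      show "card F \<le> m"
        by (rule order_trans[OF card_mono[OF conjunct1[OF *] F] conjunct2[OF *]])
    qed
  qed
  have all: "Measurable.pred K (\<lambda>w. \<forall>f\<in>F. Q w f)" if "F \<in> {F. finite F \<and> F \<subseteq> carrier G}" for F
    using that Q by (intro pred_Ball_countable) (auto intro: countable_finite)
  have "Measurable.pred K (\<lambda>w. (\<forall>f\<in>F. Q w f) \<longrightarrow> card F \<le> m)" if "F \<in> {F. finite F \<and> F \<subseteq> carrier G}" for F
    by (rule pred_intros_logic(4)[OF all[OF that] measurable_const]) simp
  then have "Measurable.pred K (\<lambda>w. \<forall>F\<in>{F. finite F \<and> F \<subseteq> carrier G}. (\<forall>f\<in>F. Q w f) \<longrightarrow> card F \<le> m)"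
    by (intro pred_Ball_countable countable_Collect_finite_subset countable_carrier)
  then show ?thesis by (simp only: eq)
qed

lemma pred_infinite:
  assumes "\<And>f. f \<in> carrier G \<Longrightarrow> Measurable.pred K (\<lambda>w. Q w f)"
  shows "Measurable.pred K (\<lambda>w. infinite {f \<in> carrier G. Q w f})"
  unfolding infinite_iff_en
proof (intro pred_intros_countable)
  show "Measurable.pred K (\<lambda>w. m \<le> n \<and> Q w (en n))" for m n :: nat
    using assms by (intro pred_intros_conj1') simp
qed

text \<open>A cluster that misses \<open>Y\<close> uses no edge that touches \<open>Y\<close>, so it
  survives the deletion of all these edges.\<close>

lemma conn_avoid:
  assumes av: "\<And>y. y \<in> Y \<Longrightarrow> \<not> conn \<xi> v y" and "conn \<xi> v z"
  shows "conn (\<lambda>e. e \<inter> Y = {} \<and> \<xi> e) v z"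
  using assms(2) unfolding conn_def
proof (induction rule: rtrancl_induct)
  case (step y z)
  have "conn \<xi> v y" using step.hyps(1) by (simp add: conn_def)
  moreover have yz: "{y, z} \<in> E" "\<xi> {y, z}" using step.hyps(2) by (auto simp: adj_def)
  ultimately have "conn \<xi> v y" "conn \<xi> v z" using conn_edge[of y z \<xi>] conn_trans by blast+
  then have "y \<notin> Y" "z \<notin> Y" using av by blast+
  then have "(y, z) \<in> adj {e \<in> E. e \<inter> Y = {} \<and> \<xi> e}" using yz by (simp add: adj_def)
  with step.IH show ?case by (rule rtrancl_into_rtrancl)
qed simp

lemma pred_percolation: "e \<in> E \<Longrightarrow> Measurable.pred (percolation E p) (\<lambda>\<omega>. \<omega> e)"
  unfolding percolation_bits by (rule pred_bits)

text \<open>The edges that touch \<open>Y\<close> are independent of the cluster of \<open>v\<close> in the graph without these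
  edges. If this cluster has infinitely many neighbours of \<open>Y\<close>, one of the connecting edges is open.\<close>

lemma AE_sprinkle:
  assumes q: "0 < q" "q \<le> 1"
  shows "AE \<eta> in percolation E q.
    \<not> ((\<forall>y\<in>Y \<inter> carrier G. \<not> conn (\<lambda>e. \<omega> e \<or> \<eta> e) v y) \<and>
       infinite {z \<in> carrier G. conn (\<lambda>e. \<omega> e \<or> \<eta> e) v z \<and> (\<exists>y\<in>Y. {z, y} \<in> E)})"
proof -
  define bad where "bad \<xi> \<longleftrightarrow> (\<forall>y\<in>Y \<inter> carrier G. \<not> conn (\<lambda>e. \<omega> e \<or> \<xi> e) v y) \<and>
       infinite {z \<in> carrier G. conn (\<lambda>e. \<omega> e \<or> \<xi> e) v z \<and> (\<exists>y\<in>Y. {z, y} \<in> E)}" for \<xi>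
  define Y' where "Y' = Y \<inter> carrier G"
  let ?P = "percolation E q"
  \<comment> \<open>Edges that touch \<open>Y'\<close> are taken from a second independent copy, all
    others from the first one; the merged configuration has the same law. For a fixed first copy the
    cluster of \<open>v\<close> away from \<open>Y'\<close> is deterministic.\<close>
  let ?f = "\<lambda>e a b. if e \<inter> Y' = {} then a else (b::bool)"
  let ?zip = "\<lambda>(\<eta>, \<theta>). \<lambda>e\<in>E. ?f e (\<eta> e) (\<theta> e)"
  interpret prob_space ?P by (rule prob_space_percolation)
  interpret PP: pair_sigma_finite ?P ?P ..
  have Yc: "countable (Y \<inter> carrier G)"
    using countable_carrier by (rule countable_subset[rotated]) simp
  have pred_bad: "Measurable.pred K (\<lambda>w. bad (F w))"
    if F: "\<And>e. e \<in> E \<Longrightarrow> Measurable.pred K (\<lambda>w. F w e)" for K and F :: "'z \<Rightarrow> 'a set \<Rightarrow> bool"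
  proof -
    have "Measurable.pred K (\<lambda>w. \<omega> e \<or> F w e)" if "e \<in> E" for e
      by (rule pred_intros_logic(5)[OF measurable_const F[OF that]]) simp
    note c = pred_conn[OF this]
    show ?thesis
      unfolding bad_def
    proof (rule pred_intros_logic(3))
      show "Measurable.pred K (\<lambda>w. \<forall>y\<in>Y \<inter> carrier G. \<not> conn (\<lambda>e. \<omega> e \<or> F w e) v y)"
        by (intro pred_Ball_countable Yc pred_intros_logic(2) c)
      show "Measurable.pred K (\<lambda>w. infinite {z \<in> carrier G. conn (\<lambda>e. \<omega> e \<or> F w e) v z \<and> (\<exists>y\<in>Y. {z, y} \<in> E)})"
        by (intro pred_infinite pred_intros_conj2' c)
    qed
  qed
  have L: "bernoulli_pmf q = map_pmf (\<lambda>(a, b). ?f e a b) (pair_pmf (bernoulli_pmf q) (bernoulli_pmf q))" for e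
    using map_fst_pair_pmf[of "bernoulli_pmf q" "bernoulli_pmf q"] map_snd_pair_pmf[of "bernoulli_pmf q" "bernoulli_pmf q"]
    by (cases "e \<inter> Y' = {}") (simp_all add: case_prod_unfold)
  have zip: "distr (?P \<Otimes>\<^sub>M ?P) ?P ?zip = ?P"
    unfolding percolation_bits by (rule bits_zip[OF L])
  have zip_meas: "?zip \<in> measurable (?P \<Otimes>\<^sub>M ?P) ?P"
    unfolding percolation_bits by (rule measurable_zip)
  have inner: "AE \<theta> in ?P. \<not> bad (?zip (\<eta>, \<theta>))" for \<eta>
  proof -
    define \<xi> where "\<xi> e \<longleftrightarrow> e \<inter> Y' = {} \<and> (\<omega> e \<or> \<eta> e)" for e
    \<comment> \<open>This set depends on the first copy only, and on the bad event it contains all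
      the cluster points adjacent to \<open>Y\<close>. If it is finite, there is no bad
      event.\<close>
    define Z where "Z = {z \<in> carrier G. z \<notin> Y \<and> conn \<xi> v z \<and> (\<exists>y\<in>Y. {z, y} \<in> E)}"
    have zip_conn: "conn \<xi> v z" if av: "\<And>y. y \<in> Y' \<Longrightarrow> \<not> conn (\<lambda>e. \<omega> e \<or> ?zip (\<eta>, \<theta>) e) v y"
      and z: "conn (\<lambda>e. \<omega> e \<or> ?zip (\<eta>, \<theta>) e) v z" for \<theta> z
      using conn_avoid[OF av z] by (rule conn_mono) (auto simp: \<xi>_def)
    have conn_zip: "conn (\<lambda>e. \<omega> e \<or> ?zip (\<eta>, \<theta>) e) v z" if z: "conn \<xi> v z" for \<theta> z
      using z by (rule conn_mono) (auto simp: \<xi>_def)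
    have bad_Z: "infinite Z" if "bad (?zip (\<eta>, \<theta>))" for \<theta>
    proof -
      have av: "\<not> conn (\<lambda>e. \<omega> e \<or> ?zip (\<eta>, \<theta>) e) v y" if "y \<in> Y'" for y
        using \<open>bad _\<close> that by (auto simp: bad_def Y'_def)
      have "{z \<in> carrier G. conn (\<lambda>e. \<omega> e \<or> ?zip (\<eta>, \<theta>) e) v z \<and> (\<exists>y\<in>Y. {z, y} \<in> E)} \<subseteq> Z"
      proof
        fix z assume "z \<in> {z \<in> carrier G. conn (\<lambda>e. \<omega> e \<or> ?zip (\<eta>, \<theta>) e) v z \<and> (\<exists>y\<in>Y. {z, y} \<in> E)}"
        then have z: "z \<in> carrier G" "conn (\<lambda>e. \<omega> e \<or> ?zip (\<eta>, \<theta>) e) v z" "\<exists>y\<in>Y. {z, y} \<in> E"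
          by blast+
        have "z \<notin> Y" using av[of z] z(1,2) unfolding Y'_def by blast
        then show "z \<in> Z" using z zip_conn[OF av z(2)] unfolding Z_def by blast
      qed
      moreover have "infinite {z \<in> carrier G. conn (\<lambda>e. \<omega> e \<or> ?zip (\<eta>, \<theta>) e) v z \<and> (\<exists>y\<in>Y. {z, y} \<in> E)}"
        using \<open>bad _\<close> unfolding bad_def by blast
      ultimately show ?thesis using finite_subset by blast
    qed
    show ?thesis
    proof (cases "finite Z")
      case True
      then have "\<not> bad (?zip (\<eta>, \<theta>))" for \<theta> using bad_Z by blast
      then show ?thesis by (rule AE_I2)
    next
      case False
      have "\<forall>z\<in>Z. \<exists>y\<in>Y. {z, y} \<in> E" by (auto simp: Z_def)
      then obtain n where n: "\<And>z. z \<in> Z \<Longrightarrow> n z \<in> Y \<and> {z, n z} \<in> E" by metis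
      define J where "J = (\<lambda>z. {z, n z}) ` Z"
      \<comment> \<open>The end \<open>z\<close> lies outside \<open>Y\<close> and the end
        \<open>n z\<close> inside, so an edge determines \<open>z\<close>. Hence infinitely many
        different fresh edges are available, and a single open one connects \<open>v\<close> to
        \<open>Y'\<close>.\<close>
      have "inj_on (\<lambda>z. {z, n z}) Z"
        using n by (auto simp: inj_on_def doubleton_eq_iff Z_def)
      then have J: "infinite J" "J \<subseteq> E" using False n by (auto simp: J_def finite_image_iff)
      have null: "emeasure ?P {\<theta> \<in> space ?P. \<forall>e\<in>J. \<not> \<theta> e} = 0"
        unfolding percolation_bits
      proof (rule emeasure_all_closed_eq_0[OF J countable_E])
        show "emeasure (bernoulli_pmf q) {False} \<le> ennreal (1 - q)"
          using q by (simp add: emeasure_pmf_single)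
      qed (use q in auto)
      have sets: "{\<theta> \<in> space ?P. \<forall>e\<in>J. \<not> \<theta> e} \<in> sets ?P"
      proof -
        have "Measurable.pred ?P (\<lambda>\<theta>. \<forall>e\<in>J. \<not> \<theta> e)"
          using J countable_subset[OF J(2) countable_E]
          by (intro pred_Ball_countable pred_intros_logic(2) pred_percolation) auto
        then show ?thesis by (simp only: pred_def)
      qed
      have good: "\<not> bad (?zip (\<eta>, \<theta>))" if e: "e \<in> J" "\<theta> e" for e \<theta>
      proof
        assume bad: "bad (?zip (\<eta>, \<theta>))"
        obtain z where z: "z \<in> Z" "e = {z, n z}" using e(1) by (auto simp: J_def)
        have nz: "n z \<in> Y'" using n[OF z(1)] edge_closed(2) by (auto simp: Y'_def)
        have "?zip (\<eta>, \<theta>) e" using e J(2) nz z(2) by auto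
        then have "conn (\<lambda>e. \<omega> e \<or> ?zip (\<eta>, \<theta>) e) z (n z)"
          using n[OF z(1)] z(2) by (intro conn_edge) auto
        moreover have "conn (\<lambda>e. \<omega> e \<or> ?zip (\<eta>, \<theta>) e) v z"
          using z(1) by (intro conn_zip) (simp add: Z_def)
        ultimately have "conn (\<lambda>e. \<omega> e \<or> ?zip (\<eta>, \<theta>) e) v (n z)" by (meson conn_trans)
        then show False using bad nz unfolding bad_def Y'_def by blast
      qed
      show ?thesis
        by (rule AE_I[OF _ null sets]) (use good in blast)
    qed
  qed
  have A: "AE w in ?P \<Otimes>\<^sub>M ?P. \<not> bad (?zip w)"
  proof (rule PP.AE_pair_measure)
    have "Measurable.pred ?P (\<lambda>\<xi>. \<not> bad \<xi>)"
      by (intro pred_intros_logic(2) pred_bad pred_percolation)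
    from measurable_compose[OF zip_meas this]
    show "{w \<in> space (?P \<Otimes>\<^sub>M ?P). \<not> bad (?zip w)} \<in> sets (?P \<Otimes>\<^sub>M ?P)"
      by (simp only: pred_def)
    show "AE \<eta> in ?P. AE \<theta> in ?P. \<not> bad (?zip (\<eta>, \<theta>))" using inner by simp
  qed
  have S: "{\<xi> \<in> space ?P. \<not> bad \<xi>} \<in> sets ?P"
  proof -
    have "Measurable.pred ?P (\<lambda>\<xi>. \<not> bad \<xi>)"
      by (intro pred_intros_logic(2) pred_bad pred_percolation)
    then show ?thesis by (simp only: pred_def)
  qed
  have "AE \<xi> in distr (?P \<Otimes>\<^sub>M ?P) ?P ?zip. \<not> bad \<xi>"
    by (rule AE_distr_iff[OF zip_meas S, THEN iffD2, OF A])
  then show ?thesis unfolding zip bad_def .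
qed

section \<open>Distances between a lower and an upper cluster\<close>

definition several_cl :: "('a set \<Rightarrow> bool) \<Rightarrow> bool" where
  "several_cl \<omega> \<longleftrightarrow> (\<exists>u\<in>carrier G. \<exists>v\<in>carrier G. inf_cl \<omega> u \<and> inf_cl \<omega> v \<and> \<not> conn \<omega> u v)"

definition hi :: "('a set \<Rightarrow> bool) \<times> ('a set \<Rightarrow> bool) \<Rightarrow> 'a set \<Rightarrow> bool" where
  "hi w e \<longleftrightarrow> fst w e \<or> snd w e"

lemma pred_hi: "e \<in> E \<Longrightarrow> Measurable.pred (two_level p q) (\<lambda>w. hi w e)"
  unfolding hi_def by (intro pred_intros_logic(5) pred_fst pred_snd)

lemma conn_fst_hi: "conn (fst w) x y \<Longrightarrow> conn (hi w) x y"
  by (erule conn_mono) (simp add: hi_def)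

lemma hi_shift2: "e \<in> E \<Longrightarrow> hi (shift2 g w) e = shift g (hi w) e"
  by (simp add: hi_def shift2_def shift_def)

lemma conn_hi_shift2:
  assumes "g \<in> carrier G" "x \<in> carrier G" "y \<in> carrier G"
  shows "conn (hi (shift2 g w)) x y \<longleftrightarrow> conn (hi w) (g \<otimes> x) (g \<otimes> y)"
  using conn_cong[of "hi (shift2 g w)" "shift g (hi w)"] hi_shift2 conn_shift[OF assms] by simp

lemma inf_cl_hi_shift2:
  assumes "g \<in> carrier G" "x \<in> carrier G"
  shows "inf_cl (hi (shift2 g w)) x \<longleftrightarrow> inf_cl (hi w) (g \<otimes> x)"
  using inf_cl_cong[of "hi (shift2 g w)" "shift g (hi w)"] hi_shift2 inf_cl_shift[OF assms] by simp

definition close_to :: "nat \<Rightarrow> ('a set \<Rightarrow> bool) \<times> ('a set \<Rightarrow> bool) \<Rightarrow> 'a \<Rightarrow> 'a \<Rightarrow> bool" where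
  "close_to r w x u \<longleftrightarrow> (\<exists>z\<in>carrier G. conn (fst w) x z \<and> u \<in> (nbhd ^^ r) {z})"

text \<open>Here \<open>x\<close> stands for the picked cluster and \<open>v\<close> for an infinite
  upper cluster that is to be shown to meet it.\<close>

definition close_pts :: "nat \<Rightarrow> ('a set \<Rightarrow> bool) \<times> ('a set \<Rightarrow> bool) \<Rightarrow> 'a \<Rightarrow> 'a \<Rightarrow> 'a set" where
  "close_pts r w x v = {f \<in> carrier G. conn (hi w) v f \<and> close_to r w x f}"

lemma close_to_cong: "conn (fst w) x y \<Longrightarrow> close_to r w x u \<longleftrightarrow> close_to r w y u"
  unfolding close_to_def by (meson conn_trans conn_sym)

lemma close_to_shift2:
  assumes g: "g \<in> carrier G" and x: "x \<in> carrier G" and u: "u \<in> carrier G"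
  shows "close_to r (shift2 g w) x u \<longleftrightarrow> close_to r w (g \<otimes> x) (g \<otimes> u)"
proof
  assume "close_to r (shift2 g w) x u"
  then obtain z where z: "z \<in> carrier G" "conn (shift g (fst w)) x z" "u \<in> (nbhd ^^ r) {z}"
    by (auto simp: close_to_def shift2_def)
  then show "close_to r w (g \<otimes> x) (g \<otimes> u)"
    unfolding close_to_def using conn_shift[OF g x z(1)] nbhd_pow_transl[OF g u z(1)] g
    by (intro bexI[of _ "g \<otimes> z"]) auto
next
  assume "close_to r w (g \<otimes> x) (g \<otimes> u)"
  then obtain z where z: "z \<in> carrier G" "conn (fst w) (g \<otimes> x) z" "g \<otimes> u \<in> (nbhd ^^ r) {z}"
    by (auto simp: close_to_def)
  define z' where "z' = inv g \<otimes> z"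
  have z': "z' \<in> carrier G" "z = g \<otimes> z'" using g z(1) by (simp_all add: z'_def m_assoc[symmetric])
  show "close_to r (shift2 g w) x u"
    unfolding close_to_def using z conn_shift[OF g x z'(1)] nbhd_pow_transl[OF g u z'(1)] z'
    by (intro bexI[of _ z']) (auto simp: shift2_def)
qed

lemma close_pts_shift2:
  assumes g: "g \<in> carrier G" and x: "x \<in> carrier G" and v: "v \<in> carrier G"
  shows "close_pts r w (g \<otimes> x) (g \<otimes> v) = (\<otimes>) g ` close_pts r (shift2 g w) x v"
proof (intro equalityI subsetI)
  fix f assume f: "f \<in> close_pts r w (g \<otimes> x) (g \<otimes> v)"
  define f' where "f' = inv g \<otimes> f"
  have f': "f' \<in> carrier G" "f = g \<otimes> f'" using g f by (simp_all add: f'_def m_assoc[symmetric] close_pts_def)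
  then have "f' \<in> close_pts r (shift2 g w) x v"
    using f conn_hi_shift2[OF g v f'(1)] close_to_shift2[OF g x f'(1)] by (simp add: close_pts_def)
  then show "f \<in> (\<otimes>) g ` close_pts r (shift2 g w) x v" using f'(2) by blast
next
  fix f assume "f \<in> (\<otimes>) g ` close_pts r (shift2 g w) x v"
  then obtain f' where f': "f = g \<otimes> f'" "f' \<in> close_pts r (shift2 g w) x v" by blast
  then have "f' \<in> carrier G" by (simp add: close_pts_def)
  then show "f \<in> close_pts r w (g \<otimes> x) (g \<otimes> v)"
    using f' conn_hi_shift2[OF g v] close_to_shift2[OF g x] g by (simp add: close_pts_def)
qed

lemma close_pts_conn: "conn (hi w) v v' \<Longrightarrow> close_pts r w x v = close_pts r w x v'"
  unfolding close_pts_def by (intro Collect_cong conj_cong refl) (meson conn_trans conn_sym)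

lemma close_pts_cong: "conn (fst w) x y \<Longrightarrow> close_pts r w x v = close_pts r w y v"
  unfolding close_pts_def using close_to_cong by (intro Collect_cong conj_cong refl)

lemma pred_close_to: "Measurable.pred (two_level p q) (\<lambda>w. close_to r w x u)"
  unfolding close_to_def
  by (intro pred_Bex_countable countable_carrier pred_intros_conj2' pred_conn pred_fst)

lemma pred_conn_hi: "Measurable.pred (two_level p q) (\<lambda>w. conn (hi w) x y)"
  by (intro pred_conn pred_hi)

lemma pred_inf_cl_hi: "Measurable.pred (two_level p q) (\<lambda>w. inf_cl (hi w) x)"
  by (intro pred_inf_cl pred_hi)

end

section \<open>Every infinite upper cluster meets the picked cluster\<close>

locale sprinkled = long_range +
  assumes q_pos: "0 < q" and q_le_1: "q \<le> 1"
begin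

text \<open>The event that \<open>v\<close> sends mass to \<open>u\<close> in the mass transport,
  with \<open>x\<close> naming the picked cluster. The bound \<open>m\<close> limits the total mass
  that \<open>v\<close> sends out.\<close>

definition few where
  "few m r v u w x \<longleftrightarrow> inf_cl (hi w) v \<and> conn (hi w) v u \<and> close_to r w x u \<and>
     finite (close_pts r w x v) \<and> card (close_pts r w x v) \<le> m"

lemma cprop_few: "cprop (few m r v u)"
proof (rule cpropI)
  fix x
  have "Measurable.pred M (\<lambda>w. finite (close_pts r w x v) \<and> card (close_pts r w x v) \<le> m)"
    unfolding close_pts_def by (intro pred_card_le pred_intros_logic(3) pred_conn_hi pred_close_to)
  from pred_intros_logic(3)[OF pred_inf_cl_hi pred_intros_logic(3)[OF pred_conn_hi pred_intros_logic(3)[OF pred_close_to this]]]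
  show "Measurable.pred M (\<lambda>w. few m r v u w x)" unfolding few_def .
next
  fix w :: "('a set \<Rightarrow> bool) \<times> ('a set \<Rightarrow> bool)" and x y
  assume "conn (fst w) x y" "few m r v u w x"
  then show "few m r v u w y"
    using close_to_cong[of w x y] close_pts_cong[of w x y] by (simp add: few_def)
qed

lemma few_shift2:
  assumes g: "g \<in> carrier G" and v: "v \<in> carrier G" and u: "u \<in> carrier G" and x: "x \<in> carrier G"
  shows "few m r v u (shift2 g w) x \<longleftrightarrow> few m r (g \<otimes> v) (g \<otimes> u) w (g \<otimes> x)"
proof -
  have inj: "inj_on ((\<otimes>) g) (close_pts r (shift2 g w) x v)"
    using inj_on_transl[OF g] by (rule inj_on_subset) (auto simp: close_pts_def)
  show ?thesis
    unfolding few_def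
    using inf_cl_hi_shift2[OF g v] conn_hi_shift2[OF g v u] close_to_shift2[OF g x u]
      close_pts_shift2[OF g x v, of r w] card_image[OF inj] finite_image_iff[OF inj]
    by simp
qed

lemma Q_cong:
  assumes h: "cfun B h" and k: "cfun C k" and eq: "\<And>w x. x \<in> carrier G \<Longrightarrow> h w x = k w x"
  shows "Q h = Q k"
  using Q_mono[OF h k] Q_mono[OF k h] eq by (simp add: order_antisym)

text \<open>Diagonal invariance, the input of every mass transport: the expected mass depends on
  \<open>inv v \<otimes> u\<close> only.\<close>

lemma QP_few_shift:
  assumes g: "g \<in> carrier G" and v: "v \<in> carrier G" and u: "u \<in> carrier G"
  shows "QP (few m r (g \<otimes> v) (g \<otimes> u)) = QP (few m r v u)"
proof -
  have "QP (few m r (g \<otimes> v) (g \<otimes> u)) = Q (\<lambda>w x. of_bool (few m r v u (shift2 g w) (inv g \<otimes> x)))"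
  proof (rule Q_cong[OF cfun_cprop[OF cprop_few] cluster_fun_shift[OF g cfun_cprop[OF cprop_few]]])
    fix w x assume x: "x \<in> carrier G"
    then show "of_bool (few m r (g \<otimes> v) (g \<otimes> u) w x) = (of_bool (few m r v u (shift2 g w) (inv g \<otimes> x)) :: real)"
      using few_shift2[OF g v u, of "inv g \<otimes> x"] g by (simp add: m_assoc[symmetric])
  qed
  also have "\<dots> = QP (few m r v u)"
    by (rule Q_shift[OF g cfun_cprop[OF cprop_few]])
  finally show ?thesis .
qed

lemma QP_sum:
  assumes "finite I" "\<And>i. i \<in> I \<Longrightarrow> cprop (H i)"
  shows "cfun (real (card I)) (\<lambda>w x. \<Sum>i\<in>I. of_bool (H i w x)) \<and>
    Q (\<lambda>w x. \<Sum>i\<in>I. of_bool (H i w x)) = (\<Sum>i\<in>I. QP (H i))"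
  using assms
proof (induction I rule: finite_induct)
  case empty
  have "cfun 0 (\<lambda>w x. 0)" by (rule cluster_fun_const) auto
  then show ?case using Q_AE_zero[of 0 "\<lambda>w x. 0"] by simp
next
  case (insert i I)
  then have i: "cfun 1 (\<lambda>w x. of_bool (H i w x))"
    and I: "cfun (real (card I)) (\<lambda>w x. \<Sum>i\<in>I. of_bool (H i w x))"
      "Q (\<lambda>w x. \<Sum>i\<in>I. of_bool (H i w x)) = (\<Sum>i\<in>I. QP (H i))"
    by (auto simp: cfun_cprop)
  have eq: "(\<lambda>w x. \<Sum>i\<in>insert i I. of_bool (H i w x) :: real) = (\<lambda>w x. of_bool (H i w x) + (\<Sum>i\<in>I. of_bool (H i w x)))"
    using insert.hyps by (intro ext sum.insert)
  have "real (card (insert i I)) = 1 + real (card I)" using insert.hyps by simp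
  then show ?case
    unfolding eq using cluster_fun_add[OF i I(1)] Q_add[OF i I(1)] I(2) sum.insert[OF insert.hyps, of "\<lambda>i. QP (H i)"]
    by (simp only: refl simp_thms)
qed

text \<open>Mass transport: every point of an infinite upper cluster sends unit mass to each of the at most
  \<open>m\<close> points of its cluster that are close to the distinguished lower cluster. The mass sent out is
  at most \<open>m\<close>, but a point that receives mass receives it from infinitely many points.\<close>

lemma null_few_one: "null (few m r \<one> \<one>)"
proof -
  \<comment> \<open>A truncation: the identity receives mass, and its upper cluster contains at
    least \<open>N\<close> of the first \<open>j\<close> points. Only finitely many senders are then
    summed, and \<open>j\<close> tends to infinity with \<open>N\<close> fixed, since the cluster is
    infinite.\<close>
  define k where "k N j w x \<longleftrightarrow> few m r \<one> \<one> w x \<and>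
    (\<exists>F\<in>{F. finite F \<and> F \<subseteq> {..<j} \<and> card F = N}. \<forall>i\<in>F. conn (hi w) \<one> (en i))" for N j :: nat and w x
  have cprop_k: "cprop (k N j)" for N j
  proof (rule cpropI)
    fix x assume x: "x \<in> carrier G"
    have "Measurable.pred M (\<lambda>w. \<exists>F\<in>{F. finite F \<and> F \<subseteq> {..<j} \<and> card F = N}. \<forall>i\<in>F. conn (hi w) \<one> (en i))"
    proof (rule pred_Bex_countable)
      show "countable {F. finite F \<and> F \<subseteq> {..<j} \<and> card F = N}"
        by (rule countable_finite, rule finite_subset[of _ "Pow {..<j}"]) auto
    qed (intro pred_Ball_countable pred_conn_hi, auto intro: countable_finite)
    then show "Measurable.pred M (\<lambda>w. k N j w x)"
      unfolding k_def by (rule pred_intros_logic(3)[OF cpropD(1)[OF cprop_few x]])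
  next
    fix w :: "('a set \<Rightarrow> bool) \<times> ('a set \<Rightarrow> bool)" and x y
    assume xy: "x \<in> carrier G" "y \<in> carrier G" "conn (fst w) x y" "k N j w x"
    then show "k N j w y" using cpropD(2)[OF cprop_few xy(1-3)] unfolding k_def by simp
  qed
  have "N * QP (k N j) \<le> m * Q (\<lambda>w x. 1)" for N j
  proof -
    have sum_in: "cfun (real (card {..<j})) (\<lambda>w x. \<Sum>i<j. of_bool (few m r (en i) \<one> w x))"
      "Q (\<lambda>w x. \<Sum>i<j. of_bool (few m r (en i) \<one> w x)) = (\<Sum>i<j. QP (few m r (en i) \<one>))"
      using QP_sum[of "{..<j}" "\<lambda>i. few m r (en i) \<one>"] cprop_few by auto
    have sum_out: "cfun (real (card {..<j})) (\<lambda>w x. \<Sum>i<j. of_bool (few m r \<one> (inv (en i)) w x))"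
      "Q (\<lambda>w x. \<Sum>i<j. of_bool (few m r \<one> (inv (en i)) w x)) = (\<Sum>i<j. QP (few m r \<one> (inv (en i))))"
      using QP_sum[of "{..<j}" "\<lambda>i. few m r \<one> (inv (en i))"] cprop_few by auto
    have "N * QP (k N j) = Q (\<lambda>w x. real N * of_bool (k N j w x))"
      using Q_scale[OF cfun_cprop[OF cprop_k], of "real N"] by simp
    also have "\<dots> \<le> Q (\<lambda>w x. \<Sum>i<j. of_bool (few m r (en i) \<one> w x))"
    proof (rule Q_mono[OF cluster_fun_scale[OF cfun_cprop[OF cprop_k]] sum_in(1)])
      fix w x
      show "real N * of_bool (k N j w x) \<le> (\<Sum>i<j. of_bool (few m r (en i) \<one> w x) :: real)"
      proof (cases "k N j w x")
        case True
        then obtain F where F: "F \<subseteq> {..<j}" "card F = N" "\<forall>i\<in>F. conn (hi w) \<one> (en i)"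
          and few: "few m r \<one> \<one> w x" by (auto simp: k_def)
        have "few m r (en i) \<one> w x" if "i \<in> F" for i
          using few F(3) that inf_cl_conn[of "hi w" \<one> "en i"] close_pts_conn[of w \<one> "en i"] conn_sym[of "hi w" \<one> "en i"]
          by (simp add: few_def)
        then have "real N = (\<Sum>i\<in>F. of_bool (few m r (en i) \<one> w x))"
          using F(2) by simp
        also have "\<dots> \<le> (\<Sum>i<j. of_bool (few m r (en i) \<one> w x))"
          using F(1) by (intro sum_mono2) auto
        finally show ?thesis using True by simp
      qed (simp add: sum_nonneg)
    qed simp
    also have "\<dots> = (\<Sum>i<j. QP (few m r (en i) \<one>))" by (rule sum_in(2))
    \<comment> \<open>The exchange of mass received and mass sent: translation by
      \<open>en i\<close> carries the pair of \<open>\<one>\<close> and \<open>inv (en i)\<close> to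
      the pair of \<open>en i\<close> and \<open>\<one>\<close>.\<close>
    also have "\<dots> = (\<Sum>i<j. QP (few m r \<one> (inv (en i))))"
      using QP_few_shift[of "en i" \<one> "inv (en i)" m r for i] by (intro sum.cong refl) simp
    also have "\<dots> = Q (\<lambda>w x. \<Sum>i<j. of_bool (few m r \<one> (inv (en i)) w x))" by (rule sum_out(2)[symmetric])
    also have "\<dots> \<le> Q (\<lambda>w x. real m * 1)"
    proof (rule Q_mono[OF sum_out(1) cluster_fun_scale[OF cfun_one]])
      fix w x
      show "(\<Sum>i<j. of_bool (few m r \<one> (inv (en i)) w x) :: real) \<le> real m * 1"
      proof (cases "finite (close_pts r w x \<one>) \<and> card (close_pts r w x \<one>) \<le> m")
        case True
        have inj: "inj_on (\<lambda>i. inv (en i)) {i \<in> {..<j}. few m r \<one> (inv (en i)) w x}"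
          using inj_en by (auto simp: inj_on_def inj_def)
        have "(\<Sum>i<j. of_bool (few m r \<one> (inv (en i)) w x) :: real) = card {i \<in> {..<j}. few m r \<one> (inv (en i)) w x}"
          by (simp add: sum.If_cases of_bool_def Int_def)
        also have "card {i \<in> {..<j}. few m r \<one> (inv (en i)) w x} \<le> card (close_pts r w x \<one>)"
          using True by (intro card_inj_on_le[OF inj]) (auto simp: few_def close_pts_def)
        finally show ?thesis using True by simp
      next
        case False
        then have "\<not> few m r \<one> u w x" for u by (auto simp: few_def)
        then show ?thesis by simp
      qed
    qed simp
    also have "\<dots> = m * Q (\<lambda>w x. 1)" by (rule Q_scale[OF cfun_one]) simp
    finally show ?thesis .
  qed
  moreover have "(\<lambda>j. N * QP (k N j)) \<longlonglongrightarrow> N * QP (few m r \<one> \<one>)" for N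
  proof (intro tendsto_mult_left Q_dominated[of 1] cfun_cprop cprop_k cprop_few)
    fix w x
    show "(\<lambda>j. of_bool (k N j w x)) \<longlonglongrightarrow> (of_bool (few m r \<one> \<one> w x) :: real)"
    proof (cases "few m r \<one> \<one> w x")
      case True
      then have "infinite {y \<in> carrier G. conn (hi w) \<one> y}" by (simp add: few_def inf_cl_def)
      then have "infinite {i. conn (hi w) \<one> (en i)}"
        unfolding infinite_iff_en infinite_nat_iff_unbounded_le by simp
      from infinite_arbitrarily_large[OF this, of N]
      obtain F where F: "finite F" "card F = N" "F \<subseteq> {i. conn (hi w) \<one> (en i)}" by blast
      obtain j0 where j0: "F \<subseteq> {..<j0}" using finite_nat_iff_bounded F(1) by blast
      have "k N j w x" if "j0 \<le> j" for j
        unfolding k_def using True F j0 that by (intro conjI bexI[of _ F]) auto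
      then have "\<forall>\<^sub>F j in sequentially. of_bool (k N j w x) = (of_bool (few m r \<one> \<one> w x) :: real)"
        using True by (intro eventually_sequentiallyI[of j0]) simp
      then show ?thesis by (rule tendsto_eventually)
    qed (simp add: k_def)
  qed
  ultimately have le: "N * QP (few m r \<one> \<one>) \<le> m * Q (\<lambda>w x. 1)" for N :: nat
    by (intro LIMSEQ_le_const2[of "\<lambda>j. N * QP (k N j)"]) auto
  have "QP (few m r \<one> \<one>) = 0"
  proof (rule ccontr)
    assume "QP (few m r \<one> \<one>) \<noteq> 0"
    then have pos: "QP (few m r \<one> \<one>) > 0" using Q_nonneg[OF cfun_cprop[OF cprop_few[of m r \<one> \<one>]]] by simp
    obtain N :: nat where "m * Q (\<lambda>w x. 1) / QP (few m r \<one> \<one>) < N" using reals_Archimedean2 by blast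
    then show False using le[of N] pos by (simp add: field_simps)
  qed
  then show ?thesis using cprop_few by (simp add: null_def)
qed

lemma null_few: "u \<in> carrier G \<Longrightarrow> null (few m r u u)"
  using null_few_one[of m r] QP_few_shift[of u \<one> \<one> m r] cprop_few by (simp add: null_def)

definition finitely_close where
  "finitely_close r v w x \<longleftrightarrow> inf_cl (hi w) v \<and> finite (close_pts r w x v) \<and> close_pts r w x v \<noteq> {}"

text \<open>A finite nonempty set of close points has some cardinality \<open>m\<close> and some
  member \<open>u\<close>, and then \<open>u\<close> sends mass to itself. Countably many choices of
  \<open>m\<close> and \<open>u\<close> cover the event.\<close>

lemma null_finitely_close: "null (finitely_close r v)"
proof (rule null_mono[OF null_ex_carrier[OF null_ex[OF null_few]]])
  show "cprop (finitely_close r v)"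
  proof (rule cpropI)
    fix x
    have "Measurable.pred M (\<lambda>w. finite (close_pts r w x v))"
    proof -
      have "Measurable.pred M (\<lambda>w. infinite (close_pts r w x v))"
        unfolding close_pts_def by (intro pred_infinite pred_intros_logic(3) pred_conn_hi pred_close_to)
      from pred_intros_logic(2)[OF this] show ?thesis by (simp only: not_not)
    qed
    moreover have "Measurable.pred M (\<lambda>w. close_pts r w x v \<noteq> {})"
    proof -
      have "(close_pts r w x v \<noteq> {}) \<longleftrightarrow> (\<exists>f\<in>carrier G. conn (hi w) v f \<and> close_to r w x f)" for w
        by (auto simp: close_pts_def)
      then show ?thesis
        by (simp only:) (intro pred_Bex_countable countable_carrier pred_intros_logic(3) pred_conn_hi pred_close_to)
    qed
    ultimately show "Measurable.pred M (\<lambda>w. finitely_close r v w x)"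
      unfolding finitely_close_def by (intro pred_intros_logic(3) pred_inf_cl_hi)
  next
    fix w :: "('a set \<Rightarrow> bool) \<times> ('a set \<Rightarrow> bool)" and x y
    assume "conn (fst w) x y" "finitely_close r v w x"
    then show "finitely_close r v w y"
      using close_pts_cong[of w x y r v] by (simp add: finitely_close_def)
  qed
  fix w x assume fc: "finitely_close r v w x"
  then obtain u where u: "u \<in> close_pts r w x v" by (auto simp: finitely_close_def)
  then have vu: "conn (hi w) v u" "u \<in> carrier G" "close_to r w x u" by (auto simp: close_pts_def)
  have "few (card (close_pts r w x v)) r u u w x"
    using fc inf_cl_conn[OF _ vu(1)] close_pts_conn[OF vu(1), of r x] vu(3)
    by (simp add: few_def finitely_close_def)
  then show "\<exists>u\<in>carrier G. \<exists>m. few m r u u w x" using vu(2) by blast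
qed

definition touching where
  "touching r v w x \<longleftrightarrow> close_pts r w x v = {} \<and> infinite (close_pts (Suc r) w x v)"

text \<open>Once the lower configuration is fixed, the \<open>r\<close>-neighbourhood
  \<open>Y\<close> of the lower cluster is a fixed set. The upper cluster misses \<open>Y\<close>
  but has infinitely many points adjacent to it, which \<open>AE_sprinkle\<close> excludes.\<close>

lemma null_touching: "null (touching r v)"
  unfolding null_def
proof
  show cp: "cprop (touching r v)"
  proof (rule cpropI)
    fix x
    have "Measurable.pred M (\<lambda>w. infinite (close_pts (Suc r) w x v))"
      unfolding close_pts_def by (intro pred_infinite pred_intros_logic(3) pred_conn_hi pred_close_to)
    moreover have "Measurable.pred M (\<lambda>w. close_pts r w x v = {})"
    proof -
      have "(close_pts r w x v = {}) \<longleftrightarrow> (\<forall>f\<in>carrier G. \<not> (conn (hi w) v f \<and> close_to r w x f))" for w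
        by (auto simp: close_pts_def)
      then show ?thesis
        by (simp only:) (intro pred_Ball_countable countable_carrier pred_intros_logic(2,3) pred_conn_hi pred_close_to)
    qed
    ultimately show "Measurable.pred M (\<lambda>w. touching r v w x)"
      unfolding touching_def by (intro pred_intros_logic(3))
  next
    fix w :: "('a set \<Rightarrow> bool) \<times> ('a set \<Rightarrow> bool)" and x y
    assume "conn (fst w) x y" "touching r v w x"
    then show "touching r v w y"
      using close_pts_cong[of w x y _ v] by (simp add: touching_def)
  qed
  show "QP (touching r v) = 0"
  proof (rule Q_AE_zero[OF cfun_cprop[OF cp]])
    fix x assume x: "x \<in> carrier G"
    interpret P1: prob_space "percolation E p" by (rule prob_space_percolation)
    interpret P2: prob_space "percolation E q" by (rule prob_space_percolation)
    interpret PP: pair_sigma_finite "percolation E p" "percolation E q" ..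
    have "AE w in percolation E p \<Otimes>\<^sub>M percolation E q. \<not> touching r v w x"
    proof (rule PP.AE_pair_measure)
      have "Measurable.pred M (\<lambda>w. \<not> touching r v w x)"
        by (rule pred_intros_logic(2)[OF cpropD(1)[OF cp x]])
      then show "{w \<in> space (percolation E p \<Otimes>\<^sub>M percolation E q). \<not> touching r v w x} \<in>
          sets (percolation E p \<Otimes>\<^sub>M percolation E q)"
        by (simp only: pred_def two_level_def)
      have "AE \<eta> in percolation E q. \<not> touching r v (\<omega>, \<eta>) x" for \<omega>
      proof -
        define Y where "Y = {u. \<exists>z\<in>carrier G. conn \<omega> x z \<and> u \<in> (nbhd ^^ r) {z}}"
        have hi: "hi (\<omega>, \<eta>) = (\<lambda>e. \<omega> e \<or> \<eta> e)" for \<eta> by (simp add: hi_def fun_eq_iff)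
        have Y: "close_to r (\<omega>, \<eta>) x u \<longleftrightarrow> u \<in> Y" for u \<eta> by (simp add: close_to_def Y_def)
        have Suc: "close_to (Suc r) (\<omega>, \<eta>) x u \<longleftrightarrow> u \<in> Y \<or> (\<exists>y\<in>Y. {u, y} \<in> E)" for u \<eta>
          unfolding close_to_def nbhd_pow_Suc Y_def by (auto simp: insert_commute)
        show ?thesis
        proof (rule AE_mp[OF AE_sprinkle[OF q_pos q_le_1, of Y \<omega> v]], intro AE_I2 impI notI)
          fix \<eta> assume ok: "\<not> ((\<forall>y\<in>Y \<inter> carrier G. \<not> conn (\<lambda>e. \<omega> e \<or> \<eta> e) v y) \<and>
            infinite {z \<in> carrier G. conn (\<lambda>e. \<omega> e \<or> \<eta> e) v z \<and> (\<exists>y\<in>Y. {z, y} \<in> E)})"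
            and t: "touching r v (\<omega>, \<eta>) x"
          have av: "\<forall>y\<in>Y \<inter> carrier G. \<not> conn (\<lambda>e. \<omega> e \<or> \<eta> e) v y"
            using t unfolding touching_def close_pts_def Y hi by blast
          have "close_pts (Suc r) (\<omega>, \<eta>) x v \<subseteq> {z \<in> carrier G. conn (\<lambda>e. \<omega> e \<or> \<eta> e) v z \<and> (\<exists>y\<in>Y. {z, y} \<in> E)}"
            using av unfolding close_pts_def Suc hi by blast
          then show False using ok av t unfolding touching_def using finite_subset by blast
        qed
      qed
      then show "AE \<omega> in percolation E p. AE \<eta> in percolation E q. \<not> touching r v (\<omega>, \<eta>) x" by simp
    qed
    then have "AE w in M. \<not> touching r v w x" by (simp only: two_level_def)
    then show "AE w in M. of_bool (touching r v w x) = (0::real)" by simp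
  qed
qed

definition separated where
  "separated v w x \<longleftrightarrow> inf_cl (hi w) v \<and> \<not> conn (hi w) v x"

text \<open>At the least radius \<open>r\<close> at which the upper cluster has close points, either
  these are finitely many, or they are infinitely many and none exist at radius
  \<open>r - 1\<close>. Both cases are null, and radius 0 would mean that the clusters meet.\<close>

lemma null_separated:
  assumes v: "v \<in> carrier G"
  shows "null (separated v)"
proof (rule null_mono[OF null_ex[OF null_disj[OF null_finitely_close null_touching]]])
  show "cprop (separated v)"
  proof (rule cpropI)
    show "Measurable.pred M (\<lambda>w. separated v w x)" for x
      unfolding separated_def by (intro pred_intros_logic(2,3) pred_inf_cl_hi pred_conn_hi)
    fix w :: "('a set \<Rightarrow> bool) \<times> ('a set \<Rightarrow> bool)" and x y
    assume "conn (fst w) x y" "separated v w x"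
    then show "separated v w y"
      using conn_trans conn_sym conn_fst_hi unfolding separated_def by blast
  qed
  fix w x assume x: "x \<in> carrier G" and sep: "separated v w x"
  obtain r0 where "v \<in> (nbhd ^^ r0) {x}" using ex_nbhd_pow[OF x v] .
  then have "close_to r0 w x v" unfolding close_to_def using x by (intro bexI[of _ x]) auto
  then have "v \<in> close_pts r0 w x v" using v by (simp add: close_pts_def)
  then have ex: "close_pts r0 w x v \<noteq> {}" by blast
  define r where "r = (LEAST r. close_pts r w x v \<noteq> {})"
  have r: "close_pts r w x v \<noteq> {}" unfolding r_def by (rule LeastI[of _ r0]) (rule ex)
  have less: "close_pts s w x v = {}" if "s < r" for s using not_less_Least that unfolding r_def by blast
  show "\<exists>r. finitely_close r v w x \<or> touching r v w x"
  proof (cases r)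
    case 0
    then obtain f where "conn (hi w) v f" "conn (fst w) x f"
      using r by (auto simp: close_pts_def close_to_def)
    then have "conn (hi w) v x" using conn_trans conn_sym conn_fst_hi by blast
    then show ?thesis using sep by (simp add: separated_def)
  next
    \<comment> \<open>\<open>touching\<close> is indexed by the last radius without close points,
      which is \<open>s\<close>.\<close>
    case (Suc s)
    show ?thesis
    proof (cases "finite (close_pts r w x v)")
      case True
      then show ?thesis using r sep by (auto simp: finitely_close_def separated_def)
    next
      case False
      then show ?thesis using less[of s] Suc by (auto simp: touching_def)
    qed
  qed
qed

text \<open>Two different infinite upper clusters cannot both contain the picked cluster, so one of
  them is separated from it, a null event. If there were almost surely several, \<open>Q\<close> of
  the constant 1 would vanish.\<close>

lemma not_AE_several_cl: "\<not> (AE w in M. several_cl (hi w))"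
proof
  assume AE: "AE w in M. several_cl (hi w)"
  have "cprop (\<lambda>w x. several_cl (hi w))"
    unfolding several_cl_def
    by (intro cpropI pred_Bex_countable countable_carrier pred_intros_logic(2,3) pred_inf_cl_hi pred_conn_hi)
  moreover have "null (\<lambda>w x. \<exists>u\<in>carrier G. \<exists>v\<in>carrier G. separated u w x \<or> separated v w x)"
    by (intro null_ex_carrier null_disj null_separated)
  ultimately have "null (\<lambda>w x. several_cl (hi w))"
  proof (elim null_mono[rotated])
    fix w x assume "several_cl (hi w)"
    then obtain u v where uv: "u \<in> carrier G" "v \<in> carrier G" "inf_cl (hi w) u" "inf_cl (hi w) v" "\<not> conn (hi w) u v"
      by (auto simp: several_cl_def)
    then have "separated u w x \<or> separated v w x"
      unfolding separated_def using conn_trans conn_sym by blast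
    then show "\<exists>u\<in>carrier G. \<exists>v\<in>carrier G. separated u w x \<or> separated v w x" using uv by blast
  qed
  then have cp: "cprop (\<lambda>w x. several_cl (hi w))" and zero: "QP (\<lambda>w x. several_cl (hi w)) = 0"
    by (auto simp: null_def)
  have f: "cfun 1 (\<lambda>w x. 1 - of_bool (several_cl (hi w)))"
    by (rule cluster_fun_diff[OF cfun_one cfun_cprop[OF cp]]) simp
  have "Q (\<lambda>w x. 1 - of_bool (several_cl (hi w))) = 0"
    using AE by (intro Q_AE_zero[OF f]) (auto elim: eventually_mono)
  with Q_add[OF cfun_cprop[OF cp] f] zero have "Q (\<lambda>w x. 1) = 0" by simp
  then show False using Q_one c_pos by simp
qed

end

section \<open>Couplings of parameters and uniqueness above long-range order\<close>

lemma bool_pmf_eqI: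
  fixes M N :: "bool pmf"
  assumes "pmf M b = pmf N b"
  shows "M = N"
proof (rule pmf_eqI)
  fix i
  have 1: "pmf L b + pmf L (\<not> b) = 1" for L :: "bool pmf"
  proof -
    have "(\<Sum>i\<in>UNIV. pmf L i) = 1" by (rule sum_pmf_eq_1) auto
    then show ?thesis by (cases b) (simp_all add: UNIV_bool)
  qed
  show "pmf M i = pmf N i"
    using assms 1[of M] 1[of N] by (cases "i = b") auto
qed

lemma bernoulli_disj:
  assumes "0 \<le> p" "p \<le> 1" "0 \<le> q" "q \<le> 1"
  shows "bernoulli_pmf (1 - (1 - p) * (1 - q)) = map_pmf (\<lambda>(a, b). a \<or> b) (pair_pmf (bernoulli_pmf p) (bernoulli_pmf q))"
proof (rule bool_pmf_eqI[of _ False])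
  have "(\<lambda>(a, b). a \<or> b) -` {False} = {(False, False)}" by auto
  then have "pmf (map_pmf (\<lambda>(a, b). a \<or> b) (pair_pmf (bernoulli_pmf p) (bernoulli_pmf q))) False = (1 - p) * (1 - q)"
    using assms by (simp add: pmf_map measure_pmf_single pmf_pair)
  moreover have "0 \<le> (1 - p) * (1 - q)" "(1 - p) * (1 - q) \<le> 1"
    using assms by (auto intro: mult_le_one)
  ultimately show "pmf (bernoulli_pmf (1 - (1 - p) * (1 - q))) False =
      pmf (map_pmf (\<lambda>(a, b). a \<or> b) (pair_pmf (bernoulli_pmf p) (bernoulli_pmf q))) False"
    by simp
qed

lemma bernoulli_conj:
  assumes "0 \<le> p" "p \<le> 1" "0 \<le> q" "q \<le> 1"
  shows "bernoulli_pmf (p * q) = map_pmf (\<lambda>(a, b). a \<and> b) (pair_pmf (bernoulli_pmf p) (bernoulli_pmf q))"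
proof (rule bool_pmf_eqI[of _ True])
  have "(\<lambda>(a, b). a \<and> b) -` {True} = {(True, True)}" by auto
  then have "pmf (map_pmf (\<lambda>(a, b). a \<and> b) (pair_pmf (bernoulli_pmf p) (bernoulli_pmf q))) True = p * q"
    using assms by (simp add: pmf_map measure_pmf_single pmf_pair)
  moreover have "0 \<le> p * q" "p * q \<le> 1"
    using assms by (auto intro: mult_le_one)
  ultimately show "pmf (bernoulli_pmf (p * q)) True =
      pmf (map_pmf (\<lambda>(a, b). a \<and> b) (pair_pmf (bernoulli_pmf p) (bernoulli_pmf q))) True"
    by simp
qed

lemma integral_of_bool:
  assumes "Measurable.pred M Q"
  shows "(\<integral>w. of_bool (Q w) \<partial>M) = (measure M {w \<in> space M. Q w} :: real)"
proof -
  have "(\<integral>w. of_bool (Q w) \<partial>M) = (\<integral>w. indicator {w \<in> space M. Q w} w \<partial>M :: real)"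
    by (rule Bochner_Integration.integral_cong) (simp_all add: indicator_def of_bool_def)
  also have "\<dots> = measure M ({w \<in> space M. Q w} \<inter> space M)" by (rule Bochner_Integration.integral_indicator)
  also have "{w \<in> space M. Q w} \<inter> space M = {w \<in> space M. Q w}" by blast
  finally show ?thesis .
qed

context cayley
begin

lemma distr_hi:
  assumes "0 \<le> p" "p \<le> 1" "0 \<le> q" "q \<le> 1"
  shows "distr (two_level p q) (percolation E (1 - (1 - p) * (1 - q))) (\<lambda>w. restrict (hi w) E) =
    percolation E (1 - (1 - p) * (1 - q))"
proof -
  have "(\<lambda>w. restrict (hi w) E) = (\<lambda>(\<omega>, \<eta>). \<lambda>e\<in>E. \<omega> e \<or> \<eta> e)"
    by (auto simp: fun_eq_iff hi_def)
  then show ?thesis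
    unfolding two_level_def percolation_bits
    by (simp only:) (rule bits_zip[where f="\<lambda>_ a b. a \<or> b", OF bernoulli_disj[OF assms]])
qed

definition lo :: "('a set \<Rightarrow> bool) \<times> ('a set \<Rightarrow> bool) \<Rightarrow> 'a set \<Rightarrow> bool" where
  "lo w e \<longleftrightarrow> fst w e \<and> snd w e"

lemma distr_lo:
  assumes "0 \<le> p" "p \<le> 1" "0 \<le> q" "q \<le> 1"
  shows "distr (two_level p q) (percolation E (p * q)) (\<lambda>w. restrict (lo w) E) = percolation E (p * q)"
proof -
  have "(\<lambda>w. restrict (lo w) E) = (\<lambda>(\<omega>, \<eta>). \<lambda>e\<in>E. \<omega> e \<and> \<eta> e)"
    by (auto simp: fun_eq_iff lo_def)
  then show ?thesis
    unfolding two_level_def percolation_bits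
    by (simp only:) (rule bits_zip[where f="\<lambda>_ a b. a \<and> b", OF bernoulli_conj[OF assms]])
qed

lemma measurable_hi: "(\<lambda>w. restrict (hi w) E) \<in> measurable (two_level p q) (percolation E r)"
  unfolding percolation_bits by (rule measurable_bits[OF pred_hi])

lemma pred_lo: "e \<in> E \<Longrightarrow> Measurable.pred (two_level p q) (\<lambda>w. lo w e)"
  unfolding lo_def by (intro pred_intros_logic(3) pred_fst pred_snd)

lemma measurable_lo: "(\<lambda>w. restrict (lo w) E) \<in> measurable (two_level p q) (percolation E r)"
  unfolding percolation_bits by (rule measurable_bits[OF pred_lo])

lemma conn_restrict: "conn (restrict \<omega> E) x y \<longleftrightarrow> conn \<omega> x y"
  by (rule conn_cong) simp

lemma inf_cl_restrict: "inf_cl (restrict \<omega> E) x \<longleftrightarrow> inf_cl \<omega> x"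
  by (rule inf_cl_cong) simp

lemma distr_fst: "distr (two_level p q) (percolation E p) fst = percolation E p"
proof -
  interpret prob_space "percolation E q" by (rule prob_space_percolation)
  show ?thesis unfolding two_level_def by (rule distr_pair_fst)
qed

lemma measurable_fst2: "fst \<in> measurable (two_level p q) (percolation E p)"
  unfolding two_level_def by (rule measurable_fst)

lemma AE_fst:
  assumes "AE \<omega> in percolation E p. Q \<omega>"
  shows "AE w in two_level p q. Q (fst w)"
  by (rule AE_distrD[OF measurable_fst2]) (simp only: distr_fst assms)

lemma pred_conn_percolation: "Measurable.pred (percolation E p) (\<lambda>\<omega>. conn \<omega> x y)"
  by (rule pred_conn[OF pred_percolation])

lemma pred_inf_cl_percolation: "Measurable.pred (percolation E p) (\<lambda>\<omega>. inf_cl \<omega> x)"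
  by (rule pred_inf_cl[OF pred_percolation])

lemma tau_eq:
  assumes "x \<in> carrier G" "y \<in> carrier G"
  shows "\<tau> p q x y = two_point (carrier G) E p x y"
proof -
  have "\<tau> p q x y = (\<integral>w. of_bool (conn (fst w) x y) \<partial>two_level p q)"
    by (simp add: cluster_kernel_def)
  also have "\<dots> = (\<integral>\<omega>. of_bool (conn \<omega> x y) \<partial>distr (two_level p q) (percolation E p) fst)"
    by (rule integral_distr[symmetric, OF measurable_fst2 borel_of_bool[OF pred_conn_percolation]])
  also have "\<dots> = two_point (carrier G) E p x y"
    unfolding distr_fst two_point_eq[OF assms] by (rule integral_of_bool[OF pred_conn_percolation])
  finally show ?thesis .
qed

lemma shift_closed: "g \<in> carrier G \<Longrightarrow> \<omega> \<in> space (percolation E p) \<Longrightarrow> shift g \<omega> \<in> space (percolation E p)"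
  unfolding percolation_bits by (rule measurable_space[OF measurable_shift])

lemma zero_one:
  assumes "Measurable.pred (percolation E p) Q"
    and "\<And>g \<omega>. g \<in> carrier G \<Longrightarrow> Q (shift g \<omega>) \<longleftrightarrow> Q \<omega>"
  shows "(AE \<omega> in percolation E p. \<not> Q \<omega>) \<or> (AE \<omega> in percolation E p. Q \<omega>)"
proof -
  interpret prob_space "percolation E p" by (rule prob_space_percolation)
  let ?A = "{\<omega> \<in> space (percolation E p). Q \<omega>}"
  have A: "?A \<in> sets (percolation E p)" using assms(1) by (simp only: pred_def)
  have "prob ?A = 0 \<or> prob ?A = 1"
    by (rule invariant_zero_one[OF A]) (use assms(2) shift_closed in blast)
  then show ?thesis
  proof
    assume "prob ?A = 0"
    then have "AE \<omega> in percolation E p. \<omega> \<notin> ?A" using prob_eq_0[OF A] by blast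
    then have "AE \<omega> in percolation E p. \<not> Q \<omega>" by (rule AE_mp) (rule AE_I2, simp)
    then show ?thesis ..
  next
    assume "prob ?A = 1"
    then have "AE \<omega> in percolation E p. \<omega> \<in> ?A" using prob_eq_1[OF A] by blast
    then have "AE \<omega> in percolation E p. Q \<omega>" by (rule AE_mp) (rule AE_I2, simp)
    then show ?thesis ..
  qed
qed

lemma ex_inf_cl_shift:
  assumes g: "g \<in> carrier G"
  shows "(\<exists>x\<in>carrier G. inf_cl (shift g \<omega>) x) \<longleftrightarrow> (\<exists>x\<in>carrier G. inf_cl \<omega> x)"
proof
  assume "\<exists>x\<in>carrier G. inf_cl \<omega> x"
  then obtain x where "x \<in> carrier G" "inf_cl \<omega> (g \<otimes> (inv g \<otimes> x))"
    using g by (auto simp: m_assoc[symmetric])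
  then show "\<exists>x\<in>carrier G. inf_cl (shift g \<omega>) x"
    using inf_cl_shift[OF g, of "inv g \<otimes> x"] g by (intro bexI[of _ "inv g \<otimes> x"]) simp_all
qed (use inf_cl_shift[OF g] g in blast)

lemma several_cl_shift:
  assumes g: "g \<in> carrier G"
  shows "several_cl (shift g \<omega>) \<longleftrightarrow> several_cl \<omega>"
proof
  assume "several_cl \<omega>"
  then obtain u v where uv: "u \<in> carrier G" "v \<in> carrier G" "inf_cl \<omega> u" "inf_cl \<omega> v" "\<not> conn \<omega> u v"
    by (auto simp: several_cl_def)
  have "inv g \<otimes> u \<in> carrier G" "inv g \<otimes> v \<in> carrier G" "g \<otimes> (inv g \<otimes> u) = u" "g \<otimes> (inv g \<otimes> v) = v"
    using uv g by (simp_all add: m_assoc[symmetric])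
  then show "several_cl (shift g \<omega>)"
    unfolding several_cl_def using uv inf_cl_shift[OF g] conn_shift[OF g]
    by (intro bexI[of _ "inv g \<otimes> u"] bexI[of _ "inv g \<otimes> v"]) simp_all
next
  assume "several_cl (shift g \<omega>)"
  then obtain u v where uv: "u \<in> carrier G" "v \<in> carrier G" "inf_cl (shift g \<omega>) u" "inf_cl (shift g \<omega>) v" "\<not> conn (shift g \<omega>) u v"
    by (auto simp: several_cl_def)
  then show "several_cl \<omega>"
    unfolding several_cl_def using inf_cl_shift[OF g] conn_shift[OF g] g
    by (intro bexI[of _ "g \<otimes> u"] bexI[of _ "g \<otimes> v"]) simp_all
qed

lemma unique_iff_several_cl:
  "unique_infinite_cluster (carrier G) E \<omega> \<longleftrightarrow> (\<exists>x\<in>carrier G. inf_cl \<omega> x) \<and> \<not> several_cl \<omega>"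
  unfolding unique_infinite_cluster_iff several_cl_def by blast

lemma pred_ex_inf_cl: "Measurable.pred (percolation E p) (\<lambda>\<omega>. \<exists>x\<in>carrier G. inf_cl \<omega> x)"
  by (intro pred_Bex_countable countable_carrier pred_inf_cl_percolation)

lemma pred_several_cl: "Measurable.pred (percolation E p) several_cl"
  unfolding several_cl_def[abs_def]
  by (intro pred_Bex_countable countable_carrier pred_intros_logic(2,3) pred_inf_cl_percolation pred_conn_percolation)

lemma unique_zero_one:
  "(AE \<omega> in percolation E p. \<not> unique_infinite_cluster (carrier G) E \<omega>) \<or>
   (AE \<omega> in percolation E p. unique_infinite_cluster (carrier G) E \<omega>)"
proof (rule zero_one)
  show "Measurable.pred (percolation E p) (\<lambda>\<omega>. unique_infinite_cluster (carrier G) E \<omega>)"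
    unfolding unique_iff_several_cl
    by (intro pred_intros_logic(3) pred_intros_logic(2) pred_ex_inf_cl pred_several_cl)
qed (simp add: unique_iff_several_cl ex_inf_cl_shift several_cl_shift)

text \<open>For every \<open>n\<close>, connection of the identity to some point of index at least
  \<open>n\<close> has probability at least \<open>c\<close>. These events decrease to the event
  that the cluster is infinite.\<close>

lemma measure_inf_cl_ge:
  assumes c: "\<And>y. y \<in> carrier G \<Longrightarrow> c \<le> two_point (carrier G) E p \<one> y"
  shows "c \<le> measure (percolation E p) {\<omega> \<in> space (percolation E p). inf_cl \<omega> \<one>}"
proof -
  let ?P = "percolation E p"
  interpret prob_space ?P by (rule prob_space_percolation)
  let ?A = "\<lambda>n. {\<omega> \<in> space ?P. \<exists>m. n \<le> m \<and> conn \<omega> \<one> (en m)}"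
  have A: "?A n \<in> sets ?P" for n
    unfolding pred_def[symmetric] by (intro pred_intros_countable(2) pred_intros_conj1' pred_conn_percolation)
  have "c \<le> prob (?A n)" for n
  proof -
    have "c \<le> prob {\<omega> \<in> space ?P. conn \<omega> \<one> (en n)}"
      using c[of "en n"] by (simp add: two_point_eq)
    also have "\<dots> \<le> prob (?A n)"
      by (rule finite_measure_mono[OF _ A]) auto
    finally show ?thesis .
  qed
  moreover have "(\<lambda>n. prob (?A n)) \<longlonglongrightarrow> prob (\<Inter>n. ?A n)"
  proof (rule finite_Lim_measure_decseq)
    show "decseq ?A" unfolding decseq_def by (auto intro: order_trans)
  qed (use A in blast)
  ultimately have "c \<le> prob (\<Inter>n. ?A n)" by (intro LIMSEQ_le_const) auto
  also have "(\<Inter>n. ?A n) = {\<omega> \<in> space ?P. inf_cl \<omega> \<one>}"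
    by (auto simp: inf_cl_def infinite_iff_en)
  finally show ?thesis .
qed

text \<open>By the zero-one law it suffices to exclude two almost sure events at \<open>r\<close>:
  several infinite clusters, by the picked cluster, and none, because the lower configuration
  already has an infinite cluster with positive probability.\<close>

theorem uniqueness_above_long_range_order:
  assumes p: "0 \<le> p" "p < r" "r \<le> 1" and c: "0 < c"
    and lro: "\<And>x y. x \<in> carrier G \<Longrightarrow> y \<in> carrier G \<Longrightarrow> c \<le> two_point (carrier G) E p x y"
  shows "AE \<omega> in percolation E r. unique_infinite_cluster (carrier G) E \<omega>"
proof -
  \<comment> \<open>The solution of \<open>(1 - p) * (1 - q) = 1 - r\<close>: an edge is closed at
    \<open>r\<close> iff it is closed at both levels.\<close>
  define q where "q = (r - p) / (1 - p)"
  have q: "0 < q" "q \<le> 1" using p by (auto simp: q_def divide_simps)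
  have "(1 - p) * (1 - q) = 1 - r" using p by (simp add: q_def field_simps)
  then have r: "r = 1 - (1 - p) * (1 - q)" by simp
  interpret sprinkled G S p q c
    using q c lro by unfold_locales (simp_all add: tau_eq)
  have hi: "distr (two_level p q) (percolation E r) (\<lambda>w. restrict (hi w) E) = percolation E r"
    unfolding r using p q by (intro distr_hi) auto
  have AE_hi: "AE w in two_level p q. Q (restrict (hi w) E)" if "AE \<omega> in percolation E r. Q \<omega>" for Q
    by (rule AE_distrD[OF measurable_hi[of p q r]]) (simp only: hi that)
  have "\<not> (AE \<omega> in percolation E r. several_cl \<omega>)"
  proof
    assume "AE \<omega> in percolation E r. several_cl \<omega>"
    from AE_hi[OF this] have "AE w in two_level p q. several_cl (hi w)"
      by (simp add: several_cl_def conn_restrict inf_cl_restrict)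
    then show False using not_AE_several_cl by blast
  qed
  then have "AE \<omega> in percolation E r. \<not> several_cl \<omega>"
    using zero_one[OF pred_several_cl several_cl_shift] by blast
  moreover have "\<not> (AE \<omega> in percolation E r. \<not> (\<exists>x\<in>carrier G. inf_cl \<omega> x))"
  proof
    assume "AE \<omega> in percolation E r. \<not> (\<exists>x\<in>carrier G. inf_cl \<omega> x)"
    from AE_hi[OF this] have "AE w in two_level p q. \<not> inf_cl (fst w) \<one>"
    proof (rule AE_mp, intro AE_I2 impI notI)
      fix w assume "\<not> (\<exists>x\<in>carrier G. inf_cl (restrict (hi w) E) x)" "inf_cl (fst w) \<one>"
      moreover from this(2) have "inf_cl (hi w) \<one>" by (rule inf_cl_mono) (simp add: hi_def)
      ultimately show False by (simp add: inf_cl_restrict)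
    qed
    moreover have S: "{\<omega> \<in> space (percolation E p). \<not> inf_cl \<omega> \<one>} \<in> sets (percolation E p)"
      unfolding pred_def[symmetric] by (intro pred_intros_logic(2) pred_inf_cl_percolation)
    ultimately have "AE \<omega> in distr (two_level p q) (percolation E p) fst. \<not> inf_cl \<omega> \<one>"
      by (intro AE_distr_iff[OF measurable_fst2 S, THEN iffD2])
    then have AE0: "AE \<omega> in percolation E p. \<not> inf_cl \<omega> \<one>" unfolding distr_fst .
    interpret P: prob_space "percolation E p" by (rule prob_space_percolation)
    have S': "{\<omega> \<in> space (percolation E p). inf_cl \<omega> \<one>} \<in> sets (percolation E p)"
      unfolding pred_def[symmetric] by (rule pred_inf_cl_percolation)
    have "P.prob {\<omega> \<in> space (percolation E p). inf_cl \<omega> \<one>} = 0"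
      unfolding P.prob_eq_0[OF S'] using AE0 by (rule AE_mp) (rule AE_I2, simp)
    then show False using measure_inf_cl_ge[of c p] lro c by simp
  qed
  then have "AE \<omega> in percolation E r. \<exists>x\<in>carrier G. inf_cl \<omega> x"
    using zero_one[OF pred_ex_inf_cl ex_inf_cl_shift] by blast
  ultimately show ?thesis
    unfolding unique_iff_several_cl by (rule AE_conjI[rotated])
qed

end

context cayley
begin

section \<open>Thinning a unique infinite cluster\<close>

text \<open>The index of the first hit is invariant under left translation because \<open>en i\<close> is multiplied from the
  right. This makes the relation \<open>linked\<close> below equivariant.\<close>

definition first_hit :: "('a set \<Rightarrow> bool) \<Rightarrow> 'a \<Rightarrow> nat \<Rightarrow> bool" where
  "first_hit \<omega> x i \<longleftrightarrow> inf_cl \<omega> (x \<otimes> en i) \<and> (\<forall>k<i. \<not> inf_cl \<omega> (x \<otimes> en k))"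

text \<open>The targets are chosen by the unthinned level \<open>fst w\<close>, whereas the
  connection between them is required in the thinned configuration \<open>lo w\<close>. Hence the
  relation tends to hold as the thinning disappears, but its decay is that of the smaller
  parameter.\<close>

definition linked :: "('a set \<Rightarrow> bool) \<times> ('a set \<Rightarrow> bool) \<Rightarrow> 'a \<Rightarrow> 'a \<Rightarrow> bool" where
  "linked w x y \<longleftrightarrow> (\<exists>i j. first_hit (fst w) x i \<and> first_hit (fst w) y j \<and> conn (lo w) (x \<otimes> en i) (y \<otimes> en j))"

definition link_kernel :: "real \<Rightarrow> real \<Rightarrow> 'a \<Rightarrow> 'a \<Rightarrow> real" where
  "link_kernel p q x y = (\<integral>w. of_bool (linked w x y) \<partial>two_level p q)"

lemma first_hit_unique: "first_hit \<omega> x i \<Longrightarrow> first_hit \<omega> x j \<Longrightarrow> i = j"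
  unfolding first_hit_def by (metis linorder_neqE_nat)

lemma ex_first_hit:
  assumes "inf_cl \<omega> (x \<otimes> en i)"
  obtains k where "k \<le> i" "first_hit \<omega> x k"
proof
  show "(LEAST k. inf_cl \<omega> (x \<otimes> en k)) \<le> i" by (rule Least_le) (rule assms)
  show "first_hit \<omega> x (LEAST k. inf_cl \<omega> (x \<otimes> en k))"
    unfolding first_hit_def using LeastI[of "\<lambda>k. inf_cl \<omega> (x \<otimes> en k)", OF assms] not_less_Least by blast
qed

lemma pred_first_hit:
  assumes F: "\<And>e. e \<in> E \<Longrightarrow> Measurable.pred K (\<lambda>w. F w e)"
  shows "Measurable.pred K (\<lambda>w. first_hit (F w) x i)"
proof -
  have "Measurable.pred K (\<lambda>w. \<forall>k\<in>{..<i}. \<not> inf_cl (F w) (x \<otimes> en k))"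
    by (intro pred_Ball_countable pred_intros_logic(2) pred_inf_cl F) simp
  then have *: "Measurable.pred K (\<lambda>w. \<forall>k<i. \<not> inf_cl (F w) (x \<otimes> en k))"
    by (simp only: Ball_def lessThan_iff)
  have "Measurable.pred K (\<lambda>w. inf_cl (F w) (x \<otimes> en i))" by (rule pred_inf_cl[OF F])
  then show ?thesis unfolding first_hit_def using * by (rule pred_intros_logic(3))
qed

lemma pred_linked: "Measurable.pred (two_level p q) (\<lambda>w. linked w x y)"
  unfolding linked_def
  by (intro pred_intros_countable(2) pred_intros_logic(3) pred_first_hit pred_conn pred_fst pred_lo)

lemma integrable_linked: "integrable (two_level p q) (\<lambda>w. of_bool (linked w x y) :: real)"
proof -
  interpret prob_space "two_level p q" by (rule prob_space_two_level)
  show ?thesis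
    by (rule integrable_const_bound[where B=1, OF AE_I2 borel_of_bool[OF pred_linked]]) simp
qed

lemma linked_sym: "linked w x y \<Longrightarrow> linked w y x"
  unfolding linked_def using conn_sym by blast

lemma linked_trans:
  assumes "linked w x y" "linked w y z"
  shows "linked w x z"
proof -
  obtain i j j' k where *: "first_hit (fst w) x i" "first_hit (fst w) y j" "conn (lo w) (x \<otimes> en i) (y \<otimes> en j)"
    "first_hit (fst w) y j'" "first_hit (fst w) z k" "conn (lo w) (y \<otimes> en j') (z \<otimes> en k)"
    using assms unfolding linked_def by blast
  have "j' = j" by (rule first_hit_unique[OF *(4,2)])
  then have "conn (lo w) (x \<otimes> en i) (z \<otimes> en k)" using *(3,6) conn_trans by blast
  then show ?thesis using *(1,5) unfolding linked_def by blast
qed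

lemma psd_link_kernel: "psd_kernel (carrier G) (link_kernel p q)"
proof
  fix x y
  have "linked w x y \<longleftrightarrow> linked w y x" for w using linked_sym by blast
  then show "link_kernel p q x y = link_kernel p q y x" by (simp add: link_kernel_def)
next
  fix a :: "(real \<times> 'a) list"
  have "form (link_kernel p q) a a = (\<integral>w. form (\<lambda>x y. of_bool (linked w x y)) a a \<partial>two_level p q)"
    unfolding link_kernel_def[abs_def] by (rule form_integral(2)[OF integrable_linked])
  also have "0 \<le> \<dots>"
  proof (rule integral_nonneg_AE, intro AE_I2)
    fix w
    have "0 \<le> form (\<lambda>x y. of_bool (linked w x y) * 1) a a"
      by (rule per_form_nonneg) (auto intro: linked_sym linked_trans)
    then show "0 \<le> form (\<lambda>x y. of_bool (linked w x y)) a a" by simp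
  qed
  finally show "0 \<le> form (link_kernel p q) a a" .
qed

lemma first_hit_shift:
  assumes "g \<in> carrier G" "x \<in> carrier G"
  shows "first_hit (shift g \<omega>) x i \<longleftrightarrow> first_hit \<omega> (g \<otimes> x) i"
  unfolding first_hit_def using assms by (simp add: inf_cl_shift m_assoc)

lemma conn_lo_shift2:
  assumes "g \<in> carrier G" "x \<in> carrier G" "y \<in> carrier G"
  shows "conn (lo (shift2 g w)) x y \<longleftrightarrow> conn (lo w) (g \<otimes> x) (g \<otimes> y)"
proof -
  have "conn (lo (shift2 g w)) x y \<longleftrightarrow> conn (shift g (lo w)) x y"
    by (rule conn_cong) (simp add: lo_def shift2_def shift_def)
  then show ?thesis by (simp add: conn_shift assms)
qed

lemma link_kernel_invariant:
  assumes g: "g \<in> carrier G" and x: "x \<in> carrier G" and y: "y \<in> carrier G"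
  shows "link_kernel p q (g \<otimes> x) (g \<otimes> y) = link_kernel p q x y"
proof -
  have "linked (shift2 g w) x y \<longleftrightarrow> linked w (g \<otimes> x) (g \<otimes> y)" for w
    using g x y by (simp add: linked_def shift2_def[of g, symmetric] first_hit_shift conn_lo_shift2 m_assoc)
      (simp add: shift2_def first_hit_shift)
  then have "link_kernel p q (g \<otimes> x) (g \<otimes> y) = (\<integral>w. of_bool (linked (shift2 g w) x y) \<partial>two_level p q)"
    by (simp add: link_kernel_def)
  also have "\<dots> = (\<integral>w. of_bool (linked w x y) \<partial>distr (two_level p q) (two_level p q) (shift2 g))"
    by (rule integral_distr[symmetric, OF measurable_shift2[OF g] borel_of_bool[OF pred_linked]])
  also have "\<dots> = link_kernel p q x y" by (simp add: distr_shift2[OF g] link_kernel_def)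
  finally show ?thesis .
qed

lemma two_point_invariant:
  assumes g: "g \<in> carrier G" and x: "x \<in> carrier G" and y: "y \<in> carrier G"
  shows "two_point (carrier G) E p (g \<otimes> x) (g \<otimes> y) = two_point (carrier G) E p x y"
proof -
  have "cluster_kernel p p (\<lambda>w x. 1) (inv (inv g) \<otimes> x) (inv (inv g) \<otimes> y) = cluster_kernel p p (\<lambda>w x. 1) x y"
    using cluster_kernel_shift[OF inv_closed[OF g] cluster_fun_const[of 1 1] x y, of p p] by simp
  then show ?thesis using g x y by (simp add: tau_eq)
qed

lemma ex_finite_path:
  assumes "conn \<omega> x y"
  shows "\<exists>F. finite F \<and> F \<subseteq> E \<and> (\<forall>e\<in>F. \<omega> e) \<and> conn (\<lambda>e. e \<in> F) x y"
  using assms unfolding conn_def[of \<omega>]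
proof (induction rule: rtrancl_induct)
  case base
  show ?case by (intro exI[of _ "{}"]) simp
next
  case (step y z)
  then obtain F where F: "finite F" "F \<subseteq> E" "\<forall>e\<in>F. \<omega> e" "conn (\<lambda>e. e \<in> F) x y" by blast
  have yz: "{y, z} \<in> E" "\<omega> {y, z}" using step.hyps(2) by (auto simp: adj_def)
  have "conn (\<lambda>e. e \<in> insert {y, z} F) x y" using F(4) by (rule conn_mono) simp
  moreover have "conn (\<lambda>e. e \<in> insert {y, z} F) y z" using yz(1) by (rule conn_edge) simp
  ultimately have "conn (\<lambda>e. e \<in> insert {y, z} F) x z" by (rule conn_trans)
  then show ?case using F yz by (intro exI[of _ "insert {y, z} F"]) simp
qed

text \<open>Finitely many edges carry a path between two given points of the unique infinite cluster, and
  these survive a thinning with retention probability close to 1.\<close>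

lemma link_kernel_tendsto_1:
  assumes unique: "AE \<omega> in percolation E p. unique_infinite_cluster (carrier G) E \<omega>"
    and q: "\<And>n. 0 \<le> q n" "\<And>n. q n \<le> 1" "q \<longlonglongrightarrow> 1"
    and x: "x \<in> carrier G" and y: "y \<in> carrier G"
  shows "(\<lambda>n. link_kernel p (q n) x y) \<longlonglongrightarrow> 1"
proof -
  let ?P = "percolation E p"
  interpret P: prob_space ?P by (rule prob_space_percolation)
  \<comment> \<open>The conditional probability of a link given the unthinned configuration. It
    converges to 1 for almost every such configuration, and dominated convergence does the
    rest.\<close>
  define h :: "nat \<Rightarrow> ('a set \<Rightarrow> bool) \<Rightarrow> real" where "h n \<omega> = (\<integral>\<theta>. of_bool (linked (\<omega>, \<theta>) x y) \<partial>percolation E (q n))" for n \<omega>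
  have fubini: "link_kernel p (q n) x y = (\<integral>\<omega>. h n \<omega> \<partial>?P)" "h n \<in> borel_measurable ?P" for n
  proof -
    interpret R: prob_space "percolation E (q n)" by (rule prob_space_percolation)
    interpret PR: pair_sigma_finite ?P "percolation E (q n)" ..
    have int: "integrable (?P \<Otimes>\<^sub>M percolation E (q n)) (\<lambda>w. of_bool (linked w x y) :: real)"
      using integrable_linked unfolding two_level_def .
    show "link_kernel p (q n) x y = (\<integral>\<omega>. h n \<omega> \<partial>?P)"
      unfolding link_kernel_def two_level_def h_def by (rule PR.integral_fst'[OF int, symmetric])
    have "(\<lambda>(\<omega>, \<theta>). of_bool (linked (\<omega>, \<theta>) x y) :: real) \<in> borel_measurable (?P \<Otimes>\<^sub>M percolation E (q n))"
      using borel_measurable_integrable[OF int] by (simp only: split_def prod.collapse)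
    then show "h n \<in> borel_measurable ?P"
      unfolding h_def[abs_def] by (rule R.borel_measurable_lebesgue_integral)
  qed
  have h_bounds: "0 \<le> h n \<omega>" "h n \<omega> \<le> 1" for n \<omega>
  proof -
    interpret R: prob_space "percolation E (q n)" by (rule prob_space_percolation)
    show "0 \<le> h n \<omega>" unfolding h_def by (rule integral_nonneg_AE) simp
    show "h n \<omega> \<le> 1"
    \<comment> \<open>The bound is needed for every \<open>\<omega>\<close>, also for those whose
      section is not known to be measurable; the integral is then 0 by convention.\<close>
    proof (cases "integrable (percolation E (q n)) (\<lambda>\<theta>. of_bool (linked (\<omega>, \<theta>) x y) :: real)")
      case True
      then have "h n \<omega> \<le> (\<integral>\<theta>. 1 \<partial>percolation E (q n))"
        unfolding h_def by (intro integral_mono) auto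
      then show ?thesis by (simp add: R.prob_space)
    qed (simp add: h_def not_integrable_integral_eq)
  qed
  have "AE \<omega> in ?P. (\<lambda>n. h n \<omega>) \<longlonglongrightarrow> 1"
  proof (rule AE_mp[OF unique], intro AE_I2 impI)
    fix \<omega> assume sp: "\<omega> \<in> space ?P" and u: "unique_infinite_cluster (carrier G) E \<omega>"
    then obtain z where z: "z \<in> carrier G" "inf_cl \<omega> z" by (auto simp: unique_infinite_cluster_iff)
    have hit: "\<exists>i. first_hit \<omega> x i" if x: "x \<in> carrier G" for x
    proof -
      obtain i where "inv x \<otimes> z = en i" using en_surj[of "inv x \<otimes> z"] x z by auto
      then have "x \<otimes> en i = z" using x z by (metis inv_solve_left en_closed)
      then show ?thesis using ex_first_hit[of \<omega> x i] z by metis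
    qed
    obtain i j where ij: "first_hit \<omega> x i" "first_hit \<omega> y j" using hit[OF x] hit[OF y] by blast
    then have "conn \<omega> (x \<otimes> en i) (y \<otimes> en j)"
      using u x y unfolding unique_infinite_cluster_iff first_hit_def by simp
    from ex_finite_path[OF this] obtain F where F: "finite F" "F \<subseteq> E" "\<forall>e\<in>F. \<omega> e"
      "conn (\<lambda>e. e \<in> F) (x \<otimes> en i) (y \<otimes> en j)" by blast
    have linked: "linked (\<omega>, \<theta>) x y" if "\<forall>e\<in>F. \<theta> e" for \<theta>
    proof -
      have "conn (lo (\<omega>, \<theta>)) (x \<otimes> en i) (y \<otimes> en j)"
        using F(4) by (rule conn_mono) (use F(3) that in \<open>simp add: lo_def\<close>)
      then show ?thesis using ij unfolding linked_def by auto
    qed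
    have lower: "q n ^ card F \<le> h n \<omega>" for n
    proof -
      let ?R = "percolation E (q n)"
      interpret R: prob_space ?R by (rule prob_space_percolation)
      have meas: "Measurable.pred ?R (\<lambda>\<theta>. linked (\<omega>, \<theta>) x y)"
      proof (rule measurable_compose[OF measurable_Pair1'])
        show "\<omega> \<in> space ?P" by (rule sp)
        show "Measurable.pred (?P \<Otimes>\<^sub>M ?R) (\<lambda>w. linked w x y)"
          using pred_linked unfolding two_level_def .
      qed
      have "emeasure ?R {\<theta> \<in> space ?R. \<forall>e\<in>F. \<theta> e \<in> {True}} = (\<Prod>e\<in>F. emeasure (bernoulli_pmf (q n)) {True})"
        unfolding percolation_bits by (rule emeasure_bits_cylinder[OF F(1,2)])
      also have "\<dots> = ennreal (q n ^ card F)"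
        using q by (simp add: emeasure_pmf_single ennreal_power)
      finally have "q n ^ card F = R.prob {\<theta> \<in> space ?R. \<forall>e\<in>F. \<theta> e}"
        using q by (simp add: R.emeasure_eq_measure)
      also have "R.prob {\<theta> \<in> space ?R. \<forall>e\<in>F. \<theta> e} \<le> R.prob {\<theta> \<in> space ?R. linked (\<omega>, \<theta>) x y}"
      proof (rule R.finite_measure_mono)
        show "{\<theta> \<in> space ?R. linked (\<omega>, \<theta>) x y} \<in> sets ?R" using meas by (simp only: pred_def)
      qed (use linked in blast)
      also have "\<dots> = h n \<omega>"
        unfolding h_def by (rule integral_of_bool[OF meas, symmetric])
      finally show ?thesis .
    qed
    show "(\<lambda>n. h n \<omega>) \<longlonglongrightarrow> 1"
    proof (rule tendsto_sandwich[OF _ _ _ tendsto_const])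
      show "(\<lambda>n. q n ^ card F) \<longlonglongrightarrow> 1" using tendsto_power[OF q(3), of "card F"] by simp
    qed (use lower h_bounds in auto)
  qed
  then have "(\<lambda>n. \<integral>\<omega>. h n \<omega> \<partial>?P) \<longlonglongrightarrow> (\<integral>\<omega>. 1 \<partial>?P)"
    using h_bounds by (intro integral_dominated_convergence[where w="\<lambda>_. 1"] fubini(2)) auto
  then show ?thesis by (simp add: fubini(1) P.prob_space)
qed

lemma link_kernel_diag:
  assumes unique: "AE \<omega> in percolation E p. unique_infinite_cluster (carrier G) E \<omega>"
    and x: "x \<in> carrier G"
  shows "link_kernel p q x x = 1"
proof -
  interpret prob_space "two_level p q" by (rule prob_space_two_level)
  have "AE w in two_level p q. of_bool (linked w x x) = (1 :: real)"
  proof (rule AE_mp[OF AE_fst[OF unique]], intro AE_I2 impI)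
    fix w :: "('a set \<Rightarrow> bool) \<times> ('a set \<Rightarrow> bool)"
    assume "unique_infinite_cluster (carrier G) E (fst w)"
    then obtain z where z: "z \<in> carrier G" "inf_cl (fst w) z" by (auto simp: unique_infinite_cluster_iff)
    obtain i where "inv x \<otimes> z = en i" using en_surj[of "inv x \<otimes> z"] x z by auto
    then have "x \<otimes> en i = z" using x z by (metis inv_solve_left en_closed)
    then obtain k where "first_hit (fst w) x k" using ex_first_hit[of "fst w" x i] z by metis
    then have "linked w x x" unfolding linked_def using conn_refl by blast
    then show "of_bool (linked w x x) = (1 :: real)" by simp
  qed
  then have "link_kernel p q x x = (\<integral>w. 1 \<partial>two_level p q)"
    unfolding link_kernel_def
    by (intro integral_cong_AE borel_of_bool pred_linked borel_measurable_const)
  then show ?thesis by (simp add: prob_space)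
qed

lemma prob_no_hit_tendsto_0:
  assumes unique: "AE \<omega> in percolation E p. unique_infinite_cluster (carrier G) E \<omega>"
  shows "(\<lambda>n. measure (percolation E p) {\<omega> \<in> space (percolation E p). \<forall>k<n. \<not> inf_cl \<omega> (en k)}) \<longlonglongrightarrow> 0"
proof -
  let ?P = "percolation E p"
  let ?A = "\<lambda>n. {\<omega> \<in> space ?P. \<forall>k\<in>{..<n}. \<not> inf_cl \<omega> (en k)}"
  interpret prob_space ?P by (rule prob_space_percolation)
  have A: "?A n \<in> sets ?P" for n
    unfolding pred_def[symmetric] by (intro pred_Ball_countable pred_intros_logic(2) pred_inf_cl_percolation) simp
  have "(\<lambda>n. prob (?A n)) \<longlonglongrightarrow> prob (\<Inter>n. ?A n)"
  proof (rule finite_Lim_measure_decseq)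
    show "decseq ?A" unfolding decseq_def by auto
  qed (use A in blast)
  moreover have "prob (\<Inter>n. ?A n) = 0"
  proof -
    have I: "(\<Inter>n. ?A n) \<in> sets ?P" by (rule sets.countable_INT) (blast intro: A, simp)
    have "AE \<omega> in ?P. \<omega> \<notin> (\<Inter>n. ?A n)"
    proof (rule AE_mp[OF unique], intro AE_I2 impI notI)
      fix \<omega> assume "unique_infinite_cluster (carrier G) E \<omega>" and \<omega>: "\<omega> \<in> (\<Inter>n. ?A n)"
      then obtain z where "z \<in> carrier G" "inf_cl \<omega> z" by (auto simp: unique_infinite_cluster_iff)
      moreover from this obtain k where "z = en k" using en_surj by blast
      moreover have "\<not> inf_cl \<omega> (en k)" using INT_D[OF \<omega>, of "Suc k"] by simp
      ultimately show False by simp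
    qed
    then show ?thesis unfolding prob_eq_0[OF I] .
  qed
  moreover have "?A n = {\<omega> \<in> space ?P. \<forall>k<n. \<not> inf_cl \<omega> (en k)}" for n by auto
  ultimately show ?thesis by simp
qed

text \<open>Choose \<open>n\<close> such that a point has no hit among its first \<open>n\<close>
  candidates with probability below 1/8. Otherwise a link connects one of \<open>n * n\<close> pairs
  in percolation at \<open>p * q\<close>. So a link of probability at least 1/2 forces one of these
  pairs to have a two-point function of at least \<open>\<epsilon>\<close>, and this puts
  \<open>g\<close> into one of finitely many translates of a finite set.\<close>

lemma link_kernel_vanishes:
  assumes unique: "AE \<omega> in percolation E p. unique_infinite_cluster (carrier G) E \<omega>"
    and pq: "0 \<le> p" "p \<le> 1" "0 \<le> q" "q \<le> 1"
    and vanish: "\<And>\<epsilon>. 0 < \<epsilon> \<Longrightarrow> finite {g \<in> carrier G. \<epsilon> \<le> two_point (carrier G) E (p * q) \<one> g}"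
  shows "finite {g \<in> carrier G. 1 / 2 \<le> link_kernel p q \<one> g}"
proof -
  let ?P = "percolation E p" and ?M = "two_level p q" and ?t = "two_point (carrier G) E (p * q)"
  interpret P: prob_space ?P by (rule prob_space_percolation)
  interpret prob_space ?M by (rule prob_space_two_level)
  define miss where "miss n x \<omega> \<longleftrightarrow> (\<forall>k<n. \<not> inf_cl \<omega> (x \<otimes> en k))" for n :: nat and x \<omega>
  have pred_miss: "Measurable.pred ?P (miss n x)" for n x
  proof -
    have "Measurable.pred ?P (\<lambda>\<omega>. \<forall>k\<in>{..<n}. \<not> inf_cl \<omega> (x \<otimes> en k))"
      by (intro pred_Ball_countable pred_intros_logic(2) pred_inf_cl_percolation) simp
    then show ?thesis unfolding miss_def[abs_def] by (simp only: Ball_def lessThan_iff)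
  qed
  obtain n where n: "P.prob {\<omega> \<in> space ?P. miss n \<one> \<omega>} < 1 / 8"
    using order_tendstoD(2)[OF prob_no_hit_tendsto_0[OF unique], of "1 / 8"]
    by (auto simp: eventually_sequentially miss_def)
  have miss_eq: "(\<integral>w. of_bool (miss n x (fst w)) \<partial>?M) = P.prob {\<omega> \<in> space ?P. miss n \<one> \<omega>}"
    if x: "x \<in> carrier G" for x
  proof -
    have sh: "miss n \<one> (shift x \<omega>) \<longleftrightarrow> miss n x \<omega>" for \<omega>
      using x by (simp add: miss_def inf_cl_shift)
    have "(\<integral>w. of_bool (miss n x (fst w)) \<partial>?M) = (\<integral>\<omega>. of_bool (miss n x \<omega>) \<partial>distr ?M ?P fst :: real)"
      by (rule integral_distr[symmetric, OF measurable_fst2 borel_of_bool[OF pred_miss]])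
    also have "\<dots> = P.prob {\<omega> \<in> space ?P. miss n x \<omega>}"
      unfolding distr_fst by (rule integral_of_bool[OF pred_miss])
    also have "{\<omega> \<in> space ?P. miss n x \<omega>} = shift x -` {\<omega> \<in> space ?P. miss n \<one> \<omega>} \<inter> space ?P"
      using shift_closed[OF x] sh by blast
    also have "P.prob \<dots> = P.prob {\<omega> \<in> space ?P. miss n \<one> \<omega>}"
      using pred_miss[of n \<one>] by (intro measure_shift[OF x]) (simp only: pred_def)
    finally show ?thesis .
  qed
  have lo_eq: "(\<integral>w. of_bool (conn (lo w) x y) \<partial>?M) = ?t x y" if xy: "x \<in> carrier G" "y \<in> carrier G" for x y
  proof -
    have "(\<integral>w. of_bool (conn (lo w) x y) \<partial>?M) = (\<integral>w. of_bool (conn (restrict (lo w) E) x y) \<partial>?M :: real)"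
      by (simp add: conn_restrict)
    also have "\<dots> = (\<integral>\<omega>. of_bool (conn \<omega> x y) \<partial>distr ?M (percolation E (p * q)) (\<lambda>w. restrict (lo w) E))"
      by (rule integral_distr[symmetric, OF measurable_lo borel_of_bool[OF pred_conn_percolation]])
    also have "\<dots> = ?t x y"
      unfolding distr_lo[OF pq] two_point_eq[OF xy] by (rule integral_of_bool[OF pred_conn_percolation])
    finally show ?thesis .
  qed
  \<comment> \<open>The \<open>n * n\<close> pairs may contribute less than 1/4, which together with
    the two failures of 1/8 stays below 1/2. The added 1 makes the inequality strict and covers
    \<open>n = 0\<close>.\<close>
  define \<epsilon> where "\<epsilon> = 1 / (4 * (real n * real n + 1))"
  have \<epsilon>: "0 < \<epsilon>" by (simp add: \<epsilon>_def add_nonneg_pos)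
  have int: "integrable ?M (\<lambda>w. of_bool (Q w) :: real)" if "Measurable.pred ?M Q" for Q
    by (rule integrable_const_bound[where B=1, OF AE_I2 borel_of_bool[OF that]]) simp
  have pm: "Measurable.pred ?M (\<lambda>w. miss n x (fst w))" for x
    by (rule measurable_compose[OF measurable_fst2 pred_miss])
  have pl: "Measurable.pred ?M (\<lambda>w. conn (lo w) x y)" for x y
    by (intro pred_conn pred_lo)
  have "\<exists>i<n. \<exists>j<n. \<epsilon> \<le> ?t (en i) (g \<otimes> en j)" if g: "g \<in> carrier G" and ge: "1 / 2 \<le> link_kernel p q \<one> g" for g
  proof (rule ccontr)
    assume "\<not> (\<exists>i<n. \<exists>j<n. \<epsilon> \<le> ?t (en i) (g \<otimes> en j))"
    then have small: "?t (en i) (g \<otimes> en j) \<le> \<epsilon>" if "i < n" "j < n" for i j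
      using that by (meson linear)
    have "link_kernel p q \<one> g \<le> (\<integral>w. of_bool (miss n \<one> (fst w)) + of_bool (miss n g (fst w)) +
        (\<Sum>i<n. \<Sum>j<n. of_bool (conn (lo w) (en i) (g \<otimes> en j))) \<partial>?M)"
      unfolding link_kernel_def
    proof (rule integral_mono[OF integrable_linked])
      show "integrable ?M (\<lambda>w. of_bool (miss n \<one> (fst w)) + of_bool (miss n g (fst w)) +
          (\<Sum>i<n. \<Sum>j<n. of_bool (conn (lo w) (en i) (g \<otimes> en j))) :: real)"
        by (intro Bochner_Integration.integrable_add Bochner_Integration.integrable_sum int pm pl)
      fix w
      let ?S = "\<Sum>i<n. \<Sum>j<n. of_bool (conn (lo w) (en i) (g \<otimes> en j)) :: real"
      have S: "0 \<le> ?S" by (intro sum_nonneg) simp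
      show "of_bool (linked w \<one> g) \<le> of_bool (miss n \<one> (fst w)) + of_bool (miss n g (fst w)) + ?S"
      proof (cases "linked w \<one> g \<and> \<not> miss n \<one> (fst w) \<and> \<not> miss n g (fst w)")
        case True
        then obtain i j where ij: "first_hit (fst w) \<one> i" "first_hit (fst w) g j"
          "conn (lo w) (\<one> \<otimes> en i) (g \<otimes> en j)" unfolding linked_def by blast
        have lt: "i < n" if hit: "first_hit (fst w) x i" and not_miss: "\<not> miss n x (fst w)" for x i
        proof -
          obtain k where k: "k < n" "inf_cl (fst w) (x \<otimes> en k)" using not_miss unfolding miss_def by blast
          obtain k' where k': "k' \<le> k" "first_hit (fst w) x k'" by (rule ex_first_hit[OF k(2)])
          have "i = k'" by (rule first_hit_unique[OF hit k'(2)])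
          then show ?thesis using k(1) k'(1) by simp
        qed
        have i: "i < n" using lt ij(1) True by blast
        have j: "j < n" using lt ij(2) True by blast
        have "1 = (of_bool (conn (lo w) (en i) (g \<otimes> en j)) :: real)" using ij(3) by simp
        also have "\<dots> \<le> (\<Sum>j<n. of_bool (conn (lo w) (en i) (g \<otimes> en j)))"
          by (rule member_le_sum) (use j in auto)
        also have "\<dots> \<le> ?S"
          by (rule member_le_sum) (use i in \<open>auto intro: sum_nonneg\<close>)
        finally show ?thesis using True by simp
      next
        case False
        then show ?thesis using S by (cases "linked w \<one> g"; cases "miss n \<one> (fst w)"; cases "miss n g (fst w)") auto
      qed
    qed
    also have "\<dots> = (\<integral>w. of_bool (miss n \<one> (fst w)) \<partial>?M) + (\<integral>w. of_bool (miss n g (fst w)) \<partial>?M) +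
        (\<Sum>i<n. \<Sum>j<n. \<integral>w. of_bool (conn (lo w) (en i) (g \<otimes> en j)) \<partial>?M)"
      by (simp only: Bochner_Integration.integral_add Bochner_Integration.integral_sum
          Bochner_Integration.integrable_add Bochner_Integration.integrable_sum int pm pl)
    also have "\<dots> \<le> 1 / 8 + 1 / 8 + (\<Sum>i<n. \<Sum>j<n. \<epsilon>)"
    proof (intro add_mono sum_mono)
      show "(\<integral>w. of_bool (miss n \<one> (fst w)) \<partial>?M) \<le> (1 / 8 :: real)"
        unfolding miss_eq[OF one_closed] using n by simp
      show "(\<integral>w. of_bool (miss n g (fst w)) \<partial>?M) \<le> (1 / 8 :: real)"
        unfolding miss_eq[OF g] using n by simp
      fix i j assume "i \<in> {..<n}" "j \<in> {..<n}"
      then show "(\<integral>w. of_bool (conn (lo w) (en i) (g \<otimes> en j)) \<partial>?M) \<le> \<epsilon>"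
        using small[of i j] g by (simp add: lo_eq)
    qed
    also have "(\<Sum>i<n. \<Sum>j<n. \<epsilon>) = (real n * real n) * \<epsilon>" by simp
    also have "\<dots> < (real n * real n + 1) * \<epsilon>" using \<epsilon> by (simp add: distrib_right)
    also have "\<dots> = 1 / 4"
    proof -
      have "real n * real n + 1 > 0" by (simp add: add_nonneg_pos)
      then show ?thesis by (simp add: \<epsilon>_def)
    qed
    finally show False using ge by simp
  qed
  \<comment> \<open>By invariance the pair \<open>en i\<close>, \<open>g \<otimes> en j\<close> has
    the same two-point function as \<open>\<one>\<close> and
    \<open>h = inv (en i) \<otimes> (g \<otimes> en j)\<close>; solving for \<open>g\<close> gives
    the two-sided translate.\<close>
  then have "{g \<in> carrier G. 1 / 2 \<le> link_kernel p q \<one> g} \<subseteq>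
      (\<Union>i<n. \<Union>j<n. (\<lambda>h. en i \<otimes> h \<otimes> inv (en j)) ` {h \<in> carrier G. \<epsilon> \<le> ?t \<one> h})"
  proof (intro subsetI, elim CollectE conjE)
    fix g assume g: "g \<in> carrier G" "1 / 2 \<le> link_kernel p q \<one> g"
      and ex: "\<And>g. g \<in> carrier G \<Longrightarrow> 1 / 2 \<le> link_kernel p q \<one> g \<Longrightarrow> \<exists>i<n. \<exists>j<n. \<epsilon> \<le> ?t (en i) (g \<otimes> en j)"
    from ex[OF g] obtain i j where ij: "i < n" "j < n" "\<epsilon> \<le> ?t (en i) (g \<otimes> en j)" by blast
    define h where "h = inv (en i) \<otimes> (g \<otimes> en j)"
    have h: "h \<in> carrier G" "en i \<otimes> h = g \<otimes> en j" using g(1) by (simp_all add: h_def m_assoc[symmetric])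
    have "\<epsilon> \<le> ?t \<one> h"
      using ij(3) two_point_invariant[of "en i" \<one> h] h by simp
    moreover have "g = en i \<otimes> h \<otimes> inv (en j)" using g(1) h(2) by (simp add: m_assoc)
    ultimately show "g \<in> (\<Union>i<n. \<Union>j<n. (\<lambda>h. en i \<otimes> h \<otimes> inv (en j)) ` {h \<in> carrier G. \<epsilon> \<le> ?t \<one> h})"
      using ij(1,2) h(1) by blast
  qed
  then show ?thesis
    by (rule finite_subset) (intro finite_UN_I finite_lessThan finite_imageI vanish[OF \<epsilon>])
qed

text \<open>The retention probability \<open>1 - 1 / (n + 2)\<close> lies strictly between 0 and 1
  for every \<open>n\<close> and tends to 1. The thinned parameter is therefore in the range where
  decay is assumed, while the kernels tend to 1.\<close>

theorem haagerup_if_vanishing_below_uniqueness: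
  assumes unique: "AE \<omega> in percolation E p. unique_infinite_cluster (carrier G) E \<omega>"
    and p: "0 < p" "p \<le> 1"
    and vanish: "\<And>r \<epsilon>. 0 < r \<Longrightarrow> r < p \<Longrightarrow> 0 < \<epsilon> \<Longrightarrow> finite {g \<in> carrier G. \<epsilon> \<le> two_point (carrier G) E r \<one> g}"
  shows "haagerup G"
proof (rule haagerup_if_positive_definite_approximation[of "\<lambda>n. link_kernel p (1 - 1 / (real n + 2))"])
  have q: "0 < 1 - 1 / (real n + 2)" "1 - 1 / (real n + 2) < 1" for n by (simp_all add: field_simps)
  have q_lim: "(\<lambda>n. 1 - 1 / (real n + 2)) \<longlonglongrightarrow> 1" by real_asymp
  show "(\<lambda>n. link_kernel p (1 - 1 / (real n + 2)) \<one> x) \<longlonglongrightarrow> 1" if "x \<in> carrier G" for x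
    using q by (intro link_kernel_tendsto_1[OF unique _ _ q_lim one_closed that]) (auto intro: less_imp_le)
  show "finite {g \<in> carrier G. 1 / 2 \<le> link_kernel p (1 - 1 / (real n + 2)) \<one> g}" for n
  proof (rule link_kernel_vanishes[OF unique])
    show "finite {g \<in> carrier G. \<epsilon> \<le> two_point (carrier G) E (p * (1 - 1 / (real n + 2))) \<one> g}" if "0 < \<epsilon>" for \<epsilon>
    proof (rule vanish[OF _ _ that])
      show "0 < p * (1 - 1 / (real n + 2))" using p(1) q(1)[of n] by simp
      show "p * (1 - 1 / (real n + 2)) < p" using mult_strict_left_mono[OF q(2)[of n] p(1)] by simp
    qed
  qed (use p q less_imp_le in auto)
qed (auto simp: countable_carrier psd_link_kernel link_kernel_invariant link_kernel_diag[OF unique])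

text \<open>Beyond a radius at which the supremum is below \<open>\<epsilon>\<close> no point
  qualifies, and balls are finite.\<close>

lemma finite_two_point_ge:
  assumes vanish: "two_point_vanishes_at_infinity (carrier G) E p" and \<epsilon>: "0 < \<epsilon>"
  shows "finite {g \<in> carrier G. \<epsilon> \<le> two_point (carrier G) E p \<one> g}"
proof -
  let ?A = "\<lambda>r. {(x, y) \<in> carrier G \<times> carrier G. graph_dist E x y > r}"
  let ?f = "\<lambda>(x, y). two_point (carrier G) E p x y"
  interpret prob_space "percolation E p" by (rule prob_space_percolation)
  have "(\<lambda>r. Sup (?f ` ?A r)) \<longlonglongrightarrow> 0"
    using vanish by (simp only: two_point_vanishes_at_infinity_def)
  from order_tendstoD(2)[OF this \<epsilon>] obtain r where r: "Sup (?f ` ?A r) < \<epsilon>"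
    by (auto simp: eventually_sequentially)
  have bdd: "bdd_above (?f ` ?A r)"
    by (rule bdd_aboveI[of _ 1]) (auto simp: two_point_def)
  have "{g \<in> carrier G. \<epsilon> \<le> two_point (carrier G) E p \<one> g} \<subseteq> (nbhd ^^ r) {\<one>}"
  proof safe
    fix g assume g: "g \<in> carrier G" "\<epsilon> \<le> two_point (carrier G) E p \<one> g"
    have "graph_dist E \<one> g \<le> r"
    proof (rule ccontr)
      assume "\<not> graph_dist E \<one> g \<le> r"
      then have "?f (\<one>, g) \<in> ?f ` ?A r" using g(1) by (intro imageI) simp
      from cSup_upper[OF this bdd] show False using r g(2) by simp
    qed
    moreover have "(\<one>, g) \<in> adj E ^^ graph_dist E \<one> g"
    proof -
      obtain n where "(\<one>, g) \<in> adj E ^^ n"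
        using connected[OF one_closed g(1)] unfolding rtrancl_power by blast
      then show ?thesis unfolding graph_dist_def by (rule LeastI)
    qed
    ultimately show "g \<in> (nbhd ^^ r) {\<one>}"
      using relpow_in_nbhd_pow nbhd_pow_mono by blast
  qed
  then show ?thesis by (rule finite_subset) (simp add: finite_nbhd_pow)
qed

section \<open>The parameters 1 and 0, and the conclusion\<close>

lemma unique_at_1: "AE \<omega> in percolation E 1. unique_infinite_cluster (carrier G) E \<omega>"
proof -
  have "pmf (bernoulli_pmf 1) False = 0" by simp
  then have "False \<notin> set_pmf (bernoulli_pmf 1)" by (simp only: set_pmf_iff not_not)
  then have "AE b in bernoulli_pmf 1. b" unfolding AE_measure_pmf_iff by (metis (full_types))
  then have "AE \<omega> in percolation E 1. \<omega> e" if "e \<in> E" for e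
    unfolding percolation_def using that
    by (intro AE_PiM_component[where P="\<lambda>b. b"] measure_pmf.prob_space_axioms)
  then have "AE \<omega> in percolation E 1. \<forall>e\<in>E. \<omega> e"
    by (intro AE_ball_countable' countable_E)
  then show ?thesis
  proof (rule AE_mp, intro AE_I2 impI)
    fix \<omega> assume all: "\<forall>e\<in>E. \<omega> e"
    have conn: "conn \<omega> x y" if "x \<in> carrier G" "y \<in> carrier G" for x y
    proof -
      have "{e \<in> E. \<omega> e} = E" using all by blast
      then show ?thesis using connected[OF that] by (simp add: conn_def)
    qed
    have "{y \<in> carrier G. conn \<omega> \<one> y} = carrier G" using conn by blast
    then have "inf_cl \<omega> \<one>" using infinite_carrier by (simp add: inf_cl_def)
    then show "unique_infinite_cluster (carrier G) E \<omega>"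
      unfolding unique_infinite_cluster_iff using conn by blast
  qed
qed

lemma not_unique_at_0: "AE \<omega> in percolation E 0. \<not> unique_infinite_cluster (carrier G) E \<omega>"
proof -
  have "pmf (bernoulli_pmf 0) True = 0" by simp
  then have "True \<notin> set_pmf (bernoulli_pmf 0)" by (simp only: set_pmf_iff not_not)
  then have "AE b in bernoulli_pmf 0. \<not> b" unfolding AE_measure_pmf_iff by (metis (full_types))
  then have "AE \<omega> in percolation E 0. \<not> \<omega> e" if "e \<in> E" for e
    unfolding percolation_def using that
    by (intro AE_PiM_component[where P="\<lambda>b. \<not> b"] measure_pmf.prob_space_axioms)
  then have "AE \<omega> in percolation E 0. \<forall>e\<in>E. \<not> \<omega> e"
    by (intro AE_ball_countable' countable_E)
  then show ?thesis
  proof (rule AE_mp, intro AE_I2 impI notI)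
    fix \<omega> assume none: "\<forall>e\<in>E. \<not> \<omega> e" and "unique_infinite_cluster (carrier G) E \<omega>"
    then obtain x where x: "infinite {y \<in> carrier G. conn \<omega> x y}"
      by (auto simp: unique_infinite_cluster_iff inf_cl_def)
    have "adj {e \<in> E. \<omega> e} = {}" using none by (auto simp: adj_def)
    then have "{y \<in> carrier G. conn \<omega> x y} \<subseteq> {x}" by (auto simp: conn_def)
    then show False using x finite_subset by blast
  qed
qed

theorem uniqueness_threshold_if_not_haagerup:
  assumes not_haagerup: "\<not> haagerup G"
    and dichotomy: "\<And>p::real. 0 < p \<Longrightarrow> p < 1 \<Longrightarrow>
      two_point_vanishes_at_infinity (carrier G) E p \<longleftrightarrow>
      (INF (g, h) \<in> carrier G \<times> carrier G. two_point (carrier G) E p g h) = 0"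
  shows "uniqueness_threshold (carrier G) E < 1 \<and>
    (AE \<omega> in percolation E (uniqueness_threshold (carrier G) E). \<not> unique_infinite_cluster (carrier G) E \<omega>)"
proof -
  define A where "A = {p \<in> {0..1}. AE \<omega> in percolation E p. unique_infinite_cluster (carrier G) E \<omega>}"
  define u where "u = uniqueness_threshold (carrier G) E"
  have u: "u = Inf A" by (simp add: u_def A_def uniqueness_threshold_def)
  have one: "1 \<in> A" using unique_at_1 by (simp add: A_def)
  have bdd: "bdd_below A" by (rule bdd_belowI[of _ 0]) (simp add: A_def)
  have "0 \<le> u"
    unfolding u
  proof (rule cInf_greatest)
    show "A \<noteq> {}" using one by blast
  qed (simp add: A_def)
  moreover have "u \<le> 1" unfolding u by (rule cInf_lower[OF one bdd])
  ultimately have u01: "0 \<le> u" "u \<le> 1" .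
  have never: False if unique: "AE \<omega> in percolation E u. unique_infinite_cluster (carrier G) E \<omega>"
  proof -
    have "u \<noteq> 0"
    proof
      assume "u = 0"
      interpret prob_space "percolation E 0" by (rule prob_space_percolation)
      from not_unique_at_0 unique[unfolded \<open>u = 0\<close>] have "AE \<omega> in percolation E 0. False" by (rule AE_mp[OF _ AE_mp]) auto
      then show False by simp
    qed
    have "haagerup G"
    proof (rule haagerup_if_vanishing_below_uniqueness[OF unique])
      show "0 < u" "u \<le> 1" using u01 \<open>u \<noteq> 0\<close> by auto
      fix p \<epsilon> :: real assume p: "0 < p" "p < u" and \<epsilon>: "0 < \<epsilon>"
      let ?f = "\<lambda>(g, h). two_point (carrier G) E p g h"
      define c where "c = Inf (?f ` (carrier G \<times> carrier G))"
      have bddf: "bdd_below (?f ` (carrier G \<times> carrier G))"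
        by (rule bdd_belowI[of _ 0]) (auto simp: two_point_def)
      have c_le: "c \<le> two_point (carrier G) E p x y" if "x \<in> carrier G" "y \<in> carrier G" for x y
      proof -
        have "?f (x, y) \<in> ?f ` (carrier G \<times> carrier G)" using that by (intro imageI) simp
        from cInf_lower[OF this bddf] show ?thesis by (simp add: c_def)
      qed
      have "0 \<le> c" unfolding c_def by (rule cInf_greatest) (auto simp: two_point_def)
      moreover have "\<not> 0 < c"
      proof
        assume "0 < c"
        \<comment> \<open>Any parameter strictly between \<open>p\<close> and \<open>u\<close> will
          do: long-range order at \<open>p\<close> gives uniqueness there, below the infimum of all
          parameters with uniqueness.\<close>
        define r where "r = (p + u) / 2"
        have r: "p < r" "r < u" using p by (simp_all add: r_def)
        have "AE \<omega> in percolation E r. unique_infinite_cluster (carrier G) E \<omega>"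
          using p r u01 \<open>0 < c\<close> c_le by (intro uniqueness_above_long_range_order[of p r c]) auto
        then have "r \<in> A" using p r u01 by (simp add: A_def)
        from cInf_lower[OF this bdd] show False using r by (simp add: u)
      qed
      ultimately have "c = 0" by simp
      then have "two_point_vanishes_at_infinity (carrier G) E p"
        using dichotomy[of p] p u01 by (simp add: c_def)
      then show "finite {g \<in> carrier G. \<epsilon> \<le> two_point (carrier G) E p \<one> g}"
        using \<epsilon> by (rule finite_two_point_ge)
    qed
    then show False using not_haagerup by simp
  qed
  then have "AE \<omega> in percolation E u. \<not> unique_infinite_cluster (carrier G) E \<omega>"
    using unique_zero_one by blast
  moreover have "u \<noteq> 1" using never unique_at_1 by blast
  then have "u < 1" using u01 by simp
  ultimately show ?thesis unfolding u_def by (intro conjI)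
qed

end

theorem corollary4p7:
  fixes G :: "('a, 'b) monoid_scheme" and S :: "'a set"
  assumes "group G"
    and "infinite (carrier G)"
    and "\<not> haagerup G"
    and "finite S"
    and "S \<subseteq> carrier G"
    and "\<And>s. s \<in> S \<Longrightarrow> inv\<^bsub>G\<^esub> s \<in> S"
    and "generate G S = carrier G"
    and "\<And>p::real. 0 < p \<Longrightarrow> p < 1 \<Longrightarrow>
           two_point_vanishes_at_infinity (carrier G) (cayley_edges G S) p \<longleftrightarrow>
           (INF (g, h) \<in> carrier G \<times> carrier G. two_point (carrier G) (cayley_edges G S) p g h) = 0"
  shows "uniqueness_threshold (carrier G) (cayley_edges G S) < 1 \<and>
         (AE \<omega> in percolation (cayley_edges G S)
                     (uniqueness_threshold (carrier G) (cayley_edges G S)).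
            \<not> unique_infinite_cluster (carrier G) (cayley_edges G S) \<omega>)"
proof -
  interpret group G by fact
  interpret cayley G S
    by unfold_locales (fact assms)+
  show ?thesis by (rule uniqueness_threshold_if_not_haagerup[OF assms(3,8)])
qed

end
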